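(* Let $T>0$ and $A:\Delta_2(0,T)\to\mathbb R^m$ be measurable. (a) Let $0<p_1,p_2,q_1,q_2\le\infty$, $0<\alpha<1$, $\gamma>1\vee\frac1{p_2}$, $p_2<p_1$, $\gamma-\frac1{p_2}>\alpha-\frac1{p_1}$, and $\|A\|_{\mathbb B^\alpha_{p_1,q_1}([0,T])}+\|\delta A\|_{\overline{\mathbb B}^\gamma_{p_2,q_2}([0,T])}<\infty$. Assume that for some $\theta\in(0,1/2)$ and $M>0$ and all $(s,u,t)\in\Delta_3(0,T)$, $$|\delta A_{sut}|\le M\big((u-s)\wedge(t-u)\big)^{\theta(\gamma-1/p_2)}\big((u-s)\vee(t-u)\big)^{(1-\theta)(\gamma-1/p_2)}.$$ Let $\mathscr IA$ and $\mathscr RA$ be the generalized integral and remainder of $A$ (see context). Then $$\|\mathscr RA\|_{\mathbb C^{\gamma-1/p_2}([0,T])}\lesssim_{p_2,q_2,\gamma,\theta}\|\delta A\|_{\overline{\mathbb B}^\gamma_{p_2,q_2}}+M$$ and $$[\mathscr IA]_{B^\alpha_{p_1,q_1\vee q_2}([0,T])}\lesssim_{p_1,p_2,q_1,q_2,\alpha,\gamma,\theta}\|A\|_{\mathbb B^\alpha_{p_1,q_1}}+T^{\gamma-\frac1{p_2}-\alpha+\frac1{p_1}}\Big(\|\delta A\|_{\overline{\mathbb B}^\gamma_{p_2,q_2}}+M\Big).$$ (b) Let $0<q_2\le1<p_2<p_1\le\infty$, $0<q_1\le\infty$, $0<\alpha<1$, $1-\frac1{p_2}>\alpha-\frac1{p_1}$,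 and $\|A\|_{\mathbb B^\alpha_{p_1,q_1}([0,T])}+\|\delta A\|_{\overline{\mathbb B}^1_{p_2,q_2}([0,T])}<\infty$. Let $(\ell_r)_{0<r\le\infty}$ be a fixed log-like family and $\omega_{q_2}(h)=h\,\ell_{q_2}(h)$ (see context). Assume that for some $M>0$, $\theta\in(0,1/2)$ and all $(s,u,t)\in\Delta_3(0,T)$, $$|\delta A_{sut}|\le M\big((u-s)\wedge(t-u)\big)^{\theta(1-1/p_2)}\big((u-s)\vee(t-u)\big)^{(1-\theta)(1-1/p_2)}.$$ Then, with $\mathscr IA$, $\mathscr RA$ the generalized integral and remainder of $A$, and with implicit constants that may also depend on the family $(\ell_r)$, $$\sup_{0\le s<t\le T}\frac{|\mathscr RA_{st}|}{\omega_{q_2}(t-s)(t-s)^{-1/p_2}}\lesssim_{p_2,q_2,\theta}\|\delta A\|_{\overline{\mathbb B}^1_{p_2,q_2}}+M$$ and $$[\mathscr IA]_{B^\alpha_{p_1,q_1\vee q_2}([0,T])}\lesssim_{p_1,p_2,q_1,q_2,\alpha,\theta}\|A\|_{\mathbb B^\alpha_{p_1,q_1}}+T^{1-\frac1{p_2}-\alpha+\frac1{p_1}}\ell_{q_2}(T)\Big(\|\delta A\|_{\overline{\mathbb B}^1_{p_2,q_2}}+M\Big).$$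
   Context: Notation: $\Delta_2(0,T)=\{(s,t)\in[0,T]^2:s\le t\}$, $\Delta_3(0,T)=\{(s,u,t)\in[0,T]^3: s\le u\le t\}$. For a path $f$, $\delta f_{st}=f_t-f_s$; for $A:\Delta_2(0,T)\to\mathbb R^m$, $\delta A_{sut}=A_{st}-A_{su}-A_{ut}$. $\lesssim_{a,b,\dots}$ means $\le C\,\cdot$ with $C$ depending only on $a,b,\dots$. $1/\infty=0$; exponents $\infty$ are read as (essential) suprema. Functions are identified if equal a.e.; pointwise bounds on $\mathscr RA$ refer to a (continuous) version. Besov spaces: for measurable $f:[0,T]\to\mathbb R^m$, $\omega_p(f,\tau)=\sup_{0\le h\le\tau}\big(\int_0^{T-h}|f_{s+h}-f_s|^p\,ds\big)^{1/p}$, $[f]_{B^\alpha_{pq}([0,T])}=\big[\int_0^T(\omega_p(f,\tau)/\tau^\alpha)^q\frac{d\tau}\tau\big]^{1/q}$, $f\in B^\alpha_{pq}$ iff $f\in L^p$ and $[f]_{B^\alpha_{pq}}<\infty$. For measurable $A$ on $\Delta_2(0,T)$, $\Omega_p(A,\tau)=\sup_{0\le h\le\tau}\big(\int_0^{T-h}|A_{r,r+h}|^p\,dr\big)^{1/p}$, $\|A\|_{\mathbb B^\omega_{pq}}=\big[\int_0^T(\Omega_p(A,\tau)/\omega(\tau))^q\frac{d\tau}\tau\big]^{1/q}$, $\mathbb B^\alpha_{pq}$ being the case $\omega(\tau)=\tau^\alpha$, and $\mathbb C^\alpha=\mathbb B^\alpha_{\infty,\infty}$. For $B$ on $\Delta_3(0,T)$,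 $\overline\Omega_p(B,\tau)=\sup_{0\le\theta\le1}\sup_{0\le h\le\tau}\big(\int_0^{T-h}|B_{r,r+\theta h,r+h}|^p\,dr\big)^{1/p}$ and $\|B\|_{\overline{\mathbb B}^\gamma_{pq}}=\big[\int_0^T(\overline\Omega_p(B,\tau)/\tau^\gamma)^q\frac{d\tau}\tau\big]^{1/q}$. Generalized integral: for a partition $P=\{0=\tau_0<\dots<\tau_N=1\}$ of $[0,1]$ with mesh $\|P\|$, let $\mathscr I_PA_{st}=\sum_{i=1}^NA_{s+\tau_{i-1}(t-s),\,s+\tau_i(t-s)}$ and $\mathscr R_PA=\mathscr I_PA-A$. If either $\gamma>1\vee\frac1{p_2}$ (case (a)), or $\gamma=1\vee\frac1{p_2}$ and $q_2\le1\wedge p_2$ (case (b), with $\gamma=1$), the finiteness assumption on $A$ ensures that there are a path $\mathscr IA:[0,T]\to\mathbb R^m$ in $B^\alpha_{p_1\wedge p_2,q_1\vee q_2}$ (unique up to additive constants) and a two-parameter map $\mathscr RA$ with $\mathscr I_PA\to\delta\mathscr IA$ and $\mathscr R_PA\to\mathscr RA=\delta\mathscr IA-A$ in $\mathbb B^\gamma_{p_2,\infty}([0,T])$ as $\|P\|\to0$. Log-like functions: $(\ell_r)_{0<r\le\infty}$ is a fixed family of functions $\ell_r:(0,T]\to(0,\infty)$ such that, for each $r$, $\ell_r$ is non-increasing; $\int_0^T\ell_r(h)^{-r}\frac{dh}h<\infty$ (for $r=\infty$: $\sup 1/\ell_\infty<\infty$); and for all $\eta,\zeta>0$, $\delta\in(0,T]$,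 $\int_0^\delta\ell_r(h)^\eta h^\zeta\frac{dh}h\lesssim_{r,\eta,\zeta}\ell_r(\delta)^\eta\delta^\zeta$. *)

theory Defs
  imports "HOL-Analysis.Analysis" "HOL-Probability.Essential_Supremum"
begin

text \<open>
  Integrability exponents in \<open>(0,\<infinity>]\<close> have type \<^typ>\<open>ennreal\<close>. A vector of \<open>\<real>\<^sup>m\<close> is a function
  \<^typ>\<open>nat \<Rightarrow> real\<close> of which only the components \<open>i < m\<close> are ever looked at; in this way \<open>m\<close> is a
  natural number that can be quantified after the implicit constants, which do not depend on it.
  A map on the simplex \<open>\<Delta>\<^sub>2(0,T)\<close> (or \<open>\<Delta>\<^sub>3(0,T)\<close>) is a total function whose values outside the
  simplex are never used. Measurable means Borel measurable.
\<close>

definition recip :: "ennreal \<Rightarrow> real" where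
  "recip p = enn2real (1 / p)"

text \<open>The power \<open>x\<^sup>a\<close> on \<open>[0,\<infinity>]\<close>, for exponents \<open>a > 0\<close> only.\<close>

definition ennpowr :: "ennreal \<Rightarrow> real \<Rightarrow> ennreal" where
  "ennpowr x a = (if x = \<infinity> then \<infinity> else ennreal (enn2real x powr a))"

definition Lp_norm :: "'a measure \<Rightarrow> ennreal \<Rightarrow> ('a \<Rightarrow> ennreal) \<Rightarrow> ennreal" where
  "Lp_norm N p f =
     (if p = \<infinity> then esssup N f
      else ennpowr (\<integral>\<^sup>+x. ennpowr (f x) (enn2real p) \<partial>N) (1 / enn2real p))"

text \<open>The measure \<open>d\<tau>/\<tau>\<close> on \<open>(0,T]\<close>.\<close>

definition log_measure :: "real \<Rightarrow> real measure" where
  "log_measure T = density (restrict_space lborel {0<..T}) (\<lambda>\<tau>. ennreal (1 / \<tau>))"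

definition vnorm :: "nat \<Rightarrow> (nat \<Rightarrow> real) \<Rightarrow> real" where
  "vnorm m x = L2_set x {..<m}"

definition Delta2 :: "real \<Rightarrow> (real \<times> real) set" where
  "Delta2 T = {(s, t). 0 \<le> s \<and> s \<le> t \<and> t \<le> T}"

definition Delta3 :: "real \<Rightarrow> (real \<times> real \<times> real) set" where
  "Delta3 T = {(s, u, t). 0 \<le> s \<and> s \<le> u \<and> u \<le> t \<and> t \<le> T}"

definition path_incr :: "(real \<Rightarrow> nat \<Rightarrow> real) \<Rightarrow> real \<Rightarrow> real \<Rightarrow> nat \<Rightarrow> real" where
  "path_incr f s t = (\<lambda>i. f t i - f s i)"

definition delta :: "(real \<Rightarrow> real \<Rightarrow> nat \<Rightarrow> real) \<Rightarrow> real \<Rightarrow> real \<Rightarrow> real \<Rightarrow> nat \<Rightarrow> real" where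
  "delta A s u t = (\<lambda>i. A s t i - A s u i - A u t i)"

definition path_measurable :: "real \<Rightarrow> nat \<Rightarrow> (real \<Rightarrow> nat \<Rightarrow> real) \<Rightarrow> bool" where
  "path_measurable T m f \<longleftrightarrow>
     (\<forall>i<m. (\<lambda>t. f t i) \<in> borel_measurable (restrict_space borel {0..T}))"

definition map2_measurable :: "real \<Rightarrow> nat \<Rightarrow> (real \<Rightarrow> real \<Rightarrow> nat \<Rightarrow> real) \<Rightarrow> bool" where
  "map2_measurable T m A \<longleftrightarrow>
     (\<forall>i<m. (\<lambda>(s, t). A s t i) \<in> borel_measurable (restrict_space borel (Delta2 T)))"

definition Omega ::
  "real \<Rightarrow> nat \<Rightarrow> ennreal \<Rightarrow> (real \<Rightarrow> real \<Rightarrow> nat \<Rightarrow> real) \<Rightarrow> real \<Rightarrow> ennreal" where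
  "Omega T m p A \<tau> =
     (SUP h\<in>{0..\<tau>}. Lp_norm (restrict_space lborel {0..T - h}) p
        (\<lambda>r. ennreal (vnorm m (A r (r + h)))))"

definition Omega3 ::
  "real \<Rightarrow> nat \<Rightarrow> ennreal \<Rightarrow> (real \<Rightarrow> real \<Rightarrow> real \<Rightarrow> nat \<Rightarrow> real) \<Rightarrow> real \<Rightarrow> ennreal" where
  "Omega3 T m p B \<tau> =
     (SUP \<theta>\<in>{0..1}. SUP h\<in>{0..\<tau>}. Lp_norm (restrict_space lborel {0..T - h}) p
        (\<lambda>r. ennreal (vnorm m (B r (r + \<theta> * h) (r + h)))))"

definition BB_norm ::
  "real \<Rightarrow> nat \<Rightarrow> real \<Rightarrow> ennreal \<Rightarrow> ennreal \<Rightarrow> (real \<Rightarrow> real \<Rightarrow> nat \<Rightarrow> real) \<Rightarrow> ennreal" where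
  "BB_norm T m \<alpha> p q A =
     Lp_norm (log_measure T) q (\<lambda>\<tau>. Omega T m p A \<tau> / ennreal (\<tau> powr \<alpha>))"

definition BB3_norm ::
  "real \<Rightarrow> nat \<Rightarrow> real \<Rightarrow> ennreal \<Rightarrow> ennreal \<Rightarrow> (real \<Rightarrow> real \<Rightarrow> real \<Rightarrow> nat \<Rightarrow> real) \<Rightarrow> ennreal" where
  "BB3_norm T m \<gamma> p q B =
     Lp_norm (log_measure T) q (\<lambda>\<tau>. Omega3 T m p B \<tau> / ennreal (\<tau> powr \<gamma>))"

definition CC_norm :: "real \<Rightarrow> nat \<Rightarrow> real \<Rightarrow> (real \<Rightarrow> real \<Rightarrow> nat \<Rightarrow> real) \<Rightarrow> ennreal" where
  "CC_norm T m \<alpha> A = BB_norm T m \<alpha> \<infinity> \<infinity> A"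

text \<open>The modulus of continuity \<open>\<omega>\<^sub>p(f,\<tau>)\<close> of a path is literally
  \<^term>\<open>Omega T m p (path_incr f) \<tau>\<close>.\<close>

definition Besov_seminorm ::
  "real \<Rightarrow> nat \<Rightarrow> real \<Rightarrow> ennreal \<Rightarrow> ennreal \<Rightarrow> (real \<Rightarrow> nat \<Rightarrow> real) \<Rightarrow> ennreal" where
  "Besov_seminorm T m \<alpha> p q f = BB_norm T m \<alpha> p q (path_incr f)"

definition Besov_space ::
  "real \<Rightarrow> nat \<Rightarrow> real \<Rightarrow> ennreal \<Rightarrow> ennreal \<Rightarrow> (real \<Rightarrow> nat \<Rightarrow> real) set" where
  "Besov_space T m \<alpha> p q =
     {f. path_measurable T m f \<and>
         Lp_norm (restrict_space lborel {0..T}) p (\<lambda>t. ennreal (vnorm m (f t))) < \<infinity> \<and>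
         Besov_seminorm T m \<alpha> p q f < \<infinity>}"

text \<open>Partitions \<open>0 = \<pi> 0 < \<dots> < \<pi> N = 1\<close> of the unit interval.\<close>

definition unit_partition :: "nat \<Rightarrow> (nat \<Rightarrow> real) \<Rightarrow> bool" where
  "unit_partition N \<pi> \<longleftrightarrow> \<pi> 0 = 0 \<and> \<pi> N = 1 \<and> strict_mono_on {..N} \<pi>"

definition mesh :: "nat \<Rightarrow> (nat \<Rightarrow> real) \<Rightarrow> real" where
  "mesh N \<pi> = Max ((\<lambda>i. \<pi> (Suc i) - \<pi> i) ` {..<N})"

definition partition_sum ::
  "nat \<Rightarrow> (nat \<Rightarrow> real) \<Rightarrow> (real \<Rightarrow> real \<Rightarrow> nat \<Rightarrow> real) \<Rightarrow> real \<Rightarrow> real \<Rightarrow> nat \<Rightarrow> real" where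
  "partition_sum N \<pi> A s t =
     (\<lambda>i. \<Sum>k<N. A (s + \<pi> k * (t - s)) (s + \<pi> (Suc k) * (t - s)) i)"

text \<open>\<open>I\<close> is a generalized integral of \<open>A\<close>: a path in the Besov space with exponents
  \<open>p\<^sub>1 \<and> p\<^sub>2\<close>, \<open>q\<^sub>1 \<or> q\<^sub>2\<close> whose increments are the limit of the partition sums of \<open>A\<close> with respect to
  the norm with exponents \<open>\<gamma>, p\<^sub>2, \<infinity>\<close>, as the mesh tends to 0. The convergence of the remainders
  is the same statement, because \<open>A\<close> cancels in their difference.\<close>

definition generalized_integral ::
  "real \<Rightarrow> nat \<Rightarrow> ennreal \<Rightarrow> ennreal \<Rightarrow> ennreal \<Rightarrow> ennreal \<Rightarrow> real \<Rightarrow> real \<Rightarrow>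
   (real \<Rightarrow> real \<Rightarrow> nat \<Rightarrow> real) \<Rightarrow> (real \<Rightarrow> nat \<Rightarrow> real) \<Rightarrow> bool" where
  "generalized_integral T m p1 p2 q1 q2 \<alpha> \<gamma> A I \<longleftrightarrow>
     I \<in> Besov_space T m \<alpha> (min p1 p2) (max q1 q2) \<and>
     (\<forall>\<epsilon>>0. \<exists>d>0. \<forall>N \<pi>. unit_partition N \<pi> \<and> mesh N \<pi> < d \<longrightarrow>
        BB_norm T m \<gamma> p2 \<infinity> (\<lambda>s t i. partition_sum N \<pi> A s t i - path_incr I s t i)
          < ennreal \<epsilon>)"

definition remainder ::
  "(real \<Rightarrow> real \<Rightarrow> nat \<Rightarrow> real) \<Rightarrow> (real \<Rightarrow> nat \<Rightarrow> real) \<Rightarrow> real \<Rightarrow> real \<Rightarrow> nat \<Rightarrow> real" where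
  "remainder A I s t = (\<lambda>i. path_incr I s t i - A s t i)"

text \<open>Equality almost everywhere on every line \<open>t - s = h\<close>, which is the identification made by
  the norms \<^const>\<open>BB_norm\<close>.\<close>

definition continuous_version ::
  "real \<Rightarrow> nat \<Rightarrow> (real \<Rightarrow> real \<Rightarrow> nat \<Rightarrow> real) \<Rightarrow> (real \<Rightarrow> real \<Rightarrow> nat \<Rightarrow> real) \<Rightarrow> bool" where
  "continuous_version T m R R' \<longleftrightarrow>
     (\<forall>i<m. continuous_on (Delta2 T) (\<lambda>(s, t). R' s t i)) \<and>
     (\<forall>h\<in>{0..T}. AE r in restrict_space lborel {0..T - h}. \<forall>i<m. R' r (r + h) i = R r (r + h) i)"

definition delta_bound ::
  "real \<Rightarrow> nat \<Rightarrow> real \<Rightarrow> real \<Rightarrow> real \<Rightarrow> (real \<Rightarrow> real \<Rightarrow> nat \<Rightarrow> real) \<Rightarrow> bool" where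
  "delta_bound T m \<theta> \<kappa> M A \<longleftrightarrow>
     (\<forall>(s, u, t)\<in>Delta3 T. vnorm m (delta A s u t)
        \<le> M * min (u - s) (t - u) powr (\<theta> * \<kappa>) * max (u - s) (t - u) powr ((1 - \<theta>) * \<kappa>))"

definition log_like :: "real \<Rightarrow> (ennreal \<Rightarrow> real \<Rightarrow> real) \<Rightarrow> bool" where
  "log_like T l \<longleftrightarrow>
     (\<forall>r>0.
        (\<forall>h\<in>{0<..T}. 0 < l r h) \<and>
        antimono_on {0<..T} (l r) \<and>
        (if r = \<infinity> then bdd_above ((\<lambda>h. 1 / l r h) ` {0<..T})
         else (\<integral>\<^sup>+h. ennreal (l r h powr (- enn2real r)) \<partial>log_measure T) < \<infinity>) \<and>
        (\<forall>\<eta>>0. \<forall>\<zeta>>0. \<exists>C. \<forall>d\<in>{0<..T}.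
           (\<integral>\<^sup>+h. ennreal (l r h powr \<eta> * h powr \<zeta>) \<partial>log_measure d)
             \<le> ennreal (C * l r d powr \<eta> * d powr \<zeta>)))"

end

theory Submission
  imports Defs
begin

text \<open>
  Write \<open>R = \<delta>I - A\<close>, \<open>p = p\<^sub>2\<close> and \<open>\<kappa> = \<gamma> - 1/p\<close>. Dyadic sewing bounds the \<open>L\<^sup>p\<close> norm of \<open>R\<close> on each line
  \<open>t - s = h\<close>, \<open>h \<le> T/2\<close>, by a multiple of \<open>h\<close> to the power \<open>\<gamma>\<close>. Since \<open>\<delta>R = -\<delta>A\<close> is pointwise at most of
  order \<open>t - s\<close> to the power \<open>\<kappa>\<close>, the function \<open>|R|\<close> is subadditive up to such an error. Averaging this over dyadically
  shrinking windows at the two end points of \<open>[s,t]\<close> turns the integral bound into a pointwise bound of order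
  \<open>\<kappa>\<close> for \<open>s, t\<close> in a set of full measure: the averages over the windows are summable, hence tend to 0, at
  almost every end point. The bound extends to a continuous version by uniform continuity, and interpolation between
  \<open>L\<^sup>p\<close> and \<open>L\<^sup>\<infinity>\<close> gives the Besov estimate of \<open>I\<close>. In the critical case the same argument gives a bound without
  the logarithmic factor, which is at least \<open>\<ell>(T)\<close>; the constants absorb \<open>1/\<ell>(T)\<close>.
\<close>

section \<open>\<open>L\<^sup>p\<close> quasi-norms with exponents in \<open>(0,\<infinity>]\<close>\<close>

text \<open>The \<open>L^p\<close> bound lives on lines \<open>t - s = h\<close> and says nothing
  about a fixed end point. If both end points range over windows of length comparable to
  \<open>H\<close>, the difference can serve as a coordinate and Fubini gives a bound on a rectangle
  of area of order \<open>H\<^sup>2\<close>. Since \<open>(\<gamma> - \<kappa>) * p = 1\<close>, the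
  mean of \<open>|R|\<close> to the power \<open>p\<close> over it is of order
  \<open>H powr (\<kappa> * p)\<close>, which matches the pointwise error. At a fixed end point no
  second variable is left to average over; there the windows are compared with windows of half the
  size, and the resulting errors form a geometric series. Two obstacles shape the details. First,
  \<open>p\<close> may be below 1, so chaining is done for \<open>|R|\<close> to the power
  \<open>min 1 p\<close>, which is subadditive and still controlled by the power \<open>p\<close>.
  Second, the norms with respect to \<open>d\<tau>/\<tau>\<close> on \<open>(0,T]\<close> control
  the moduli only up to \<open>T/2\<close>, so every longer interval has to be cut into pieces of
  length at most \<open>T/2\<close>. The norm \<open>\<Phi>\<close> of \<open>\<delta>A\<close> and
  \<open>M\<close> are merged early into one number \<open>K = c * (\<Phi> + M)\<close>, which
  serves both the integral bound and the pointwise bound; the constants multiplying \<open>K\<close>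
  then depend on exponents only.\<close>

lemma ennpowr_ennreal: "0 \<le> c \<Longrightarrow> ennpowr (ennreal c) a = ennreal (c powr a)"
  by (simp add: ennpowr_def)

lemma ennpowr_0 [simp]: "ennpowr 0 a = 0"
  using ennpowr_ennreal[of 0 a] by simp

lemma ennpowr_top [simp]: "ennpowr top a = top"
  by (simp add: ennpowr_def)

lemma ennpowr_1 [simp]: "ennpowr x 1 = x"
  by (cases x) (simp_all add: ennpowr_ennreal)

lemma ennpowr_mono:
  assumes "x \<le> y" "0 \<le> a"
  shows "ennpowr x a \<le> ennpowr y a"
proof (cases y)
  case (real r)
  with assms obtain s where "x = ennreal s" "0 \<le> s" by (cases x) (auto simp: top_unique)
  with real assms show ?thesis by (simp add: ennpowr_ennreal powr_mono2)
qed simp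

lemma ennpowr_ennpowr: "ennpowr (ennpowr x a) b = ennpowr x (a * b)"
  by (cases x) (simp_all add: ennpowr_ennreal powr_powr)

lemma ennpowr_mult:
  assumes "0 < a"
  shows "ennpowr (x * y) a = ennpowr x a * ennpowr y a"
proof -
  consider "x = 0 \<or> y = 0" | "x \<noteq> 0" "y \<noteq> 0" "x = top \<or> y = top"
    | r s where "x = ennreal r" "y = ennreal s" "0 \<le> r" "0 \<le> s"
    by (cases x; cases y) auto
  then show ?thesis
  proof cases
    case 2
    have nz: "ennpowr z a \<noteq> 0" if "z \<noteq> 0" for z
      using that by (cases z) (auto simp: ennpowr_ennreal)
    from 2(3) show ?thesis
      using nz[OF 2(1)] nz[OF 2(2)] 2(1,2) by (elim disjE) (simp_all add: ennreal_mult_top ennreal_top_mult)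
  next
    case 3
    then show ?thesis
      by (simp add: ennreal_mult[symmetric] ennpowr_ennreal powr_mult)
  qed auto
qed

lemma divide_ennreal_eq_mult: "0 < c \<Longrightarrow> x / ennreal c = x * ennreal (1 / c)"
  by (simp add: divide_ennreal_def inverse_ennreal inverse_eq_divide)

lemma ennpowr_le_iff:
  assumes "0 < a"
  shows "ennpowr x (1 / a) \<le> y \<longleftrightarrow> x \<le> ennpowr y a"
proof
  assume "ennpowr x (1 / a) \<le> y"
  from ennpowr_mono[OF this, of a] show "x \<le> ennpowr y a"
    using assms by (simp add: ennpowr_ennpowr)
next
  assume "x \<le> ennpowr y a"
  from ennpowr_mono[OF this, of "1/a"] show "ennpowr x (1 / a) \<le> y"
    using assms by (simp add: ennpowr_ennpowr)
qed

lemma ennpowr_add_le: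
  assumes "0 < a"
  shows "ennpowr (x + y) a \<le> ennreal (2 powr a) * (ennpowr x a + ennpowr y a)"
proof -
  have "x + y \<le> 2 * max x y"
    by (metis add_mono max.cobounded1 max.cobounded2 mult_2)
  then have "ennpowr (x + y) a \<le> ennpowr 2 a * ennpowr (max x y) a"
    using ennpowr_mono[of "x+y" "2 * max x y" a] assms by (simp add: ennpowr_mult)
  also have "ennpowr (max x y) a \<le> ennpowr x a + ennpowr y a"
    by (simp add: max_def add_increasing add_increasing2)
  also have "ennpowr 2 a = ennreal (2 powr a)"
    using ennpowr_ennreal[of 2 a] by simp
  finally show ?thesis by (simp add: mult_left_mono)
qed

lemma ennpowr_measurable [measurable]:
  assumes "f \<in> borel_measurable M"
  shows "(\<lambda>x. ennpowr (f x) a) \<in> borel_measurable M"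
  unfolding ennpowr_def using assms by measurable

lemma ennreal_exponent_cases:
  assumes "0 < (p::ennreal)"
  obtains (infinite) "p = top" "recip p = 0"
    | (finite) r where "0 < r" "p = ennreal r" "enn2real p = r" "recip p = 1 / r"
proof (cases p)
  case (real r)
  then have "0 < r" using assms by auto
  moreover then have "recip p = 1 / r"
    unfolding recip_def real(2) ennreal_1[symmetric] using real
    by (subst divide_ennreal) auto
  ultimately show ?thesis using real finite by auto
qed (auto simp: recip_def intro!: infinite)

lemma Lp_norm_infinity_le_iff:
  assumes "f \<in> borel_measurable N"
  shows "Lp_norm N top f \<le> c \<longleftrightarrow> (AE x in N. f x \<le> c)"
proof
  assume "Lp_norm N top f \<le> c"
  then show "AE x in N. f x \<le> c"
    using esssup_AE[of f N] by (auto simp: Lp_norm_def elim!: eventually_mono)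
qed (use assms in \<open>auto simp: Lp_norm_def\<close>)

lemma Lp_norm_infinity_imp_AE: "Lp_norm N top f \<le> c \<Longrightarrow> AE x in N. f x \<le> c"
  using esssup_AE[of f N] by (auto simp: Lp_norm_def elim!: eventually_mono)

lemma Lp_norm_finite_le_iff:
  assumes "0 < r"
  shows "Lp_norm N (ennreal r) f \<le> c \<longleftrightarrow> (\<integral>\<^sup>+x. ennpowr (f x) r \<partial>N) \<le> ennpowr c r"
  using assms by (simp add: Lp_norm_def ennpowr_le_iff)

lemma Lp_norm_mono_AE:
  assumes "0 < p" "f \<in> borel_measurable N" "AE x in N. f x \<le> g x"
  shows "Lp_norm N p f \<le> Lp_norm N p g"
  using assms(1)
proof (cases rule: ennreal_exponent_cases)
  case infinite
  then show ?thesis using assms by (auto simp: Lp_norm_def intro: esssup_AE_mono)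
next
  case (finite r)
  have "(\<integral>\<^sup>+x. ennpowr (f x) r \<partial>N) \<le> (\<integral>\<^sup>+x. ennpowr (g x) r \<partial>N)"
    using assms(3) finite
    by (intro nn_integral_mono_AE) (auto elim!: eventually_mono intro: ennpowr_mono)
  then show ?thesis using finite by (simp add: Lp_norm_def ennpowr_mono)
qed

lemma Lp_norm_cmult_le:
  assumes "0 < p" "f \<in> borel_measurable N" "0 < c"
  shows "Lp_norm N p (\<lambda>x. ennreal c * f x) \<le> ennreal c * Lp_norm N p f"
  using assms(1)
proof (cases rule: ennreal_exponent_cases)
  case infinite
  have "AE x in N. ennreal c * f x \<le> ennreal c * Lp_norm N p f"
    using Lp_norm_infinity_imp_AE[of N f "Lp_norm N p f"] infinite
    by (auto elim!: eventually_mono intro: mult_left_mono)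
  then show ?thesis
    using infinite assms(2) by (auto simp: Lp_norm_infinity_le_iff)
next
  case (finite r)
  have "(\<integral>\<^sup>+x. ennpowr (ennreal c * f x) r \<partial>N) = ennpowr (ennreal c) r * (\<integral>\<^sup>+x. ennpowr (f x) r \<partial>N)"
    using finite assms by (simp add: ennpowr_mult nn_integral_cmult)
  then show ?thesis using finite assms by (simp add: Lp_norm_def ennpowr_mult ennpowr_ennpowr)
qed

text \<open>The first factor 2 comes from \<open>ennpowr_add_le\<close>, the second factor from
  adding two equal integrals of \<open>p\<close>-th powers. The value is not sharp, but it covers
  \<open>p < 1\<close> and \<open>p = \<infinity>\<close> at once.\<close>

definition quasi_const :: "ennreal \<Rightarrow> real" where
  "quasi_const p = 2 * 2 powr recip p"

lemma quasi_const_pos [simp]: "0 < quasi_const p"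
  by (simp add: quasi_const_def)

lemma Lp_norm_add_le:
  assumes "0 < p" and [measurable]: "f \<in> borel_measurable N" "g1 \<in> borel_measurable N" "g2 \<in> borel_measurable N"
    and le: "AE x in N. f x \<le> g1 x + g2 x"
  shows "Lp_norm N p f \<le> ennreal (quasi_const p) * (Lp_norm N p g1 + Lp_norm N p g2)"
  using assms(1)
proof (cases rule: ennreal_exponent_cases)
  case infinite
  have "AE x in N. f x \<le> Lp_norm N p g1 + Lp_norm N p g2"
    using le Lp_norm_infinity_imp_AE[where f=g1 and N=N, OF order_refl] Lp_norm_infinity_imp_AE[where f=g2 and N=N, OF order_refl]
    unfolding infinite(1) infinity_ennreal_def
    by eventually_elim (meson add_mono order_trans order_refl)
  then have "Lp_norm N p f \<le> 1 * (Lp_norm N p g1 + Lp_norm N p g2)"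
    using infinite by (simp add: Lp_norm_infinity_le_iff)
  also have "\<dots> \<le> ennreal (quasi_const p) * (Lp_norm N p g1 + Lp_norm N p g2)"
    by (intro mult_right_mono) (use infinite in \<open>auto simp: quasi_const_def\<close>)
  finally show ?thesis .
next
  case (finite r)
  define G where "G = Lp_norm N p g1 + Lp_norm N p g2"
  have *: "(\<integral>\<^sup>+x. ennpowr (g x) r \<partial>N) \<le> ennpowr G r" if "g = g1 \<or> g = g2" for g
  proof -
    have "Lp_norm N p g \<le> G" using that by (auto simp: G_def)
    then show ?thesis using Lp_norm_finite_le_iff[of r N g G] finite by simp
  qed
  have "(\<integral>\<^sup>+x. ennpowr (f x) r \<partial>N) \<le> (\<integral>\<^sup>+x. ennreal (2 powr r) * (ennpowr (g1 x) r + ennpowr (g2 x) r) \<partial>N)"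
    using le finite
    by (intro nn_integral_mono_AE) (auto elim!: eventually_mono intro: order_trans[OF ennpowr_mono ennpowr_add_le])
  also have "\<dots> = ennreal (2 powr r) * ((\<integral>\<^sup>+x. ennpowr (g1 x) r \<partial>N) + (\<integral>\<^sup>+x. ennpowr (g2 x) r \<partial>N))"
    by (simp add: nn_integral_cmult nn_integral_add)
  also have "\<dots> \<le> ennreal (2 powr r) * (ennpowr G r + ennpowr G r)"
    using *[of g1] *[of g2] by (intro mult_left_mono add_mono) auto
  also have "\<dots> = ennreal (quasi_const p powr r) * ennpowr G r"
    using finite by (simp add: quasi_const_def powr_mult powr_powr ennreal_mult mult_2[symmetric] mult.assoc)
  also have "\<dots> = ennpowr (ennreal (quasi_const p) * G) r"
    using finite by (simp add: ennpowr_mult ennpowr_ennreal less_imp_le)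
  finally show ?thesis
    using finite Lp_norm_finite_le_iff[of r N f "ennreal (quasi_const p) * G"] by (simp add: G_def)
qed

text \<open>For finite exponents \<open>s \<le> r\<close>, interpolation by
  \<open>y powr r \<le> b powr (r - s) * y powr s\<close> on \<open>[0,b]\<close>; for
  \<open>q' = \<infinity>\<close> the last factor is 1 because \<open>recip\<close> vanishes. It
  serves twice: between \<open>L^p\<close> and \<open>L^\<infinity>\<close> for the remainder, and
  with \<open>c = b\<close> as the embedding from \<open>q1\<close> into a larger exponent over
  \<open>log_measure\<close>.\<close>

lemma Lp_norm_le_of_smaller_exponent:
  assumes "0 < q" "q \<le> q'" "0 < b" and [measurable]: "g \<in> borel_measurable N"
    and bd: "AE x in N. g x \<le> ennreal b" and q: "Lp_norm N q g \<le> ennreal c" "0 < c"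
  shows "Lp_norm N q' g \<le> ennreal (b * (c / b) powr (enn2real q * recip q'))"
proof -
  have "0 < q'" using assms by auto
  then show ?thesis
  proof (cases rule: ennreal_exponent_cases)
    case infinite
    then show ?thesis using bd assms by (auto simp: Lp_norm_infinity_le_iff)
  next
    case (finite r)
    then obtain s where s: "0 < s" "q = ennreal s" "s \<le> r"
      using assms(1,2) by (cases q) (auto simp: top_unique)
    have "ennpowr y r \<le> ennreal (b powr (r - s)) * ennpowr y s" if y: "y \<le> ennreal b" for y
    proof -
      obtain z where z: "y = ennreal z" "0 \<le> z" "z \<le> b"
        using y assms(3) by (cases y) (auto simp: top_unique)
      have "z powr r = z powr (r - s) * z powr s" by (simp add: powr_add[symmetric])
      also have "\<dots> \<le> b powr (r - s) * z powr s"
        using z s by (intro mult_right_mono powr_mono2) auto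
      finally show ?thesis using z by (simp add: ennpowr_ennreal ennreal_mult[symmetric])
    qed
    then have "(\<integral>\<^sup>+x. ennpowr (g x) r \<partial>N) \<le> (\<integral>\<^sup>+x. ennreal (b powr (r - s)) * ennpowr (g x) s \<partial>N)"
      using bd by (intro nn_integral_mono_AE) (auto elim!: eventually_mono)
    also have "\<dots> = ennreal (b powr (r - s)) * (\<integral>\<^sup>+x. ennpowr (g x) s \<partial>N)"
      by (simp add: nn_integral_cmult)
    also have "\<dots> \<le> ennreal (b powr (r - s)) * ennreal (c powr s)"
      using q s Lp_norm_finite_le_iff[of s N g "ennreal c"]
      by (intro mult_left_mono) (auto simp: ennpowr_ennreal)
    also have "\<dots> = ennreal ((b * (c / b) powr (s * (1 / r))) powr r)"
      using assms finite
      by (simp add: ennreal_mult[symmetric] powr_mult powr_powr powr_divide powr_diff)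
    finally show ?thesis
      using finite s assms Lp_norm_finite_le_iff[of r N g "ennreal (b * (c / b) powr (s * (1 / r)))"]
      by (simp add: ennpowr_ennreal)
  qed
qed

section \<open>Monotone functions and the measure \<open>d\<tau>/\<tau>\<close>\<close>

lemma space_log_measure [simp]: "space (log_measure T) = {0<..T}"
  by (simp add: log_measure_def space_restrict_space)

lemma sets_log_measure [measurable_cong]:
  "sets (log_measure T) = sets (restrict_space borel {0<..T})"
  by (simp add: log_measure_def sets_restrict_space)

lemma log_density_measurable [measurable]:
  "(\<lambda>\<tau>. ennreal (1 / \<tau>)) \<in> borel_measurable (restrict_space lborel {0<..T})"
  by (intro measurable_restrict_space1) measurable

lemma nn_integral_log_measure:
  assumes "f \<in> borel_measurable (log_measure T)"
  shows "(\<integral>\<^sup>+\<tau>. f \<tau> \<partial>log_measure T) = (\<integral>\<^sup>+\<tau>. ennreal (1 / \<tau>) * f \<tau> * indicator {0<..T} \<tau> \<partial>lborel)"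
proof -
  have "f \<in> borel_measurable (restrict_space lborel {0<..T})"
    using assms by (simp add: log_measure_def)
  then show ?thesis
    by (simp add: log_measure_def nn_integral_density nn_integral_restrict_space)
qed

lemma AE_log_measure:
  "(AE \<tau> in log_measure T. P \<tau>) \<longleftrightarrow> (AE \<tau> in lborel. \<tau> \<in> {0<..T} \<longrightarrow> P \<tau>)"
  unfolding log_measure_def
  by (subst AE_density, measurable, subst AE_restrict_space_iff) (auto intro!: AE_cong)

lemma AE_lborel_obtain:
  assumes "AE x in lborel. P x" "a < (b::real)"
  obtains x where "a < x" "x < b" "P x"
proof -
  have "\<exists>x. a < x \<and> x < b \<and> P x"
  proof (rule ccontr)
    assume "\<not> ?thesis"
    then have "AE x in lborel. x \<notin> {a<..<b}"
      using assms(1) by (auto elim!: eventually_mono)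
    then have "emeasure lborel {a<..<b} = 0"
      by (subst (asm) AE_iff_measurable[OF _ refl]) (auto simp: greaterThanLessThan_eq Int_def)
    then show False using assms(2) by simp
  qed
  then show thesis using that by blast
qed

text \<open>The moduli \<open>Omega\<close> and \<open>Omega3\<close> are suprema over uncountable
  families, so their measurability is drawn from monotonicity: superlevel sets are
  intervals.\<close>

lemma mono_on_measurable_ennreal:
  fixes f :: "real \<Rightarrow> ennreal"
  assumes "mono_on {0<..T} f"
  shows "f \<in> borel_measurable (log_measure T)"
proof (rule borel_measurableI_greater)
  fix y
  have "is_interval {x \<in> space (log_measure T). y < f x}"
    unfolding is_interval_1 using assms
    by (auto simp: mono_on_def) (meson greaterThanAtMost_iff less_le_trans order_less_le_trans order_trans)
  then have "{x \<in> space (log_measure T). y < f x} \<in> sets borel"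
    by (rule real_interval_borel_measurable)
  then show "{x \<in> space (log_measure T). y < f x} \<in> sets (log_measure T)"
    unfolding sets_log_measure sets_restrict_space
    by (intro image_eqI[where x="{x \<in> space (log_measure T). y < f x}"]) auto
qed

lemma mono_on_quotient_measurable:
  fixes \<phi> :: "real \<Rightarrow> ennreal"
  assumes "mono_on {0<..T} \<phi>"
  shows "(\<lambda>\<tau>. \<phi> \<tau> / ennreal (\<tau> powr \<gamma>)) \<in> borel_measurable (log_measure T)"
proof -
  have [measurable]: "\<phi> \<in> borel_measurable (log_measure T)"
    by (rule mono_on_measurable_ennreal[OF assms])
  have [measurable]: "(\<lambda>\<tau>. \<tau> powr \<gamma>) \<in> borel_measurable (log_measure T)"
    unfolding measurable_cong_sets[OF sets_log_measure refl]
    by (intro measurable_restrict_space1) measurable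
  show ?thesis by measurable
qed

text \<open>With \<open>t = h / 2 ^ n\<close>, the quotient at any \<open>\<tau>\<close> in
  \<open>(t, 2t]\<close> dominates \<open>\<phi> t / (2t) powr \<gamma>\<close>, and
  \<open>d\<tau>/\<tau>\<close> gives this block mass at least 1/2, hence the factor 2. The blocks
  are disjoint, and they lie in \<open>(0,T]\<close> because \<open>h \<le> T / 2\<close>.\<close>

lemma log_measure_dyadic_sum_le:
  fixes \<phi> :: "real \<Rightarrow> ennreal"
  assumes mono: "mono_on {0<..T} \<phi>" and r: "0 < r" and g: "0 < \<gamma>" and h: "0 < h" "h \<le> T / 2"
  shows "(\<Sum>n<N. ennpowr (\<phi> (h / 2 ^ n) / ennreal ((2 * (h / 2 ^ n)) powr \<gamma>)) r)
    \<le> 2 * (\<integral>\<^sup>+\<tau>. ennpowr (\<phi> \<tau> / ennreal (\<tau> powr \<gamma>)) r \<partial>log_measure T)"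
proof -
  define f where "f \<tau> = ennpowr (\<phi> \<tau> / ennreal (\<tau> powr \<gamma>)) r" for \<tau>
  have fm[measurable]: "f \<in> borel_measurable (log_measure T)"
    unfolding f_def by (intro ennpowr_measurable mono_on_quotient_measurable mono)
  define F where "F \<tau> = ennreal (1 / \<tau>) * f \<tau> * indicator {0<..T} \<tau>" for \<tau>
  have "(\<lambda>\<tau>. f \<tau> * indicator {0<..T} \<tau>) \<in> borel_measurable borel"
    using fm borel_measurable_restrict_space_iff_ennreal[of "{0<..T}" borel f]
    by (simp cong: measurable_cong_sets[OF sets_log_measure refl])
  then have [measurable]: "F \<in> borel_measurable borel"
    unfolding F_def mult.assoc by measurable
  have step: "ennpowr (\<phi> t / ennreal ((2 * t) powr \<gamma>)) r \<le> 2 * (\<integral>\<^sup>+\<tau>. F \<tau> * indicator {t<..2*t} \<tau> \<partial>lborel)"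
    if t: "0 < t" "t \<le> T / 2" for t
  proof -
    let ?c = "ennpowr (\<phi> t / ennreal ((2 * t) powr \<gamma>)) r"
    have "ennreal 2 * ennreal (1 / (2 * t)) * ennreal t = 1"
      using t by (simp add: ennreal_mult[symmetric] del: ennreal_numeral)
    then have "?c = (ennreal 2 * ennreal (1 / (2 * t)) * ennreal t) * ?c"
      by simp
    also have "\<dots> = 2 * (ennreal (1 / (2 * t)) * ?c * ennreal t)"
      by (simp add: ac_simps)
    also have "ennreal (1 / (2 * t)) * ?c * ennreal t
        = (\<integral>\<^sup>+\<tau>. ennreal (1 / (2 * t)) * ?c * indicator {t<..2*t} \<tau> \<partial>lborel)"
      using t by (subst nn_integral_cmult_indicator) auto
    finally have "?c = 2 * (\<integral>\<^sup>+\<tau>. ennreal (1 / (2 * t)) * ?c * indicator {t<..2*t} \<tau> \<partial>lborel)" .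
    also have "\<dots> \<le> 2 * (\<integral>\<^sup>+\<tau>. F \<tau> * indicator {t<..2*t} \<tau> \<partial>lborel)"
    proof (intro mult_left_mono nn_integral_mono)
      fix \<tau>
      show "ennreal (1 / (2 * t)) * ?c * indicator {t<..2*t} \<tau> \<le> F \<tau> * indicator {t<..2*t} \<tau>"
      proof (cases "\<tau> \<in> {t<..2*t}")
        case True
        then have \<tau>: "t < \<tau>" "\<tau> \<le> 2 * t" "0 < \<tau>" "\<tau> \<le> T" using t by auto
        have "\<phi> t / ennreal ((2 * t) powr \<gamma>) \<le> \<phi> \<tau> / ennreal (\<tau> powr \<gamma>)"
          unfolding divide_ennreal_def
        proof (intro mult_mono)
          show "\<phi> t \<le> \<phi> \<tau>" using mono \<tau> t by (auto simp: mono_on_def)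
          show "inverse (ennreal ((2 * t) powr \<gamma>)) \<le> inverse (ennreal (\<tau> powr \<gamma>))"
            using \<tau> t g by (auto simp: inverse_ennreal intro!: powr_mono2 le_imp_inverse_le)
        qed auto
        then have "?c \<le> f \<tau>" unfolding f_def using r by (intro ennpowr_mono) auto
        moreover have "ennreal (1 / (2 * t)) \<le> ennreal (1 / \<tau>)"
          using \<tau> t by (intro ennreal_leI divide_left_mono) auto
        ultimately show ?thesis using \<tau> by (simp add: F_def mult_mono)
      qed auto
    qed auto
    finally show ?thesis .
  qed
  have "(\<Sum>n<N. ennpowr (\<phi> (h / 2 ^ n) / ennreal ((2 * (h / 2 ^ n)) powr \<gamma>)) r)
    \<le> 2 * (\<integral>\<^sup>+\<tau>. F \<tau> * indicator {2 * h / 2 ^ N<..2 * h} \<tau> \<partial>lborel)"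
  proof (induction N)
    case (Suc N)
    let ?t = "h / 2 ^ N"
    have le: "?t \<le> h / 1" using h by (intro divide_left_mono) auto
    have t: "0 < ?t" "?t \<le> T / 2"
      using h by simp (use h le in linarith)
    have ind: "indicator {2 * h / 2 ^ Suc N<..2 * h} \<tau> =
        indicator {2 * h / 2 ^ N<..2 * h} \<tau> + (indicator {?t<..2*?t} \<tau> :: ennreal)" for \<tau>
      using t le by (auto simp: indicator_def)
    have "(\<Sum>n<Suc N. ennpowr (\<phi> (h / 2 ^ n) / ennreal ((2 * (h / 2 ^ n)) powr \<gamma>)) r)
      \<le> 2 * (\<integral>\<^sup>+\<tau>. F \<tau> * indicator {2 * h / 2 ^ N<..2 * h} \<tau> \<partial>lborel)
        + 2 * (\<integral>\<^sup>+\<tau>. F \<tau> * indicator {?t<..2*?t} \<tau> \<partial>lborel)"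
      using Suc step[OF t] by (simp add: add_mono)
    also have "\<dots> = 2 * (\<integral>\<^sup>+\<tau>. F \<tau> * indicator {2 * h / 2 ^ Suc N<..2 * h} \<tau> \<partial>lborel)"
      unfolding ind distrib_left by (subst nn_integral_add) (auto simp: distrib_left)
    finally show ?case .
  qed auto
  also have "\<dots> \<le> 2 * (\<integral>\<^sup>+\<tau>. F \<tau> \<partial>lborel)"
    by (intro mult_left_mono nn_integral_mono) (auto simp: indicator_def)
  also have "(\<integral>\<^sup>+\<tau>. F \<tau> \<partial>lborel) = (\<integral>\<^sup>+\<tau>. f \<tau> \<partial>log_measure T)"
    by (simp add: nn_integral_log_measure[OF fm] F_def)
  finally show ?thesis by (simp add: f_def)
qed

text \<open>The restriction to the lower half of the interval cannot be dropped: near \<open>T\<close> the norm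
  does not control the supremum.\<close>

lemma mono_le_Lp_norm_log_measure:
  fixes \<phi> :: "real \<Rightarrow> ennreal"
  assumes mono: "mono_on {0<..T} \<phi>" and q: "0 < q" and g: "0 < \<gamma>" and h: "0 < h" "h \<le> T / 2"
  shows "\<phi> h \<le> ennreal (2 powr recip q * (2 * h) powr \<gamma>)
    * Lp_norm (log_measure T) q (\<lambda>\<tau>. \<phi> \<tau> / ennreal (\<tau> powr \<gamma>))"
    (is "_ \<le> _ * ?\<Phi>")
proof -
  have *: "\<phi> h \<le> ennreal (2 powr recip q * (2 * h) powr \<gamma>) * ?\<Phi>"
    if "\<phi> h / ennreal ((2 * h) powr \<gamma>) \<le> ennreal (2 powr recip q) * ?\<Phi>"
  proof -
    have "\<phi> h = \<phi> h / ennreal ((2 * h) powr \<gamma>) * ennreal ((2 * h) powr \<gamma>)"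
      using h by (simp add: divide_ennreal_def mult.assoc ennreal_inverse_mult inverse_ennreal ennreal_mult[symmetric])
    also have "\<dots> \<le> ennreal (2 powr recip q) * ?\<Phi> * ennreal ((2 * h) powr \<gamma>)"
      using that by (intro mult_right_mono) auto
    finally show ?thesis by (simp add: ennreal_mult ac_simps)
  qed
  show ?thesis
    using q
  proof (cases rule: ennreal_exponent_cases)
    case infinite
    have "AE \<tau> in log_measure T. \<phi> \<tau> / ennreal (\<tau> powr \<gamma>) \<le> ?\<Phi>"
      using infinite by (intro Lp_norm_infinity_imp_AE) auto
    then have "AE \<tau> in lborel. \<tau> \<in> {0<..T} \<longrightarrow> \<phi> \<tau> / ennreal (\<tau> powr \<gamma>) \<le> ?\<Phi>"
      by (simp add: AE_log_measure)
    \<comment> \<open>The essential supremum bounds almost every \<open>\<tau>\<close>, perhaps not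
      \<open>h\<close>; monotonicity of \<open>\<phi>\<close> transfers the bound from a good
      \<open>\<tau>\<close> slightly above \<open>h\<close>.\<close>
    then obtain \<tau> where \<tau>: "h < \<tau>" "\<tau> < 2 * h" "\<tau> \<in> {0<..T} \<longrightarrow> \<phi> \<tau> / ennreal (\<tau> powr \<gamma>) \<le> ?\<Phi>"
      by (rule AE_lborel_obtain[where a=h and b="2*h"]) (use h in auto)
    have "\<phi> h / ennreal ((2 * h) powr \<gamma>) \<le> \<phi> \<tau> / ennreal (\<tau> powr \<gamma>)"
      unfolding divide_ennreal_def
    proof (intro mult_mono)
      show "\<phi> h \<le> \<phi> \<tau>" using mono \<tau> h by (auto simp: mono_on_def)
      show "inverse (ennreal ((2 * h) powr \<gamma>)) \<le> inverse (ennreal (\<tau> powr \<gamma>))"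
        using \<tau> h g by (auto simp: inverse_ennreal intro!: powr_mono2 le_imp_inverse_le)
    qed auto
    also have "\<dots> \<le> ?\<Phi>" using \<tau> h by auto
    finally show ?thesis using infinite by (intro *) auto
  next
    case (finite r)
    have "ennpowr (\<phi> h / ennreal ((2 * h) powr \<gamma>)) r
      \<le> 2 * (\<integral>\<^sup>+\<tau>. ennpowr (\<phi> \<tau> / ennreal (\<tau> powr \<gamma>)) r \<partial>log_measure T)"
      using log_measure_dyadic_sum_le[OF mono finite(1) g h, of 1] by simp
    also have "\<dots> \<le> 2 * ennpowr ?\<Phi> r"
      using finite by (intro mult_left_mono) (auto simp flip: Lp_norm_finite_le_iff)
    also have "\<dots> = ennpowr (ennreal (2 powr recip q) * ?\<Phi>) r"
      using finite by (simp add: ennpowr_mult ennpowr_ennreal powr_powr)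
    finally have "ennpowr (\<phi> h / ennreal ((2 * h) powr \<gamma>)) r \<le> \<dots>" .
    from ennpowr_mono[OF this, of "1 / r"] show ?thesis
      using finite by (intro *) (simp add: ennpowr_ennpowr)
  qed
qed

lemma nn_integral_powr_from_0:
  assumes "0 < a" "0 \<le> T"
  shows "(\<integral>\<^sup>+x. ennreal (x powr (a - 1)) * indicator {0<..T} x \<partial>lborel) = ennreal (T powr a / a)"
proof -
  have "(\<integral>\<^sup>+x. indicator {0..T} x * ennreal (x powr (a - 1)) \<partial>lborel) = ennreal (T powr a / a)"
    using has_integral_powr_from_0[of "a - 1" T] assms
    by (subst nn_integral_has_integral_lebesgue[symmetric, where \<Omega>="{0..T}" and f="\<lambda>x. x powr (a-1)"])
       (auto simp: ennreal_indicator ennreal_mult' intro!: nn_integral_cong split: split_indicator)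
  moreover have "(\<integral>\<^sup>+x. ennreal (x powr (a - 1)) * indicator {0<..T} x \<partial>lborel)
     = (\<integral>\<^sup>+x. indicator {0..T} x * ennreal (x powr (a - 1)) \<partial>lborel)"
    by (intro nn_integral_cong) (auto split: split_indicator)
  ultimately show ?thesis by simp
qed

section \<open>From integral bounds to pointwise bounds by chaining\<close>

text \<open>After division by \<open>x + y\<close> this is \<open>z \<le> z powr e\<close> on
  \<open>[0,1]\<close>.\<close>

lemma powr_add_le_of_le_1:
  assumes "0 \<le> x" "0 \<le> y" "0 < e" "e \<le> (1::real)"
  shows "(x + y) powr e \<le> x powr e + y powr e"
proof (cases "x + y = 0")
  case False
  then have s: "0 < x + y" using assms by auto
  have *: "z / (x + y) \<le> (z / (x + y)) powr e" if "0 \<le> z" "z \<le> x + y" for z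
  proof (cases "z = 0")
    case False
    then have "0 < z / (x + y)" "z / (x + y) \<le> 1" using that s by auto
    then have "(z / (x + y)) powr 1 \<le> (z / (x + y)) powr e"
      using assms by (intro powr_mono') auto
    then show ?thesis using \<open>0 < z / (x + y)\<close> by (metis powr_one order_less_imp_le)
  qed auto
  have "1 = x / (x + y) + y / (x + y)" using s by (simp add: add_divide_distrib[symmetric])
  also have "\<dots> \<le> (x / (x + y)) powr e + (y / (x + y)) powr e"
    using assms by (intro add_mono *) auto
  also have "\<dots> = (x powr e + y powr e) / (x + y) powr e"
    using assms by (simp add: powr_divide add_divide_distrib)
  finally show ?thesis using s by (simp add: field_simps)
qed (use assms in auto)

text \<open>\<open>\<rho>\<close> abstracts \<open>|R|\<close>, extended by 0 outside the simplex so
  that integrals may run over the whole line. One constant \<open>K\<close> appears in both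
  \<open>int_le\<close> and \<open>triangle\<close>, which makes all derived constants functions of
  \<open>p\<close> and \<open>\<kappa>\<close> alone.\<close>

locale chaining =
  fixes T p \<gamma> K \<kappa> :: real and \<rho> :: "real \<Rightarrow> real \<Rightarrow> real"
  assumes T_pos: "0 < T" and p_pos: "0 < p" and \<gamma>_pos: "0 < \<gamma>" and K_pos: "0 < K"
    and \<kappa>: "\<kappa> = \<gamma> - 1 / p" and \<kappa>_pos: "0 < \<kappa>"
    and nonneg: "\<And>s t. 0 \<le> \<rho> s t"
    and meas: "case_prod \<rho> \<in> borel_measurable (borel \<Otimes>\<^sub>M borel)"
    and support: "\<And>s t. \<rho> s t \<noteq> 0 \<Longrightarrow> 0 \<le> s \<and> s \<le> t \<and> t \<le> T"
    and int_le: "\<And>h. 0 < h \<Longrightarrow> h \<le> T / 2 \<Longrightarrow>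
      (\<integral>\<^sup>+r. ennreal (\<rho> r (r + h) powr p) \<partial>lborel) \<le> ennreal ((K * h powr \<gamma>) powr p)"
    and triangle: "\<And>s u t. 0 \<le> s \<Longrightarrow> s \<le> u \<Longrightarrow> u \<le> t \<Longrightarrow> t \<le> T \<Longrightarrow>
      \<rho> s t \<le> \<rho> s u + \<rho> u t + K * (t - s) powr \<kappa>"
begin

text \<open>Two demands fix this exponent: \<open>e \<le> 1\<close> makes the power subadditive, and
  \<open>e \<le> p\<close> lets the \<open>p\<close>-th power control it.\<close>

definition e :: real where "e = min 1 p"
definition \<sigma> :: "real \<Rightarrow> real \<Rightarrow> ennreal" where "\<sigma> s t = ennreal (\<rho> s t powr e)"
definition scale :: "real \<Rightarrow> real" where "scale h = (K * h powr \<kappa>) powr e"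

lemma e_pos: "0 < e" and e_le: "e \<le> 1" "e \<le> p"
  using p_pos by (auto simp: e_def)

lemma scale_nonneg [simp]: "0 \<le> scale h"
  by (simp add: scale_def)

lemma \<rho>_measurable [measurable]:
  assumes [measurable]: "f \<in> borel_measurable M" "g \<in> borel_measurable M"
  shows "(\<lambda>x. \<rho> (f x) (g x)) \<in> borel_measurable M"
  using measurable_compose[OF _ meas, of "\<lambda>x. (f x, g x)" M] by simp

lemma \<sigma>_measurable [measurable]:
  assumes [measurable]: "f \<in> borel_measurable M" "g \<in> borel_measurable M"
  shows "(\<lambda>x. \<sigma> (f x) (g x)) \<in> borel_measurable M"
  unfolding \<sigma>_def by measurable

lemma \<sigma>_triangle:
  assumes "0 \<le> s" "s \<le> u" "u \<le> t" "t \<le> T"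
  shows "\<sigma> s t \<le> \<sigma> s u + \<sigma> u t + ennreal (scale (t - s))"
proof -
  have "\<rho> s t powr e \<le> (\<rho> s u + \<rho> u t + K * (t - s) powr \<kappa>) powr e"
    using triangle[OF assms] nonneg e_pos by (intro powr_mono2) auto
  also have "\<dots> \<le> (\<rho> s u + \<rho> u t) powr e + scale (t - s)"
    unfolding scale_def using nonneg K_pos e_pos e_le by (intro powr_add_le_of_le_1) auto
  also have "(\<rho> s u + \<rho> u t) powr e \<le> \<rho> s u powr e + \<rho> u t powr e"
    using nonneg e_pos e_le by (intro powr_add_le_of_le_1) auto
  finally show ?thesis
    unfolding \<sigma>_def by (simp add: ennreal_plus[symmetric] del: ennreal_plus)
qed

text \<open>The elementary inequality \<open>x\<^sup>e \<le> z\<^sup>e (1 + x\<^sup>p / z\<^sup>p)\<close> for \<open>e \<le> p\<close> takes the place of Jensen's inequality.\<close>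

lemma \<sigma>_le:
  assumes "0 < H"
  shows "\<sigma> s t \<le> ennreal (scale H) * (1 + ennreal (\<rho> s t powr p / (K * H powr \<kappa>) powr p))"
proof -
  define z where "z = K * H powr \<kappa>"
  have z: "0 < z" using K_pos assms by (simp add: z_def)
  have "\<rho> s t powr e \<le> z powr e * (1 + \<rho> s t powr p / z powr p)"
  proof (cases "\<rho> s t \<le> z")
    case True
    then have "\<rho> s t powr e \<le> z powr e * 1"
      using nonneg e_pos by (auto intro!: powr_mono2)
    also have "\<dots> \<le> z powr e * (1 + \<rho> s t powr p / z powr p)"
      by (intro mult_left_mono) auto
    finally show ?thesis .
  next
    case False
    then have "(\<rho> s t / z) powr e \<le> (\<rho> s t / z) powr p"
      using z e_le by (intro powr_mono) auto
    then have "\<rho> s t powr e \<le> z powr e * (\<rho> s t powr p / z powr p)"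
      using z nonneg[of s t] by (simp add: powr_divide field_simps)
    also have "\<dots> \<le> z powr e * (1 + \<rho> s t powr p / z powr p)"
      by (intro mult_left_mono) auto
    finally show ?thesis .
  qed
  then show ?thesis
    by (simp add: \<sigma>_def scale_def z_def[symmetric] ennreal_mult[symmetric] flip: ennreal_1 ennreal_plus)
qed

text \<open>The difference \<open>z\<close> of the two end points replaces \<open>y\<close> as
  integration variable. After Fubini the inner integral runs along the line of length
  \<open>z \<le> H\<close>, where \<open>int_le\<close> applies; integrating over \<open>z\<close>
  adds the factor \<open>H\<close>. The sign \<open>d\<close> covers a right end point written as
  \<open>s + y\<close> as well as one written as \<open>t - y\<close>.\<close>

lemma rectangle_integral_le:
  assumes d: "d = 1 \<or> d = (-1::real)" and H: "0 < H" "H \<le> T / 2"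
    and [measurable]: "X \<in> sets borel" "Y \<in> sets borel"
    and XY: "\<And>x y. x \<in> X \<Longrightarrow> y \<in> Y \<Longrightarrow> 0 < (t + d * y) - (s + x) \<and> (t + d * y) - (s + x) \<le> H"
  shows "(\<integral>\<^sup>+x. \<integral>\<^sup>+y. indicator X x * indicator Y y * ennreal (\<rho> (s + x) (t + d * y) powr p) \<partial>lborel \<partial>lborel)
    \<le> ennreal (H * (K * H powr \<gamma>) powr p)"
proof -
  have "(\<integral>\<^sup>+x. \<integral>\<^sup>+y. indicator X x * indicator Y y * ennreal (\<rho> (s + x) (t + d * y) powr p) \<partial>lborel \<partial>lborel)
    = (\<integral>\<^sup>+x. \<integral>\<^sup>+z. indicator X x * indicator Y (d * (s + x - t) + d * z)
         * ennreal (\<rho> (s + x) (t + d * (d * (s + x - t) + d * z)) powr p) \<partial>lborel \<partial>lborel)"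
  proof (rule nn_integral_cong)
    fix x
    show "(\<integral>\<^sup>+y. indicator X x * indicator Y y * ennreal (\<rho> (s + x) (t + d * y) powr p) \<partial>lborel)
      = (\<integral>\<^sup>+z. indicator X x * indicator Y (d * (s + x - t) + d * z)
         * ennreal (\<rho> (s + x) (t + d * (d * (s + x - t) + d * z)) powr p) \<partial>lborel)"
      using d nn_integral_real_affine[where c=d and t="d * (s + x - t)"
        and f="\<lambda>y. indicator X x * indicator Y y * ennreal (\<rho> (s + x) (t + d * y) powr p)"]
      by auto
  qed
  also have "\<dots> \<le> (\<integral>\<^sup>+x. \<integral>\<^sup>+z. indicator {0<..H} z * ennreal (\<rho> (s + x) (s + x + z) powr p) \<partial>lborel \<partial>lborel)"
  proof (intro nn_integral_mono)
    fix x z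
    have eq: "t + d * (d * (s + x - t) + d * z) = s + x + z"
      using d by (auto simp: algebra_simps)
    show "indicator X x * indicator Y (d * (s + x - t) + d * z)
         * ennreal (\<rho> (s + x) (t + d * (d * (s + x - t) + d * z)) powr p)
      \<le> indicator {0<..H} z * ennreal (\<rho> (s + x) (s + x + z) powr p)"
      unfolding eq using XY[of x "d * (s + x - t) + d * z"] eq
      by (auto simp: indicator_def)
  qed
  also have "\<dots> = (\<integral>\<^sup>+z. \<integral>\<^sup>+x. indicator {0<..H} z * ennreal (\<rho> (s + x) (s + x + z) powr p) \<partial>lborel \<partial>lborel)"
    by (rule lborel_pair.Fubini') measurable
  also have "\<dots> \<le> (\<integral>\<^sup>+z. ennreal ((K * H powr \<gamma>) powr p) * indicator {0<..H} z \<partial>lborel)"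
  proof (intro nn_integral_mono)
    fix z
    show "(\<integral>\<^sup>+x. indicator {0<..H} z * ennreal (\<rho> (s + x) (s + x + z) powr p) \<partial>lborel)
      \<le> ennreal ((K * H powr \<gamma>) powr p) * indicator {0<..H} z"
    proof (cases "z \<in> {0<..H}")
      case True
      have "(\<integral>\<^sup>+x. indicator {0<..H} z * ennreal (\<rho> (s + x) (s + x + z) powr p) \<partial>lborel)
        = (\<integral>\<^sup>+x. ennreal (\<rho> x (x + z) powr p) \<partial>lborel)"
        using True by (subst nn_integral_real_affine[where c=1 and t=s and f="\<lambda>x. ennreal (\<rho> x (x + z) powr p)"]) auto
      also have "\<dots> \<le> ennreal ((K * z powr \<gamma>) powr p)"
        using True H by (intro int_le) auto
      also have "\<dots> \<le> ennreal ((K * H powr \<gamma>) powr p)"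
        using True K_pos \<gamma>_pos p_pos by (intro ennreal_leI powr_mono2 mult_left_mono) auto
      finally show ?thesis using True by simp
    qed simp
  qed
  also have "\<dots> = ennreal (H * (K * H powr \<gamma>) powr p)"
    using H by (subst nn_integral_cmult_indicator) (auto simp: ennreal_mult[symmetric] mult.commute)
  finally show ?thesis .
qed

text \<open>This identity fixes the exponent \<open>\<kappa> = \<gamma> - 1 / p\<close>: the
  rectangle bound, measured in units of \<open>(K * H powr \<kappa>) powr p\<close>, becomes an
  area.\<close>

lemma scale_ratio: "0 < H \<Longrightarrow> H * (K * H powr \<gamma>) powr p / (K * H powr \<kappa>) powr p = H\<^sup>2"
proof -
  assume H: "0 < H"
  have "(K * H powr \<gamma>) powr p / (K * H powr \<kappa>) powr p = H powr ((\<gamma> - \<kappa>) * p)"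
    using H K_pos by (simp add: powr_mult powr_powr powr_diff left_diff_distrib)
  also have "(\<gamma> - \<kappa>) * p = 1" using p_pos by (simp add: \<kappa>)
  finally have "(K * H powr \<gamma>) powr p / (K * H powr \<kappa>) powr p = H"
    using H by simp
  then show ?thesis by (simp add: power2_eq_square flip: times_divide_eq_right)
qed

lemma rectangle_\<sigma>_le:
  assumes d: "d = 1 \<or> d = (-1::real)" and H: "0 < H" "H \<le> T / 2"
    and [measurable]: "X \<in> sets borel" "Y \<in> sets borel"
    and XY: "\<And>x y. x \<in> X \<Longrightarrow> y \<in> Y \<Longrightarrow> 0 < (t + d * y) - (s + x) \<and> (t + d * y) - (s + x) \<le> H"
  shows "(\<integral>\<^sup>+x. \<integral>\<^sup>+y. indicator X x * indicator Y y * \<sigma> (s + x) (t + d * y) \<partial>lborel \<partial>lborel)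
    \<le> ennreal (scale H) * (emeasure lborel X * emeasure lborel Y + ennreal (H\<^sup>2))"
proof -
  define z where "z = (K * H powr \<kappa>) powr p"
  have z: "0 < z" using K_pos H by (simp add: z_def)
  have "(\<integral>\<^sup>+x. \<integral>\<^sup>+y. indicator X x * indicator Y y * \<sigma> (s + x) (t + d * y) \<partial>lborel \<partial>lborel)
    \<le> (\<integral>\<^sup>+x. \<integral>\<^sup>+y. ennreal (scale H) * (indicator X x * indicator Y y) + ennreal (scale H) * (ennreal (1 / z) *
        (indicator X x * indicator Y y * ennreal (\<rho> (s + x) (t + d * y) powr p))) \<partial>lborel \<partial>lborel)"
  proof (intro nn_integral_mono)
    fix x y
    show "indicator X x * indicator Y y * \<sigma> (s + x) (t + d * y)
      \<le> ennreal (scale H) * (indicator X x * indicator Y y) + ennreal (scale H) * (ennreal (1 / z) *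
        (indicator X x * indicator Y y * ennreal (\<rho> (s + x) (t + d * y) powr p)))"
      using \<sigma>_le[OF H(1), of "s + x" "t + d * y"] z
      by (auto simp: indicator_def z_def[symmetric] ennreal_mult[symmetric] distrib_left)
  qed
  also have "\<dots> = ennreal (scale H) * (\<integral>\<^sup>+x. \<integral>\<^sup>+y. indicator X x * indicator Y y \<partial>lborel \<partial>lborel)
     + ennreal (scale H) * (ennreal (1 / z) * (\<integral>\<^sup>+x. \<integral>\<^sup>+y. indicator X x * indicator Y y * ennreal (\<rho> (s + x) (t + d * y) powr p) \<partial>lborel \<partial>lborel))"
    by (simp add: nn_integral_add nn_integral_cmult)
  also have "(\<integral>\<^sup>+x. \<integral>\<^sup>+y. indicator X x * indicator Y y \<partial>lborel \<partial>lborel) = emeasure lborel X * emeasure lborel Y"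
    by (simp add: nn_integral_cmult nn_integral_multc)
  also have "ennreal (1 / z) * (\<integral>\<^sup>+x. \<integral>\<^sup>+y. indicator X x * indicator Y y * ennreal (\<rho> (s + x) (t + d * y) powr p) \<partial>lborel \<partial>lborel)
    \<le> ennreal (1 / z) * ennreal (H * (K * H powr \<gamma>) powr p)"
    by (intro mult_left_mono rectangle_integral_le assms) auto
  also have "\<dots> = ennreal (H\<^sup>2)"
    using z scale_ratio[OF H(1)] H by (simp add: ennreal_mult[symmetric] z_def)
  finally show ?thesis
    by (simp add: distrib_left add_mono mult_left_mono)
qed

text \<open>The window has length \<open>h / 2\<close>, so this is half of the mean over it. The
  windows for \<open>h, h/2, h/4, ...\<close> are disjoint, which later makes the averages
  summable.\<close>

definition right_avg :: "real \<Rightarrow> real \<Rightarrow> ennreal" where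
  "right_avg s h = ennreal (1 / h) * (\<integral>\<^sup>+v. indicator {h/2<..<h} v * \<sigma> s (s + v) \<partial>lborel)"

text \<open>The inequality \<open>\<sigma>_triangle\<close> through an intermediate point
  \<open>s + x\<close> is averaged over \<open>x\<close> in the smaller and \<open>y\<close> in the
  larger window. The term from \<open>s + x\<close> to \<open>s + y\<close> has two free end points,
  so \<open>rectangle_\<sigma>_le\<close> bounds it by a multiple of \<open>scale h\<close>.\<close>

lemma right_avg_step:
  assumes s: "0 \<le> s" "s + h \<le> T" and h: "0 < h" "h \<le> T / 2"
  shows "right_avg s h \<le> right_avg s (h / 2) + ennreal (17 / 2 * scale h)"
proof -
  let ?X = "{h/4<..<h/2}" and ?Y = "{h/2<..<h}"
  let ?g0 = "\<integral>\<^sup>+v. indicator ?Y v * \<sigma> s (s + v) \<partial>lborel"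
  let ?g1 = "\<integral>\<^sup>+v. indicator ?X v * \<sigma> s (s + v) \<partial>lborel"
  have "ennreal (h / 4) * ?g0 = (\<integral>\<^sup>+x. \<integral>\<^sup>+y. indicator ?X x * indicator ?Y y * \<sigma> s (s + y) \<partial>lborel \<partial>lborel)"
    using h by (simp add: nn_integral_cmult nn_integral_multc mult.assoc)
  also have "\<dots> \<le> (\<integral>\<^sup>+x. \<integral>\<^sup>+y. indicator ?Y y * (indicator ?X x * \<sigma> s (s + x))
     + indicator ?X x * indicator ?Y y * \<sigma> (s + x) (s + 1 * y)
     + ennreal (scale h) * (indicator ?X x * indicator ?Y y) \<partial>lborel \<partial>lborel)"
  proof (intro nn_integral_mono)
    fix x y
    have "\<sigma> s (s + y) \<le> \<sigma> s (s + x) + \<sigma> (s + x) (s + y) + ennreal (scale h)" if "x \<in> ?X" "y \<in> ?Y"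
    proof -
      have "\<sigma> s (s + y) \<le> \<sigma> s (s + x) + \<sigma> (s + x) (s + y) + ennreal (scale (s + y - s))"
        using that s by (intro \<sigma>_triangle) auto
      also have "scale (s + y - s) \<le> scale h"
        unfolding scale_def using that K_pos e_pos \<kappa>_pos
        by (intro powr_mono2 mult_left_mono) auto
      finally show ?thesis by (simp add: add_left_mono ennreal_leI)
    qed
    then show "indicator ?X x * indicator ?Y y * \<sigma> s (s + y) \<le> indicator ?Y y * (indicator ?X x * \<sigma> s (s + x))
     + indicator ?X x * indicator ?Y y * \<sigma> (s + x) (s + 1 * y)
     + ennreal (scale h) * (indicator ?X x * indicator ?Y y)"
      by (auto simp: indicator_def)
  qed
  also have "\<dots> = ennreal (h / 2) * ?g1
     + (\<integral>\<^sup>+x. \<integral>\<^sup>+y. indicator ?X x * indicator ?Y y * \<sigma> (s + x) (s + 1 * y) \<partial>lborel \<partial>lborel)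
     + ennreal (scale h) * (ennreal (h / 4) * ennreal (h / 2))"
    using h by (simp add: nn_integral_add nn_integral_cmult nn_integral_multc)
  also have "(\<integral>\<^sup>+x. \<integral>\<^sup>+y. indicator ?X x * indicator ?Y y * \<sigma> (s + x) (s + 1 * y) \<partial>lborel \<partial>lborel)
    \<le> ennreal (scale h) * (emeasure lborel ?X * emeasure lborel ?Y + ennreal (h\<^sup>2))"
    using h by (intro rectangle_\<sigma>_le) auto
  finally have "ennreal (h / 4) * ?g0 \<le> ennreal (h / 2) * ?g1
     + ennreal (scale h) * (emeasure lborel ?X * emeasure lborel ?Y + ennreal (h\<^sup>2))
     + ennreal (scale h) * (ennreal (h / 4) * ennreal (h / 2))"
    by (simp add: add_mono)
  \<comment> \<open>The windows span an area \<open>h\<^sup>2 / 8\<close>, so the errors are 1/8 + 1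
    from the rectangle and 1/8 from the triangle inequality, in units of
    \<open>scale h * h\<^sup>2\<close>. Multiplication by \<open>4 / h\<^sup>2\<close> leaves
    \<open>5 * scale h\<close>; the stated 17/2 has some slack.\<close>
  also have "\<dots> = ennreal (h / 2) * ?g1 + ennreal (5 / 4 * scale h * h\<^sup>2)"
    using h by (simp add: ennreal_mult[symmetric] ennreal_plus[symmetric] add.assoc power2_eq_square algebra_simps
      del: ennreal_plus)
  finally have "ennreal (4 / h\<^sup>2) * (ennreal (h / 4) * ?g0)
      \<le> ennreal (4 / h\<^sup>2) * (ennreal (h / 2) * ?g1 + ennreal (5 / 4 * scale h * h\<^sup>2))"
    by (rule mult_left_mono) auto
  also have "\<dots> = ennreal (2 / h) * ?g1 + ennreal (5 * scale h)"
    using h by (simp add: distrib_left mult.assoc[symmetric] ennreal_mult[symmetric] power2_eq_square)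
  also have "ennreal (4 / h\<^sup>2) * (ennreal (h / 4) * ?g0) = right_avg s h"
    using h by (simp add: right_avg_def mult.assoc[symmetric] ennreal_mult[symmetric] power2_eq_square)
  also have "ennreal (2 / h) * ?g1 = right_avg s (h / 2)"
    by (simp add: right_avg_def)
  finally show ?thesis
    by (rule order_trans) (auto intro!: add_left_mono ennreal_leI)
qed

end

lemma halved_le: "0 < h \<Longrightarrow> h / 2 ^ n \<le> (h::real)"
  using divide_left_mono[of 1 "2^n" h] by simp

context chaining
begin

text \<open>The sum of the step errors: \<open>scale\<close> shrinks by the factor
  \<open>2 powr (- (\<kappa> * e))\<close> at each halving, so they form a convergent geometric
  series.\<close>

definition avg_const :: real where
  "avg_const = 17 / 2 / (1 - 2 powr (- (\<kappa> * e)))"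

lemma ratio_less_1: "2 powr (- (\<kappa> * e)) < (1::real)"
  using \<kappa>_pos e_pos powr_less_mono[of "- (\<kappa> * e)" 0 2] by simp

lemma avg_const_pos: "0 < avg_const"
  using ratio_less_1 by (simp add: avg_const_def)

lemma scale_halved:
  assumes "0 < h"
  shows "scale (h / 2 ^ n) = scale h * (2 powr (- (\<kappa> * e))) ^ n"
proof -
  have "scale (h / 2 ^ n) = scale h * (2 ^ n) powr (- (\<kappa> * e))"
    unfolding scale_def using assms K_pos
    by (simp add: powr_mult powr_divide powr_powr powr_minus field_simps)
  also have "(2 ^ n) powr (- (\<kappa> * e)) = (2 powr (- (\<kappa> * e))) ^ n"
    by (simp add: powr_realpow[symmetric] powr_powr mult.commute)
  finally show ?thesis .
qed

lemma right_avg_iterate: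
  assumes s: "0 \<le> s" "s + h \<le> T" and h: "0 < h" "h \<le> T / 2"
  shows "right_avg s h \<le> right_avg s (h / 2 ^ n) + ennreal (avg_const * scale h)"
proof -
  define q where "q = 2 powr (- (\<kappa> * e))"
  have q: "0 < q" "q < 1" using ratio_less_1 by (auto simp: q_def)
  have "right_avg s h \<le> right_avg s (h / 2 ^ n) + ennreal (17 / 2 * scale h * (\<Sum>k<n. q ^ k))"
  proof (induction n)
    case (Suc n)
    have le: "0 < h / 2 ^ n" "s + h / 2 ^ n \<le> T" "h / 2 ^ n \<le> T / 2"
      using s h halved_le[OF h(1), of n] by (simp, linarith, linarith)
    have "right_avg s (h / 2 ^ n) \<le> right_avg s (h / 2 ^ n / 2) + ennreal (17 / 2 * scale (h / 2 ^ n))"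
      by (intro right_avg_step s le)
    also have "\<dots> = right_avg s (h / 2 ^ Suc n) + ennreal (17 / 2 * scale h * q ^ n)"
      by (simp add: scale_halved[OF h(1)] q_def field_simps)
    finally have "right_avg s h \<le> right_avg s (h / 2 ^ Suc n) + ennreal (17 / 2 * scale h * q ^ n)
        + ennreal (17 / 2 * scale h * (\<Sum>k<n. q ^ k))"
      by (rule order_trans[OF Suc add_right_mono])
    also have "\<dots> = right_avg s (h / 2 ^ Suc n) + ennreal (17 / 2 * scale h * (\<Sum>k<Suc n. q ^ k))"
      using q by (simp add: add.assoc distrib_left sum_nonneg add.commute flip: ennreal_plus)
    finally show ?case .
  qed simp
  also have "17 / 2 * scale h * (\<Sum>k<n. q ^ k) \<le> avg_const * scale h"
  proof -
    have "(\<Sum>k<n. q ^ k) \<le> 1 / (1 - q)"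
      using q by (simp add: sum_gp_strict divide_right_mono)
    from mult_left_mono[OF this, of "17 / 2 * scale h"] show ?thesis
      by (simp add: avg_const_def q_def)
  qed
  finally show ?thesis by (simp add: add_left_mono ennreal_leI)
qed

text \<open>A Dini-type integral at the left end point \<open>s\<close>: it collects the averages at
  all scales, and its finiteness is what makes \<open>s\<close> a good end point.\<close>

definition log_int :: "real \<Rightarrow> ennreal" where
  "log_int s = (\<integral>\<^sup>+v. indicator {0<..T/2} v * ennreal (1 / v) * \<sigma> s (s + v) \<partial>lborel)"

lemma log_int_measurable [measurable]: "log_int \<in> borel_measurable borel"
  unfolding log_int_def by measurable

text \<open>By Tonelli, integrating over \<open>s\<close> first gives a multiple of
  \<open>v powr (\<gamma> * e)\<close> on the line of length \<open>v\<close>, and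
  \<open>v powr (\<gamma> * e - 1)\<close> is integrable at 0.\<close>

lemma log_int_finite: "AE s in lborel. log_int s \<noteq> \<infinity>"
proof (rule nn_integral_PInf_AE)
  let ?C = "K powr e * (T + 1)"
  have "(\<integral>\<^sup>+s. log_int s \<partial>lborel)
    = (\<integral>\<^sup>+v. \<integral>\<^sup>+s. indicator {0<..T/2} v * ennreal (1 / v) * \<sigma> s (s + v) \<partial>lborel \<partial>lborel)"
    unfolding log_int_def by (rule lborel_pair.Fubini') measurable
  also have "\<dots> \<le> (\<integral>\<^sup>+v. ennreal ?C * (ennreal (v powr (\<gamma> * e - 1)) * indicator {0<..T/2} v) \<partial>lborel)"
  proof (intro nn_integral_mono)
    fix v
    show "(\<integral>\<^sup>+s. indicator {0<..T/2} v * ennreal (1 / v) * \<sigma> s (s + v) \<partial>lborel)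
      \<le> ennreal ?C * (ennreal (v powr (\<gamma> * e - 1)) * indicator {0<..T/2} v)"
    proof (cases "v \<in> {0<..T/2}")
      case True
      \<comment> \<open>With this threshold, both the constant part over \<open>[0,T]\<close> and
        the part with the \<open>p\<close>-th power of \<open>\<rho>\<close> contribute a multiple
        of \<open>z powr e\<close>, namely \<open>T\<close> and 1 times it.\<close>
      define z where "z = K * v powr \<gamma>"
      have z: "0 < z" using K_pos True by (simp add: z_def)
      have "(\<integral>\<^sup>+s. \<sigma> s (s + v) \<partial>lborel)
        \<le> (\<integral>\<^sup>+s. ennreal (z powr e) * indicator {0..T} s + ennreal (z powr e / z powr p) * ennreal (\<rho> s (s + v) powr p) \<partial>lborel)"
      proof (intro nn_integral_mono)
        fix s
        have *: "x powr e \<le> z powr e + z powr e / z powr p * x powr p" if "0 \<le> x" for x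
        proof (cases "x \<le> z")
          case True
          then have "x powr e \<le> z powr e + 0"
            using that e_pos by (auto intro!: powr_mono2)
          also have "\<dots> \<le> z powr e + z powr e / z powr p * x powr p"
            by (intro add_left_mono) auto
          finally show ?thesis .
        next
          case False
          then have "(x / z) powr e \<le> (x / z) powr p"
            using z e_le by (intro powr_mono) auto
          then have "x powr e \<le> 0 + z powr e / z powr p * x powr p"
            using z that by (simp add: powr_divide field_simps)
          also have "\<dots> \<le> z powr e + z powr e / z powr p * x powr p"
            by (intro add_right_mono) auto
          finally show ?thesis .
        qed
        show "\<sigma> s (s + v) \<le> ennreal (z powr e) * indicator {0..T} s
            + ennreal (z powr e / z powr p) * ennreal (\<rho> s (s + v) powr p)"
        proof (cases "\<rho> s (s + v) = 0")
          case False
          then have "s \<in> {0..T}" using support[of s "s + v"] True by auto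
          then show ?thesis
            using *[OF nonneg[of s "s + v"]]
            by (simp add: \<sigma>_def ennreal_mult[symmetric] flip: ennreal_plus)
        qed (simp add: \<sigma>_def)
      qed
      also have "\<dots> = ennreal (z powr e) * ennreal T
          + ennreal (z powr e / z powr p) * (\<integral>\<^sup>+s. ennreal (\<rho> s (s + v) powr p) \<partial>lborel)"
        using T_pos by (simp add: nn_integral_add nn_integral_cmult)
      also have "(\<integral>\<^sup>+s. ennreal (\<rho> s (s + v) powr p) \<partial>lborel) \<le> ennreal (z powr p)"
        unfolding z_def using True by (intro int_le) auto
      also have "ennreal (z powr e) * ennreal T + ennreal (z powr e / z powr p) * ennreal (z powr p)
          = ennreal (?C * v powr (\<gamma> * e))"
        using z T_pos K_pos True
        by (simp add: ennreal_mult[symmetric] ennreal_plus[symmetric] del: ennreal_plus)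
          (simp add: z_def powr_mult powr_powr algebra_simps)
      finally have "(\<integral>\<^sup>+s. \<sigma> s (s + v) \<partial>lborel) \<le> ennreal (?C * v powr (\<gamma> * e))"
        by (simp add: add_left_mono mult_left_mono)
      then have "ennreal (1 / v) * (\<integral>\<^sup>+s. \<sigma> s (s + v) \<partial>lborel) \<le> ennreal (1 / v) * ennreal (?C * v powr (\<gamma> * e))"
        by (rule mult_left_mono) simp
      also have "\<dots> = ennreal ?C * ennreal (v powr (\<gamma> * e - 1))"
        using True T_pos by (simp add: ennreal_mult[symmetric] powr_diff)
      finally show ?thesis using True by (simp add: nn_integral_cmult)
    qed simp
  qed
  also have "\<dots> = ennreal ?C * ennreal ((T / 2) powr (\<gamma> * e) / (\<gamma> * e))"
    using T_pos \<gamma>_pos e_pos nn_integral_powr_from_0[of "\<gamma> * e" "T/2"] by (simp add: nn_integral_cmult)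
  also have "\<dots> < \<infinity>"
    by (simp add: ennreal_mult_less_top)
  finally show "(\<integral>\<^sup>+s. log_int s \<partial>lborel) \<noteq> \<infinity>"
    by simp
qed measurable

text \<open>On the window below \<open>h / 2 ^ n\<close> the weight \<open>1 / v\<close> is at least
  the normalizing factor of the average, and the windows are disjoint subsets of
  \<open>(0, T/2]\<close>.\<close>

lemma sum_right_avg_le:
  assumes h: "0 < h" "h \<le> T / 2"
  shows "(\<Sum>n<N. right_avg s (h / 2 ^ n)) \<le> log_int s"
proof -
  let ?f = "\<lambda>v. ennreal (1 / v) * \<sigma> s (s + v)"
  have "(\<Sum>n<N. right_avg s (h / 2 ^ n)) \<le> (\<integral>\<^sup>+v. indicator {h / 2 ^ N<..<h} v * ?f v \<partial>lborel)"
  proof (induction N)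
    case (Suc N)
    let ?t = "h / 2 ^ N"
    have t: "0 < ?t" "?t \<le> h" using h halved_le[of h N] by auto
    have "right_avg s ?t = (\<integral>\<^sup>+v. ennreal (1 / ?t) * (indicator {?t/2<..<?t} v * \<sigma> s (s + v)) \<partial>lborel)"
      unfolding right_avg_def by (subst nn_integral_cmult) auto
    also have "\<dots> \<le> (\<integral>\<^sup>+v. indicator {?t/2<..<?t} v * ?f v \<partial>lborel)"
    proof (intro nn_integral_mono)
      fix v
      show "ennreal (1 / ?t) * (indicator {?t/2<..<?t} v * \<sigma> s (s + v)) \<le> indicator {?t/2<..<?t} v * ?f v"
      proof (cases "v \<in> {?t/2<..<?t}")
        case True
        then have "0 < v" "v \<le> ?t" using t by (auto intro: less_trans[of 0 "?t/2"])
        then have "1 / ?t \<le> 1 / v" using t by (intro divide_left_mono mult_pos_pos) auto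
        then show ?thesis using True by (auto intro!: mult_right_mono ennreal_leI)
      qed simp
    qed
    finally have "(\<Sum>n<Suc N. right_avg s (h / 2 ^ n)) \<le> (\<integral>\<^sup>+v. indicator {h / 2 ^ N<..<h} v * ?f v \<partial>lborel)
        + (\<integral>\<^sup>+v. indicator {?t/2<..<?t} v * ?f v \<partial>lborel)"
      using Suc by (simp add: add_mono)
    also have "\<dots> = (\<integral>\<^sup>+v. indicator {h / 2 ^ N<..<h} v * ?f v + indicator {?t/2<..<?t} v * ?f v \<partial>lborel)"
      by (subst nn_integral_add) auto
    also have "\<dots> \<le> (\<integral>\<^sup>+v. indicator {h / 2 ^ Suc N<..<h} v * ?f v \<partial>lborel)"
    proof (intro nn_integral_mono)
      fix v
      have "indicator {h / 2 ^ N<..<h} v + indicator {?t/2<..<?t} v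
          \<le> (indicator {h / 2 ^ Suc N<..<h} v :: ennreal)"
      proof -
        have "h / 2 ^ Suc N = ?t / 2" by simp
        then show ?thesis
          unfolding indicator_def using t by (auto split: if_splits)
      qed
      then show "indicator {h / 2 ^ N<..<h} v * ?f v + indicator {?t/2<..<?t} v * ?f v
          \<le> indicator {h / 2 ^ Suc N<..<h} v * ?f v"
        unfolding distrib_right[symmetric] by (rule mult_right_mono) simp
    qed
    finally show ?case .
  qed simp
  also have "\<dots> \<le> log_int s"
    unfolding log_int_def mult.assoc
  proof (intro nn_integral_mono mult_right_mono)
    fix v
    have "0 < v" if "h / 2 ^ N < v"
      by (rule le_less_trans[OF _ that]) (use h in simp)
    then show "(indicator {h / 2 ^ N<..<h} v :: ennreal) \<le> indicator {0<..T/2} v"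
      using h by (auto simp: indicator_def)
  qed simp
  finally show ?thesis .
qed

text \<open>If an average exceeded the bound by some \<open>\<epsilon> > 0\<close>, so would the averages at all scales \<open>h / 2\<^sup>n\<close>
  exceed \<open>\<epsilon>\<close>, but their sum is finite.\<close>

lemma right_avg_le:
  assumes s: "0 \<le> s" "s + h \<le> T" and h: "0 < h" "h \<le> T / 2" and fin: "log_int s \<noteq> \<infinity>"
  shows "right_avg s h \<le> ennreal (avg_const * scale h)"
proof -
  obtain F where F: "log_int s = ennreal F" "0 \<le> F"
    using fin by (cases "log_int s") auto
  have c: "0 \<le> avg_const * scale h" using avg_const_pos by simp
  have *: "of_nat N * right_avg s h \<le> ennreal (F + N * (avg_const * scale h))" for N
  proof -
    have "of_nat N * right_avg s h = (\<Sum>n<N. right_avg s h)" by simp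
    also have "\<dots> \<le> (\<Sum>n<N. right_avg s (h / 2 ^ n) + ennreal (avg_const * scale h))"
      by (intro sum_mono right_avg_iterate s h)
    also have "\<dots> \<le> ennreal F + of_nat N * ennreal (avg_const * scale h)"
      using sum_right_avg_le[OF h, where N=N and s=s] F by (simp add: sum.distrib add_mono)
    also have "\<dots> = ennreal (F + N * (avg_const * scale h))"
      using F c by (simp add: ennreal_mult[symmetric] ennreal_of_nat_eq_real_of_nat flip: ennreal_plus)
    finally show ?thesis .
  qed
  have "right_avg s h \<noteq> top" using *[of 1] by (auto simp: top_unique)
  then obtain a where a: "right_avg s h = ennreal a" "0 \<le> a"
    by (cases "right_avg s h") auto
  have "a \<le> avg_const * scale h"
  proof (rule ccontr)
    assume "\<not> ?thesis"
    then obtain N :: nat where "F < N * (a - avg_const * scale h)"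
      using reals_Archimedean3[of "a - avg_const * scale h"] by auto
    moreover have "N * a \<le> F + N * (avg_const * scale h)"
      using *[of N] a F c by (simp add: ennreal_mult[symmetric] ennreal_of_nat_eq_real_of_nat del: ennreal_plus)
    ultimately show False by (simp add: algebra_simps)
  qed
  then show ?thesis using a by (simp add: ennreal_leI)
qed

text \<open>Time reversal preserves all hypotheses and exchanges the two end points, so the results
  on averages at a left end point also serve the right one.\<close>

lemma reflected: "chaining T p \<gamma> K \<kappa> (\<lambda>s t. \<rho> (T - t) (T - s))"
proof unfold_locales
  show "(\<lambda>(s, t). \<rho> (T - t) (T - s)) \<in> borel_measurable (borel \<Otimes>\<^sub>M borel)"
    by measurable
  show "(\<integral>\<^sup>+r. ennreal (\<rho> (T - (r + h)) (T - r) powr p) \<partial>lborel) \<le> ennreal ((K * h powr \<gamma>) powr p)"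
    if "0 < h" "h \<le> T / 2" for h
    using int_le[OF that]
      nn_integral_real_affine[where c="-1" and t="T - h" and f="\<lambda>r. ennreal (\<rho> r (r + h) powr p)"]
    by (simp add: algebra_simps)
  show "\<rho> (T - t) (T - s) \<le> \<rho> (T - u) (T - s) + \<rho> (T - t) (T - u) + K * (t - s) powr \<kappa>"
    if "0 \<le> s" "s \<le> u" "u \<le> t" "t \<le> T" for s u t
    using triangle[of "T - t" "T - u" "T - s"] that by simp
  show "0 \<le> s \<and> s \<le> t \<and> t \<le> T" if "\<rho> (T - t) (T - s) \<noteq> 0" for s t
    using support[OF that] by auto
qed (use T_pos p_pos \<gamma>_pos K_pos \<kappa> \<kappa>_pos nonneg in auto)

definition chain_const :: real where
  "chain_const = (4 * avg_const + 7) powr (1 / e)"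

text \<open>A point \<open>s + x\<close> near the left end and a point \<open>t - y\<close> near the
  right end are inserted and averaged over. The outer terms are averages at a single end point,
  bounded by \<open>right_avg_le\<close> and its reflection; the middle term is a rectangle.\<close>

theorem AE_le:
  "\<exists>G. (AE s in lborel. s \<in> G) \<and>
     (\<forall>s\<in>G. \<forall>t\<in>G. 0 \<le> s \<and> s < t \<and> t \<le> T \<longrightarrow> \<rho> s t \<le> chain_const * K * (t - s) powr \<kappa>)"
proof -
  interpret R: chaining T p \<gamma> K \<kappa> "\<lambda>s t. \<rho> (T - t) (T - s)"
    by (rule reflected)
  \<comment> \<open>The first condition makes a point good as a left end, the second as a right end,
    so one set can serve both \<open>s\<close> and \<open>t\<close>.\<close>
  define G where "G = {s. log_int s \<noteq> \<infinity> \<and> R.log_int (T - s) \<noteq> \<infinity>}"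
  have "AE s in lborel. R.log_int (T + (-1) * s) \<noteq> \<infinity>"
    by (rule AE_borel_affine) (use R.log_int_finite in auto)
  with log_int_finite have "AE s in lborel. s \<in> G"
    by (auto simp: G_def)
  moreover have "\<rho> s t \<le> chain_const * K * (t - s) powr \<kappa>"
    if G: "s \<in> G" "t \<in> G" and st: "0 \<le> s" "s < t" "t \<le> T" for s t
  proof -
    define h where "h = t - s"
    have h: "0 < h" "h \<le> T" using st by (auto simp: h_def)
    \<comment> \<open>For \<open>x, y\<close> in this window the gap between \<open>s + x\<close>
      and \<open>t - y\<close> lies in \<open>(0, h/2)\<close>, hence below \<open>T/2\<close>, so
      the integral bound is available even for \<open>h\<close> close to \<open>T\<close>. It is
      also the window of \<open>right_avg\<close> at scale \<open>h/2\<close>.\<close>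
    let ?V = "{h/4<..<h/2}"
    have g_le: "(\<integral>\<^sup>+v. indicator ?V v * f v \<partial>lborel) \<le> ennreal (h / 2 * avg_const * scale h)"
      if le: "ennreal (1 / (h / 2)) * (\<integral>\<^sup>+v. indicator {h/2/2<..<h/2} v * f v \<partial>lborel) \<le> ennreal (avg_const * scale (h / 2))"
      for f
    proof -
      have "(\<integral>\<^sup>+v. indicator ?V v * f v \<partial>lborel)
          = ennreal (h / 2) * (ennreal (1 / (h / 2)) * (\<integral>\<^sup>+v. indicator {h/2/2<..<h/2} v * f v \<partial>lborel))"
        using h by (simp add: mult.assoc[symmetric] ennreal_mult[symmetric])
      also have "\<dots> \<le> ennreal (h / 2) * ennreal (avg_const * scale (h / 2))"
        by (intro mult_left_mono le) simp
      also have "\<dots> \<le> ennreal (h / 2) * ennreal (avg_const * scale h)"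
        unfolding scale_def using avg_const_pos h K_pos e_pos \<kappa>_pos
        by (intro mult_left_mono ennreal_leI powr_mono2) auto
      finally show ?thesis using h avg_const_pos by (simp add: ennreal_mult[symmetric] mult.assoc)
    qed
    have left: "(\<integral>\<^sup>+v. indicator ?V v * \<sigma> s (s + v) \<partial>lborel) \<le> ennreal (h / 2 * avg_const * scale h)"
    proof -
      have "s + h / 2 \<le> T" using st h by (simp add: h_def field_simps)
      then have "right_avg s (h/2) \<le> ennreal (avg_const * scale (h/2))"
        using st h G by (intro right_avg_le) (auto simp: G_def)
      then show ?thesis
        unfolding right_avg_def by (rule g_le)
    qed
    have half: "T - t + h / 2 \<le> T" using st h by (simp add: h_def field_simps)
    have "R.right_avg (T - t) (h/2) \<le> ennreal (avg_const * scale (h/2))"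
      using st h G half by (intro R.right_avg_le) (auto simp: G_def)
    then have right: "(\<integral>\<^sup>+v. indicator ?V v * \<sigma> (t - v) t \<partial>lborel) \<le> ennreal (h / 2 * avg_const * scale h)"
      unfolding R.right_avg_def R.\<sigma>_def \<sigma>_def by (intro g_le) (simp add: algebra_simps)
    have scale_le: "scale x \<le> scale h" if "0 \<le> x" "x \<le> h" for x
      unfolding scale_def using that K_pos e_pos \<kappa>_pos by (intro powr_mono2 mult_left_mono) auto
    have V: "emeasure lborel ?V = ennreal (h / 4)" using h by simp
    have "ennreal (h / 4) * ennreal (h / 4) * \<sigma> s t
        = (\<integral>\<^sup>+x. \<integral>\<^sup>+y. indicator ?V x * indicator ?V y * \<sigma> s t \<partial>lborel \<partial>lborel)"
      using V by (simp add: nn_integral_cmult nn_integral_multc mult.assoc)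
    also have "\<dots> \<le> (\<integral>\<^sup>+x. \<integral>\<^sup>+y. indicator ?V y * (indicator ?V x * \<sigma> s (s + x))
       + indicator ?V x * indicator ?V y * \<sigma> (s + x) (t + (-1) * y)
       + indicator ?V x * (indicator ?V y * \<sigma> (t - y) t)
       + ennreal (2 * scale h) * (indicator ?V x * indicator ?V y) \<partial>lborel \<partial>lborel)"
    proof (intro nn_integral_mono)
      fix x y
      have "\<sigma> s t \<le> \<sigma> s (s + x) + \<sigma> (s + x) (t - y) + \<sigma> (t - y) t + ennreal (2 * scale h)"
        if "x \<in> ?V" "y \<in> ?V"
      proof -
        have 1: "\<sigma> s t \<le> \<sigma> s (s + x) + \<sigma> (s + x) t + ennreal (scale (t - s))"
          using that st h_def by (intro \<sigma>_triangle) auto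
        have 2: "\<sigma> (s + x) t \<le> \<sigma> (s + x) (t - y) + \<sigma> (t - y) t + ennreal (scale (t - (s + x)))"
          using that st h_def by (intro \<sigma>_triangle) auto
        have "scale (t - (s + x)) \<le> scale h"
          using that h by (intro scale_le) (auto simp: h_def)
        then have 3: "ennreal (scale (t - (s + x))) \<le> ennreal (scale h)" by (rule ennreal_leI)
        have "\<sigma> s t \<le> \<sigma> s (s + x) + (\<sigma> (s + x) (t - y) + \<sigma> (t - y) t + ennreal (scale h)) + ennreal (scale h)"
          using order_trans[OF 1 add_right_mono[OF add_left_mono[OF order_trans[OF 2 add_left_mono[OF 3]]]]]
          by (simp add: h_def)
        also have "\<dots> = \<sigma> s (s + x) + \<sigma> (s + x) (t - y) + \<sigma> (t - y) t + (ennreal (scale h) + ennreal (scale h))"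
          by (simp add: ac_simps)
        also have "ennreal (scale h) + ennreal (scale h) = ennreal (2 * scale h)"
          by (simp flip: ennreal_plus)
        finally show ?thesis .
      qed
      then show "indicator ?V x * indicator ?V y * \<sigma> s t \<le> indicator ?V y * (indicator ?V x * \<sigma> s (s + x))
       + indicator ?V x * indicator ?V y * \<sigma> (s + x) (t + (-1) * y)
       + indicator ?V x * (indicator ?V y * \<sigma> (t - y) t)
       + ennreal (2 * scale h) * (indicator ?V x * indicator ?V y)"
        by (auto simp: indicator_def)
    qed
    also have "\<dots> = ennreal (h / 4) * (\<integral>\<^sup>+v. indicator ?V v * \<sigma> s (s + v) \<partial>lborel)
       + (\<integral>\<^sup>+x. \<integral>\<^sup>+y. indicator ?V x * indicator ?V y * \<sigma> (s + x) (t + (-1) * y) \<partial>lborel \<partial>lborel)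
       + ennreal (h / 4) * (\<integral>\<^sup>+v. indicator ?V v * \<sigma> (t - v) t \<partial>lborel)
       + ennreal (2 * scale h) * (ennreal (h / 4) * ennreal (h / 4))"
      using V by (simp add: nn_integral_add nn_integral_cmult nn_integral_multc)
    also have "\<dots> \<le> ennreal (h / 4) * ennreal (h / 2 * avg_const * scale h)
       + ennreal (scale h) * (ennreal (h / 4) * ennreal (h / 4) + ennreal ((h / 2)\<^sup>2))
       + ennreal (h / 4) * ennreal (h / 2 * avg_const * scale h)
       + ennreal (2 * scale h) * (ennreal (h / 4) * ennreal (h / 4))"
    proof -
      have "(\<integral>\<^sup>+x. \<integral>\<^sup>+y. indicator ?V x * indicator ?V y * \<sigma> (s + x) (t + (-1) * y) \<partial>lborel \<partial>lborel)
        \<le> ennreal (scale (h / 2)) * (emeasure lborel ?V * emeasure lborel ?V + ennreal ((h / 2)\<^sup>2))"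
        using h st by (intro rectangle_\<sigma>_le) (auto simp: h_def)
      also have "\<dots> \<le> ennreal (scale h) * (emeasure lborel ?V * emeasure lborel ?V + ennreal ((h / 2)\<^sup>2))"
        using h by (intro mult_right_mono ennreal_leI scale_le) auto
      finally show ?thesis
        using left right unfolding V by (intro add_mono mult_left_mono) auto
    qed
    \<comment> \<open>In units of \<open>scale h * h\<^sup>2 / 16\<close>: each end contributes
      \<open>2 * avg_const\<close>, the middle rectangle 1 + 4, and the two triangle errors
      2.\<close>
    also have "\<dots> = ennreal ((4 * avg_const + 7) * scale h * h\<^sup>2 / 16)"
      using h avg_const_pos
      by (simp add: ennreal_mult[symmetric] ennreal_plus[symmetric] power2_eq_square field_simps del: ennreal_plus)
    finally have "ennreal (h / 4) * ennreal (h / 4) * ennreal (\<rho> s t powr e)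
        \<le> ennreal ((4 * avg_const + 7) * scale h * h\<^sup>2 / 16)"
      by (simp add: \<sigma>_def)
    then have "h / 4 * (h / 4) * \<rho> s t powr e \<le> (4 * avg_const + 7) * scale h * h\<^sup>2 / 16"
      using h avg_const_pos by (simp add: ennreal_mult[symmetric])
    then have "h\<^sup>2 * \<rho> s t powr e \<le> h\<^sup>2 * ((4 * avg_const + 7) * scale h)"
      by (simp add: power2_eq_square algebra_simps)
    then have "\<rho> s t powr e \<le> (4 * avg_const + 7) * scale h"
      using h by (subst (asm) mult_le_cancel_left_pos) auto
    then have "(\<rho> s t powr e) powr (1 / e) \<le> ((4 * avg_const + 7) * scale h) powr (1 / e)"
      using e_pos by (intro powr_mono2) auto
    then show ?thesis
      using e_pos K_pos h nonneg[of s t] avg_const_pos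
      by (simp add: powr_powr powr_mult scale_def chain_const_def h_def)
  qed
  ultimately show ?thesis by blast
qed

end

section \<open>Dyadic sewing\<close>

lemma vnorm_nonneg [simp]: "0 \<le> vnorm m x"
  by (simp add: vnorm_def)

lemma vnorm_cong: "(\<And>i. i < m \<Longrightarrow> x i = y i) \<Longrightarrow> vnorm m x = vnorm m y"
  unfolding vnorm_def by (rule L2_set_cong) auto

lemma vnorm_add_le: "vnorm m (\<lambda>i. x i + y i) \<le> vnorm m x + vnorm m y"
  unfolding vnorm_def by (rule L2_set_triangle_ineq)

lemma vnorm_uminus: "vnorm m (\<lambda>i. - x i) = vnorm m x"
  by (simp add: vnorm_def L2_set_def)

lemma vnorm_zero: "vnorm m (\<lambda>i. 0) = 0"
  by (simp add: vnorm_def L2_set_def)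

lemma vnorm_eq_0_iff: "vnorm m x = 0 \<longleftrightarrow> (\<forall>i<m. x i = 0)"
  unfolding vnorm_def by (subst L2_set_eq_0_iff) auto

lemma vnorm_sum_le: "vnorm m (\<lambda>i. \<Sum>k\<in>S. f k i) \<le> (\<Sum>k\<in>S. vnorm m (f k))"
proof (induction S rule: infinite_finite_induct)
  case (insert k S)
  then show ?case
    using vnorm_add_le[of m "f k" "\<lambda>i. \<Sum>k\<in>S. f k i"] by simp
qed (auto simp: vnorm_zero)

lemma abs_le_vnorm: "i < m \<Longrightarrow> \<bar>x i\<bar> \<le> vnorm m x"
  unfolding vnorm_def using member_le_L2_set[of "{..<m}" i "\<lambda>i. \<bar>x i\<bar>"]
  by (simp add: L2_set_def)

lemma vnorm_measurable [measurable]: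
  assumes "\<And>i. i < m \<Longrightarrow> (\<lambda>x. f x i) \<in> borel_measurable N"
  shows "(\<lambda>x. vnorm m (f x)) \<in> borel_measurable N"
  unfolding vnorm_def L2_set_def using assms by measurable

lemma map2_measurable_curve:
  assumes A: "map2_measurable T m A" "i < m"
    and [measurable]: "g1 \<in> borel_measurable borel" "g2 \<in> borel_measurable borel"
    and S: "\<And>r. r \<in> S \<Longrightarrow> 0 \<le> g1 r \<and> g1 r \<le> g2 r \<and> g2 r \<le> T"
  shows "(\<lambda>r. A (g1 r) (g2 r) i) \<in> borel_measurable (restrict_space lborel S)"
proof -
  have "(\<lambda>r. (g1 r, g2 r)) \<in> restrict_space lborel S \<rightarrow>\<^sub>M restrict_space borel (Delta2 T)"
  proof (rule measurable_restrict_space2)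
    show "(\<lambda>r. (g1 r, g2 r)) \<in> space (restrict_space lborel S) \<rightarrow> Delta2 T"
      using S by (auto simp: space_restrict_space Delta2_def)
    show "(\<lambda>r. (g1 r, g2 r)) \<in> borel_measurable (restrict_space lborel S)"
      unfolding borel_prod[symmetric] by (intro measurable_restrict_space1) measurable
  qed
  from measurable_compose[OF this, of "\<lambda>(s, t). A s t i" borel] A show ?thesis
    by (simp add: map2_measurable_def)
qed

lemma path_incr_measurable:
  assumes "path_measurable T m f"
  shows "map2_measurable T m (path_incr f)"
  unfolding map2_measurable_def
proof (intro allI impI)
  fix i assume i: "i < m"
  have f: "(\<lambda>t. f t i) \<in> borel_measurable (restrict_space borel {0..T})"
    using assms i by (simp add: path_measurable_def)
  have "fst \<in> restrict_space borel (Delta2 T) \<rightarrow>\<^sub>M restrict_space borel {0..T}"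
    by (rule measurable_restrict_space3) (auto simp: Delta2_def borel_prod[symmetric])
  moreover have "snd \<in> restrict_space borel (Delta2 T) \<rightarrow>\<^sub>M restrict_space borel {0..T}"
    by (rule measurable_restrict_space3) (auto simp: Delta2_def borel_prod[symmetric])
  ultimately have [measurable]:
    "(\<lambda>x. f (fst x) i) \<in> borel_measurable (restrict_space borel (Delta2 T))"
    "(\<lambda>x. f (snd x) i) \<in> borel_measurable (restrict_space borel (Delta2 T))"
    using measurable_compose[OF _ f] by auto
  show "(\<lambda>(s, t). path_incr f s t i) \<in> borel_measurable (restrict_space borel (Delta2 T))"
    unfolding path_incr_def case_prod_beta by measurable
qed

lemma map2_measurable_diff:
  assumes "map2_measurable T m A" "map2_measurable T m B"
  shows "map2_measurable T m (\<lambda>s t i. A s t i - B s t i)"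
  using assms unfolding map2_measurable_def case_prod_beta by (auto intro!: borel_measurable_diff)

lemma remainder_measurable:
  assumes "map2_measurable T m A" "path_measurable T m f"
  shows "map2_measurable T m (remainder A f)"
  using map2_measurable_diff[OF path_incr_measurable[OF assms(2)] assms(1)]
  by (simp add: remainder_def[abs_def])

lemma vnorm_curve_measurable:
  assumes "map2_measurable T m A"
    and "g1 \<in> borel_measurable borel" "g2 \<in> borel_measurable borel"
    and "\<And>r. r \<in> S \<Longrightarrow> 0 \<le> g1 r \<and> g1 r \<le> g2 r \<and> g2 r \<le> T"
  shows "(\<lambda>r. vnorm m (A (g1 r) (g2 r))) \<in> borel_measurable (restrict_space lborel S)"
  by (rule vnorm_measurable) (rule map2_measurable_curve[OF assms(1) _ assms(2-4)])

lemma delta_curve_measurable: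
  assumes "map2_measurable T m A" and [measurable]: "g1 \<in> borel_measurable borel"
      "g2 \<in> borel_measurable borel" "g3 \<in> borel_measurable borel"
    and S: "\<And>r. r \<in> S \<Longrightarrow> 0 \<le> g1 r \<and> g1 r \<le> g2 r \<and> g2 r \<le> g3 r \<and> g3 r \<le> T"
  shows "(\<lambda>r. vnorm m (delta A (g1 r) (g2 r) (g3 r))) \<in> borel_measurable (restrict_space lborel S)"
proof (intro vnorm_measurable)
  fix i assume i: "i < m"
  have [measurable]: "(\<lambda>r. A (g1 r) (g3 r) i) \<in> borel_measurable (restrict_space lborel S)"
    "(\<lambda>r. A (g1 r) (g2 r) i) \<in> borel_measurable (restrict_space lborel S)"
    "(\<lambda>r. A (g2 r) (g3 r) i) \<in> borel_measurable (restrict_space lborel S)"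
    by (rule map2_measurable_curve[OF assms(1) i]; use S in force)+
  show "(\<lambda>r. delta A (g1 r) (g2 r) (g3 r) i) \<in> borel_measurable (restrict_space lborel S)"
    unfolding delta_def by measurable
qed

text \<open>Convexity is invoked for positive \<open>x\<close> and \<open>y\<close>; if one of them
  vanishes, the claim reduces to \<open>a powr p \<le> a\<close> for a weight \<open>a\<close> in
  \<open>[0,1]\<close>.\<close>

lemma powr_convex_combination:
  assumes "0 \<le> x" "0 \<le> y" "0 \<le> u" "0 \<le> v" "u + v = 1" "1 \<le> (p::real)"
  shows "(u * x + v * y) powr p \<le> u * x powr p + v * y powr p"
proof -
  have *: "(a * z) powr p \<le> a * z powr p" if "0 \<le> a" "a \<le> 1" "0 \<le> z" for a z
  proof (cases "a = 0")
    case False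
    then have "a powr p \<le> a powr 1" using that assms by (intro powr_mono') auto
    then show ?thesis using that False by (simp add: powr_mult mult_right_mono)
  qed auto
  have le1: "u \<le> 1" "v \<le> 1" and u: "u = 1 - v" using assms by linarith+
  consider "x = 0" | "y = 0" | "0 < x" "0 < y" using assms by linarith
  then show ?thesis
  proof cases
    case 1
    then show ?thesis using *[OF assms(4) le1(2) assms(2)] by simp
  next
    case 2
    then show ?thesis using *[OF assms(3) le1(1) assms(1)] by simp
  next
    case 3
    then show ?thesis
      using convex_onD[OF powr_convex[OF assms(6)] assms(4) le1(2), of x y] by (simp add: u)
  qed
qed

text \<open>Minkowski's inequality; the exponent \<open>max 1 p\<close> makes it the triangle inequality for
  \<open>\<parallel>\<cdot>\<parallel>\<^sub>p\<close> to the power \<open>min 1 p\<close>, for all \<open>p > 0\<close>.\<close>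

lemma nn_integral_powr_add_le:
  assumes p: "0 < p" and [measurable]: "f \<in> borel_measurable N" "g \<in> borel_measurable N"
    and nonneg: "\<And>x. 0 \<le> f x" "\<And>x. 0 \<le> g x" "0 \<le> a" "0 \<le> b"
    and f: "(\<integral>\<^sup>+x. ennreal (f x powr p) \<partial>N) \<le> ennreal (a powr max 1 p)"
    and g: "(\<integral>\<^sup>+x. ennreal (g x powr p) \<partial>N) \<le> ennreal (b powr max 1 p)"
  shows "(\<integral>\<^sup>+x. ennreal ((f x + g x) powr p) \<partial>N) \<le> ennreal ((a + b) powr max 1 p)"
proof (cases "p \<le> 1")
  case True
  have "(\<integral>\<^sup>+x. ennreal ((f x + g x) powr p) \<partial>N) \<le> (\<integral>\<^sup>+x. ennreal (f x powr p) + ennreal (g x powr p) \<partial>N)"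
    using True p nonneg
    by (intro nn_integral_mono) (auto simp flip: ennreal_plus intro!: ennreal_leI powr_add_le_of_le_1)
  also have "\<dots> = (\<integral>\<^sup>+x. ennreal (f x powr p) \<partial>N) + (\<integral>\<^sup>+x. ennreal (g x powr p) \<partial>N)"
    by (intro nn_integral_add) auto
  also have "\<dots> \<le> ennreal a + ennreal b"
    using f g True nonneg by (intro add_mono) auto
  finally show ?thesis using True nonneg by simp
next
  case False
  \<comment> \<open>The convexity argument below divides by \<open>a\<close> and \<open>b\<close>;
    when one of them is 0, the corresponding function vanishes almost everywhere and drops
    out.\<close>
  have zero: "AE x in N. u x = 0"
    if "(\<integral>\<^sup>+x. ennreal (u x powr p) \<partial>N) \<le> ennreal (0 powr max 1 p)" "u \<in> borel_measurable N" for u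
  proof -
    note [measurable] = that(2)
    have "(\<integral>\<^sup>+x. ennreal (u x powr p) \<partial>N) = 0" using that(1) by simp
    then have "AE x in N. ennreal (u x powr p) = 0"
      by (subst (asm) nn_integral_0_iff_AE) auto
    then show ?thesis by eventually_elim (simp add: ennreal_eq_0_iff)
  qed
  consider "a = 0" | "b = 0" | "0 < a" "0 < b" using nonneg by linarith
  then show ?thesis
  proof cases
    case 1
    have "(\<integral>\<^sup>+x. ennreal ((f x + g x) powr p) \<partial>N) = (\<integral>\<^sup>+x. ennreal (g x powr p) \<partial>N)"
      using zero[of f] f 1 by (intro nn_integral_cong_AE) auto
    then show ?thesis using g 1 by simp
  next
    case 2
    have "(\<integral>\<^sup>+x. ennreal ((f x + g x) powr p) \<partial>N) = (\<integral>\<^sup>+x. ennreal (f x powr p) \<partial>N)"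
      using zero[of g] g 2 by (intro nn_integral_cong_AE) auto
    then show ?thesis using f 2 by simp
  next
    case 3
    define c where "c = (a + b) powr p"
    have c: "0 < c" using 3 by (simp add: c_def)
    have ap: "0 < a powr p" "0 < b powr p" using 3 by auto
    \<comment> \<open>Weights proportional to the norm bounds make both normalized functions
      \<open>f / a\<close> and \<open>g / b\<close> have norm at most 1, so the convex combination
      yields exactly \<open>a + b\<close>.\<close>
    define u where "u = a / (a + b)"
    define v where "v = b / (a + b)"
    have uv: "0 \<le> u" "0 \<le> v" "u + v = 1" using 3 by (auto simp: u_def v_def add_divide_distrib[symmetric])
    have pointwise: "(f x + g x) powr p \<le> c * u / a powr p * f x powr p + c * v / b powr p * g x powr p" for x
    proof -
      have "f x + g x = (a + b) * (u * (f x / a) + v * (g x / b))"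
      proof -
        have "u * (f x / a) = f x / (a + b)" "v * (g x / b) = g x / (a + b)"
          using 3 by (simp_all add: u_def v_def)
        then show ?thesis using 3 by (simp add: add_divide_distrib[symmetric])
      qed
      then have "(f x + g x) powr p = c * (u * (f x / a) + v * (g x / b)) powr p"
        using 3 uv nonneg by (simp add: c_def powr_mult)
      also have "\<dots> \<le> c * (u * (f x / a) powr p + v * (g x / b) powr p)"
        using 3 uv nonneg False c by (intro mult_left_mono powr_convex_combination) auto
      also have "\<dots> = c * u / a powr p * f x powr p + c * v / b powr p * g x powr p"
        using 3 nonneg by (simp add: powr_divide field_simps)
      finally show ?thesis .
    qed
    have "(\<integral>\<^sup>+x. ennreal ((f x + g x) powr p) \<partial>N)
      \<le> (\<integral>\<^sup>+x. ennreal (c * u / a powr p) * ennreal (f x powr p) + ennreal (c * v / b powr p) * ennreal (g x powr p) \<partial>N)"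
      using pointwise c uv
      by (intro nn_integral_mono) (auto simp: ennreal_mult[symmetric] intro!: ennreal_leI simp flip: ennreal_plus)
    also have "\<dots> = ennreal (c * u / a powr p) * (\<integral>\<^sup>+x. ennreal (f x powr p) \<partial>N)
        + ennreal (c * v / b powr p) * (\<integral>\<^sup>+x. ennreal (g x powr p) \<partial>N)"
      by (simp add: nn_integral_add nn_integral_cmult)
    also have "\<dots> \<le> ennreal (c * u / a powr p) * ennreal (a powr p) + ennreal (c * v / b powr p) * ennreal (b powr p)"
      using f g False by (intro add_mono mult_left_mono) (auto simp: max_def)
    also have "\<dots> = ennreal (c * u + c * v)"
      using ap c uv 3 by (simp add: ennreal_mult[symmetric])
    also have "c * u + c * v = c" using uv by (simp flip: distrib_left)
    finally show ?thesis using False by (simp add: c_def max_def)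
  qed
qed

lemma nn_integral_powr_sum_le:
  assumes p: "0 < p" and meas: "\<And>k. k \<in> S \<Longrightarrow> f k \<in> borel_measurable N"
    and nonneg: "\<And>k x. 0 \<le> f k x" "\<And>k. 0 \<le> a k"
    and f: "\<And>k. k \<in> S \<Longrightarrow> (\<integral>\<^sup>+x. ennreal (f k x powr p) \<partial>N) \<le> ennreal (a k powr max 1 p)"
  shows "(\<integral>\<^sup>+x. ennreal ((\<Sum>k\<in>S. f k x) powr p) \<partial>N) \<le> ennreal ((\<Sum>k\<in>S. a k) powr max 1 p)"
  using meas f
proof (induction S rule: infinite_finite_induct)
  case (insert k S)
  have "(\<integral>\<^sup>+x. ennreal ((f k x + (\<Sum>k\<in>S. f k x)) powr p) \<partial>N) \<le> ennreal ((a k + (\<Sum>k\<in>S. a k)) powr max 1 p)"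
    using insert nonneg by (intro nn_integral_powr_add_le p borel_measurable_sum sum_nonneg) auto
  then show ?case using insert by simp
qed auto

section \<open>Moduli and telescoping of dyadic partition sums\<close>

lemma Omega_mono: "mono_on S (Omega T m p A)"
  unfolding Omega_def mono_on_def by (auto intro!: SUP_subset_mono)

lemma Omega3_mono: "mono_on S (Omega3 T m p B)"
  unfolding Omega3_def mono_on_def by (auto intro!: SUP_mono' SUP_subset_mono)

lemma Lp_norm_le_Omega:
  "0 \<le> h \<Longrightarrow> h \<le> \<tau> \<Longrightarrow> Lp_norm (restrict_space lborel {0..T - h}) p (\<lambda>r. ennreal (vnorm m (A r (r + h))))
    \<le> Omega T m p A \<tau>"
  unfolding Omega_def by (rule SUP_upper2[of h]) auto

lemma Lp_norm_le_Omega3: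
  "0 \<le> h \<Longrightarrow> h \<le> \<tau> \<Longrightarrow> 0 \<le> \<theta> \<Longrightarrow> \<theta> \<le> 1 \<Longrightarrow>
    Lp_norm (restrict_space lborel {0..T - h}) p (\<lambda>r. ennreal (vnorm m (B r (r + \<theta> * h) (r + h))))
    \<le> Omega3 T m p B \<tau>"
  unfolding Omega3_def by (rule SUP_upper2[of \<theta>], simp, rule SUP_upper2[of h]) auto

lemma Omega_le_BB_norm:
  assumes "0 < q" "0 < \<gamma>" "0 < h" "h \<le> T / 2"
  shows "Omega T m p A h \<le> ennreal (2 powr recip q * (2 * h) powr \<gamma>) * BB_norm T m \<gamma> p q A"
  unfolding BB_norm_def by (intro mono_le_Lp_norm_log_measure Omega_mono assms)

lemma Omega3_le_BB3_norm:
  assumes "0 < q" "0 < \<gamma>" "0 < h" "h \<le> T / 2"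
  shows "Omega3 T m p B h \<le> ennreal (2 powr recip q * (2 * h) powr \<gamma>) * BB3_norm T m \<gamma> p q B"
  unfolding BB3_norm_def by (intro mono_le_Lp_norm_log_measure Omega3_mono assms)

lemma unit_partition_dyadic: "unit_partition (2 ^ n) (\<lambda>k. real k / 2 ^ n)"
  by (auto simp: unit_partition_def strict_mono_on_def divide_strict_right_mono)

lemma mesh_dyadic: "mesh (2 ^ n) (\<lambda>k. real k / 2 ^ n) = 1 / 2 ^ n"
proof -
  have "(\<lambda>i. real (Suc i) / 2 ^ n - real i / 2 ^ n) ` {..<2 ^ n} = {1 / 2 ^ n :: real}"
    by (auto simp: field_simps intro!: image_eqI[of _ _ 0])
  then show ?thesis by (simp add: mesh_def)
qed

definition dyadic_sum :: "nat \<Rightarrow> (real \<Rightarrow> real \<Rightarrow> nat \<Rightarrow> real) \<Rightarrow> real \<Rightarrow> real \<Rightarrow> nat \<Rightarrow> real" where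
  "dyadic_sum n A = partition_sum (2 ^ n) (\<lambda>k. real k / 2 ^ n) A"

lemma dyadic_sum_eq:
  "dyadic_sum n A s (s + h) i = (\<Sum>k<2 ^ n. A (s + real k * (h / 2 ^ n)) (s + real k * (h / 2 ^ n) + h / 2 ^ n) i)"
  unfolding dyadic_sum_def partition_sum_def
  by (intro sum.cong refl arg_cong2[where f="\<lambda>x y. A x y i"]) (auto simp: field_simps)

lemma sum_lessThan_double: "(\<Sum>k<2 * n. f k) = (\<Sum>k<n. f (2 * k) + f (2 * k + 1 :: nat) :: real)"
  by (induction n) (auto simp: algebra_simps)

text \<open>Refinement inserts the midpoint of each of the \<open>2 ^ n\<close> intervals, and each
  insertion costs one value of \<open>delta A\<close>.\<close>

lemma dyadic_sum_step:
  "dyadic_sum n A s (s + h) i - dyadic_sum (Suc n) A s (s + h) i =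
    (\<Sum>k<2 ^ n. delta A (s + real k * (h / 2 ^ n)) (s + real k * (h / 2 ^ n) + h / 2 ^ n / 2) (s + real k * (h / 2 ^ n) + h / 2 ^ n) i)"
  unfolding dyadic_sum_eq power_Suc sum_lessThan_double sum_subtractf[symmetric]
proof (intro sum.cong refl)
  fix k :: nat
  let ?x = "s + real k * (h / 2 ^ n)"
  have eqs: "s + real (2 * k) * (h / (2 * 2 ^ n)) = ?x" "?x + h / (2 * 2 ^ n) = ?x + h / 2 ^ n / 2"
    "s + real (2 * k + 1) * (h / (2 * 2 ^ n)) = ?x + h / 2 ^ n / 2"
    "?x + h / 2 ^ n / 2 + h / (2 * 2 ^ n) = ?x + h / 2 ^ n"
    by (simp_all add: field_simps)
  show "A ?x (?x + h / 2 ^ n) i - (A (s + real (2 * k) * (h / (2 * 2 ^ n))) (s + real (2 * k) * (h / (2 * 2 ^ n)) + h / (2 * 2 ^ n)) i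
     + A (s + real (2 * k + 1) * (h / (2 * 2 ^ n))) (s + real (2 * k + 1) * (h / (2 * 2 ^ n)) + h / (2 * 2 ^ n)) i)
     = delta A ?x (?x + h / 2 ^ n / 2) (?x + h / 2 ^ n) i"
    unfolding eqs delta_def by simp
qed

lemma nn_integral_translate_le:
  assumes [measurable]: "f \<in> borel_measurable (restrict_space lborel {0..b::real})"
    and "0 \<le> c" "a + c \<le> b"
  shows "(\<integral>\<^sup>+x. f (x + c) \<partial>restrict_space lborel {0..a}) \<le> (\<integral>\<^sup>+x. f x \<partial>restrict_space lborel {0..b} :: ennreal)"
proof -
  have [measurable]: "(\<lambda>x. f x * indicator {0..b} x) \<in> borel_measurable borel"
    using borel_measurable_restrict_space_iff_ennreal[of "{0..b}" lborel f] assms(1) by simp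
  have "(\<integral>\<^sup>+x. f (x + c) \<partial>restrict_space lborel {0..a}) = (\<integral>\<^sup>+x. f (x + c) * indicator {0..a} x \<partial>lborel)"
    by (simp add: nn_integral_restrict_space)
  also have "\<dots> \<le> (\<integral>\<^sup>+x. f (c + 1 * x) * indicator {0..b} (c + 1 * x) \<partial>lborel)"
    using assms by (intro nn_integral_mono) (auto simp: indicator_def add.commute)
  also have "\<dots> = (\<integral>\<^sup>+x. f x * indicator {0..b} x \<partial>lborel)"
    using nn_integral_real_affine[where c=1 and t=c and f="\<lambda>x. f x * indicator {0..b} x"] by simp
  also have "\<dots> = (\<integral>\<^sup>+x. f x \<partial>restrict_space lborel {0..b})"
    by (simp add: nn_integral_restrict_space)
  finally show ?thesis .
qed

lemma Lp_norm_vnorm_le_iff: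
  assumes "0 < p" "0 \<le> c"
  shows "Lp_norm N (ennreal p) (\<lambda>x. ennreal (vnorm m (f x))) \<le> ennreal c
    \<longleftrightarrow> (\<integral>\<^sup>+x. ennreal (vnorm m (f x) powr p) \<partial>N) \<le> ennreal (c powr p)"
  using assms by (simp add: Lp_norm_finite_le_iff ennpowr_ennreal)

lemma min_max_mult: "min 1 p * max 1 p = (p::real)"
  by (auto simp: min_def max_def)

lemma subinterval_ordered:
  fixes x y h r T :: real
  assumes "0 \<le> x" "0 \<le> y" "x + y \<le> h" "0 \<le> r" "r \<le> T - h"
  shows "0 \<le> r + x \<and> r + x \<le> r + x + y / 2 \<and> r + x + y / 2 \<le> r + x + y \<and> r + x + y \<le> T"
  using assms by auto

text \<open>The remainder is a finite telescoping sum over dyadic levels plus the error of the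
  finest partition sum. Level \<open>n\<close> consists of \<open>2 ^ n\<close> translates of one
  function with \<open>L^p\<close> norm at most \<open>b n\<close>; the power \<open>min 1 p\<close>
  of the norm satisfies the triangle inequality, which explains the form of the sums bounded by
  \<open>S\<close>. Only the values \<open>b n\<close> distinguish the supercritical from the
  critical case.\<close>

lemma remainder_integral_le:
  assumes T: "0 < T" and p: "0 < p" and g: "0 < \<gamma>" and h: "0 < h" "h \<le> T / 2"
    and A: "map2_measurable T m A"
    and gi: "generalized_integral T m p1 (ennreal p) q1 q2 \<alpha> \<gamma> A I"
    and b: "\<And>n. 0 \<le> b n"
    and b_le: "\<And>n. (\<integral>\<^sup>+r. ennreal (vnorm m (delta A r (r + h / 2 ^ n / 2) (r + h / 2 ^ n)) powr p)
       \<partial>restrict_space lborel {0..T - h / 2 ^ n}) \<le> ennreal (b n powr p)"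
    and S: "0 < S" "\<And>N. (\<Sum>n<N. 2 ^ n * b n powr min 1 p) \<le> S"
  shows "(\<integral>\<^sup>+r. ennreal (vnorm m (remainder A I r (r + h)) powr p) \<partial>restrict_space lborel {0..T - h})
     \<le> ennreal ((2 * S) powr max 1 p)"
proof -
  define W where "W = restrict_space lborel {0..T - h}"
  have Im: "path_measurable T m I"
    using gi by (simp add: generalized_integral_def Besov_space_def)
  \<comment> \<open>Chosen so that the error of the finest level, once
    \<open>Omega_le_BB_norm\<close> has restored the factor \<open>(2 * h) powr \<gamma>\<close>, is
    at most \<open>S\<close> in the same units as the telescoping sum; hence the final
    \<open>2 * S\<close>.\<close>
  define \<epsilon> where "\<epsilon> = S powr (max 1 p / p) / (2 * h) powr \<gamma>"
  have eps: "0 < \<epsilon>" using S h by (simp add: \<epsilon>_def)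
  obtain d where d: "0 < d" "\<And>N \<pi>. unit_partition N \<pi> \<and> mesh N \<pi> < d \<Longrightarrow>
        BB_norm T m \<gamma> (ennreal p) \<infinity> (\<lambda>s t i. partition_sum N \<pi> A s t i - path_incr I s t i) < ennreal \<epsilon>"
    using gi eps unfolding generalized_integral_def by meson
  obtain N where N: "(1 / 2) ^ N < d"
    using real_arch_pow_inv[OF d(1), of "1/2"] by auto
  let ?E = "\<lambda>s t i. dyadic_sum N A s t i - path_incr I s t i"
  have E_BB: "BB_norm T m \<gamma> (ennreal p) \<infinity> ?E < ennreal \<epsilon>"
    using d(2)[of "2 ^ N" "\<lambda>k. real k / 2 ^ N"] N
    by (simp add: unit_partition_dyadic mesh_dyadic dyadic_sum_def power_one_over)
  have E: "(\<integral>\<^sup>+r. ennreal (vnorm m (?E r (r + h)) powr p) \<partial>W) \<le> ennreal (S powr max 1 p)"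
  proof -
    have "Lp_norm W (ennreal p) (\<lambda>r. ennreal (vnorm m (?E r (r + h)))) \<le> Omega T m (ennreal p) ?E h"
      unfolding W_def using h by (intro Lp_norm_le_Omega[where A="?E"]) auto
    also have "\<dots> \<le> ennreal (2 powr recip \<infinity> * (2 * h) powr \<gamma>) * BB_norm T m \<gamma> (ennreal p) \<infinity> ?E"
      using g h by (intro Omega_le_BB_norm) auto
    also have "\<dots> \<le> ennreal ((2 * h) powr \<gamma>) * ennreal \<epsilon>"
      using E_BB by (intro mult_mono) (auto simp: recip_def)
    also have "\<dots> = ennreal (S powr (max 1 p / p))"
      using h by (simp add: \<epsilon>_def ennreal_mult[symmetric])
    finally show ?thesis
      using p S by (simp add: Lp_norm_vnorm_le_iff powr_powr)
  qed
  define D where "D n k r = vnorm m (delta A (r + real k * (h / 2 ^ n)) (r + real k * (h / 2 ^ n) + h / 2 ^ n / 2)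
      (r + real k * (h / 2 ^ n) + h / 2 ^ n))" for n k r
  have hn: "real k * (h / 2 ^ n) + h / 2 ^ n \<le> h" if "k < 2 ^ n" for k n
  proof -
    have "Suc k \<le> 2 ^ n" using that by simp
    then have "real (Suc k) \<le> real (2 ^ n)" by (rule of_nat_mono)
    then have "real (Suc k) * (h / 2 ^ n) \<le> 2 ^ n * (h / 2 ^ n)" using h by (intro mult_right_mono) auto
    moreover have "real (Suc k) * (h / 2 ^ n) = real k * (h / 2 ^ n) + h / 2 ^ n"
      by (simp only: of_nat_Suc distrib_right mult_1_left add.commute)
    ultimately show ?thesis by simp
  qed
  have D_meas: "D n k \<in> borel_measurable W" if "k < 2 ^ n" for n k
    unfolding D_def W_def
  proof (rule delta_curve_measurable[OF A])
    fix r assume "r \<in> {0..T - h}"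
    then have r: "0 \<le> r" "r \<le> T - h" by auto
    have "0 \<le> real k * (h / 2 ^ n)" "0 \<le> h / 2 ^ n" using h by auto
    from subinterval_ordered[OF this hn[OF that] r]
    show "0 \<le> r + real k * (h / 2 ^ n) \<and>
         r + real k * (h / 2 ^ n) \<le> r + real k * (h / 2 ^ n) + h / 2 ^ n / 2 \<and>
         r + real k * (h / 2 ^ n) + h / 2 ^ n / 2 \<le> r + real k * (h / 2 ^ n) + h / 2 ^ n \<and>
         r + real k * (h / 2 ^ n) + h / 2 ^ n \<le> T" .
  qed measurable
  \<comment> \<open>Translation by \<open>k * (h / 2 ^ n)\<close> maps \<open>[0, T - h]\<close>
    into \<open>[0, T - h / 2 ^ n]\<close>, so the bound on a single line serves every
    \<open>k\<close>. The exponents recombine because \<open>min 1 p * max 1 p = p\<close>.\<close>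
  have D_int: "(\<integral>\<^sup>+r. ennreal (D n k r powr p) \<partial>W) \<le> ennreal ((b n powr min 1 p) powr max 1 p)"
    if "k < 2 ^ n" for n k
  proof -
    let ?f = "\<lambda>r. ennreal (vnorm m (delta A r (r + h / 2 ^ n / 2) (r + h / 2 ^ n)) powr p)"
    have "0 \<le> h / 2 ^ n" using h by simp
    then have [measurable]: "(\<lambda>r. vnorm m (delta A r (r + h / 2 ^ n / 2) (r + h / 2 ^ n)))
        \<in> borel_measurable (restrict_space lborel {0..T - h / 2 ^ n})"
      using A by (intro delta_curve_measurable) auto
    have "(\<integral>\<^sup>+r. ennreal (D n k r powr p) \<partial>W) = (\<integral>\<^sup>+r. ?f (r + real k * (h / 2 ^ n)) \<partial>W)"
      by (simp add: D_def)
    also have "\<dots> \<le> (\<integral>\<^sup>+r. ?f r \<partial>restrict_space lborel {0..T - h / 2 ^ n})"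
      unfolding W_def
    proof (rule nn_integral_translate_le)
      show "0 \<le> real k * (h / 2 ^ n)" using h by simp
      show "T - h + real k * (h / 2 ^ n) \<le> T - h / 2 ^ n" using hn[OF that] by linarith
    qed measurable
    also have "\<dots> \<le> ennreal (b n powr p)" by (rule b_le)
    finally show ?thesis by (simp add: powr_powr min_max_mult)
  qed
  have E_meas: "(\<lambda>r. vnorm m (?E r (r + h))) \<in> borel_measurable W"
  proof (intro vnorm_measurable borel_measurable_diff)
    fix i assume i: "i < m"
    show "(\<lambda>r. path_incr I r (r + h) i) \<in> borel_measurable W"
      unfolding W_def using h by (intro map2_measurable_curve[OF path_incr_measurable[OF Im] i]) auto
    show "(\<lambda>r. dyadic_sum N A r (r + h) i) \<in> borel_measurable W"
      unfolding dyadic_sum_eq W_def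
    proof (intro borel_measurable_sum map2_measurable_curve[OF A i])
      fix k r assume "k \<in> {..<2 ^ N :: nat}" "r \<in> {0..T - h}"
      then have k: "k < 2 ^ N" and r: "0 \<le> r" "r \<le> T - h" by auto
      have "0 \<le> real k * (h / 2 ^ N)" "0 \<le> h / 2 ^ N" using h by auto
      from subinterval_ordered[OF this hn[OF k] r]
      show "0 \<le> r + real k * (h / 2 ^ N) \<and>
         r + real k * (h / 2 ^ N) \<le> r + real k * (h / 2 ^ N) + h / 2 ^ N \<and>
         r + real k * (h / 2 ^ N) + h / 2 ^ N \<le> T"
        by (elim conjE) (intro conjI, assumption, rule order_trans, assumption+)
    qed measurable
  qed
  \<comment> \<open>The telescope starts at level 0, where the dyadic sum is \<open>A\<close>
    itself, and stops at the finite level \<open>N\<close>; no pointwise limit of partition sums is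
    taken.\<close>
  have pointwise: "vnorm m (remainder A I r (r + h)) \<le> vnorm m (?E r (r + h)) + (\<Sum>n<N. \<Sum>k<2 ^ n. D n k r)" for r
  proof -
    have "remainder A I r (r + h) i = - ?E r (r + h) i + (- (\<Sum>n<N. \<Sum>k<2 ^ n.
        delta A (r + real k * (h / 2 ^ n)) (r + real k * (h / 2 ^ n) + h / 2 ^ n / 2) (r + real k * (h / 2 ^ n) + h / 2 ^ n) i))" for i
    proof -
      have "(\<Sum>n<N. \<Sum>k<2 ^ n.
        delta A (r + real k * (h / 2 ^ n)) (r + real k * (h / 2 ^ n) + h / 2 ^ n / 2) (r + real k * (h / 2 ^ n) + h / 2 ^ n) i)
        = (\<Sum>n<N. dyadic_sum n A r (r + h) i - dyadic_sum (Suc n) A r (r + h) i)"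
        by (simp add: dyadic_sum_step)
      also have "\<dots> = A r (r + h) i - dyadic_sum N A r (r + h) i"
        by (subst sum_lessThan_telescope') (simp add: dyadic_sum_eq[of 0])
      finally show ?thesis by (simp add: remainder_def)
    qed
    then have eq: "remainder A I r (r + h) = (\<lambda>i. - ?E r (r + h) i + (- (\<Sum>n<N. \<Sum>k<2 ^ n.
        delta A (r + real k * (h / 2 ^ n)) (r + real k * (h / 2 ^ n) + h / 2 ^ n / 2) (r + real k * (h / 2 ^ n) + h / 2 ^ n) i)))"
      by (rule ext)
    have "vnorm m (remainder A I r (r + h)) \<le> vnorm m (\<lambda>i. - ?E r (r + h) i)
      + vnorm m (\<lambda>i. - (\<Sum>n<N. \<Sum>k<2 ^ n.
        delta A (r + real k * (h / 2 ^ n)) (r + real k * (h / 2 ^ n) + h / 2 ^ n / 2) (r + real k * (h / 2 ^ n) + h / 2 ^ n) i))"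
      unfolding eq by (rule vnorm_add_le)
    also have "\<dots> \<le> vnorm m (?E r (r + h)) + (\<Sum>n<N. \<Sum>k<2 ^ n. D n k r)"
      unfolding vnorm_uminus D_def
      by (intro add_mono order_refl order_trans[OF vnorm_sum_le] sum_mono vnorm_sum_le)
    finally show ?thesis .
  qed
  have "(\<integral>\<^sup>+r. ennreal (vnorm m (remainder A I r (r + h)) powr p) \<partial>W)
    \<le> (\<integral>\<^sup>+r. ennreal ((vnorm m (?E r (r + h)) + (\<Sum>n<N. \<Sum>k<2 ^ n. D n k r)) powr p) \<partial>W)"
    using pointwise p by (intro nn_integral_mono ennreal_leI powr_mono2) auto
  also have "\<dots> \<le> ennreal ((S + (\<Sum>n<N. \<Sum>k<(2::nat) ^ n. b n powr min 1 p)) powr max 1 p)"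
  proof (rule nn_integral_powr_add_le[OF p E_meas _ _ _ _ _ E])
    have D_nonneg: "0 \<le> D n k r" for n k r by (simp add: D_def)
    have b_nonneg: "0 \<le> (\<Sum>k<(2::nat) ^ n. b n powr min 1 p)" for n
      by (intro sum_nonneg) simp
    have D_sum_meas: "(\<lambda>r. \<Sum>k<2 ^ n. D n k r) \<in> borel_measurable W" for n
      by (rule borel_measurable_sum, rule D_meas) simp
    have *: "(\<integral>\<^sup>+r. ennreal ((\<Sum>k<2 ^ n. D n k r) powr p) \<partial>W)
        \<le> ennreal ((\<Sum>k<(2::nat) ^ n. b n powr min 1 p) powr max 1 p)" for n
      by (rule nn_integral_powr_sum_le[OF p _ D_nonneg _ D_int]) (simp_all add: D_meas)
    show "(\<integral>\<^sup>+r. ennreal ((\<Sum>n<N. \<Sum>k<2 ^ n. D n k r) powr p) \<partial>W)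
        \<le> ennreal ((\<Sum>n<N. \<Sum>k<(2::nat) ^ n. b n powr min 1 p) powr max 1 p)"
      by (rule nn_integral_powr_sum_le[OF p D_sum_meas _ b_nonneg *]) (rule sum_nonneg, rule D_nonneg)
    show "(\<lambda>r. \<Sum>n<N. \<Sum>k<2 ^ n. D n k r) \<in> borel_measurable W"
      by (rule borel_measurable_sum) (rule D_sum_meas)
    show "0 \<le> (\<Sum>n<N. \<Sum>k<2 ^ n. D n k r)" for r
      by (intro sum_nonneg D_nonneg)
    show "0 \<le> (\<Sum>n<N. \<Sum>k<(2::nat) ^ n. b n powr min 1 p)"
      by (rule sum_nonneg) (rule b_nonneg)
  qed (use S in auto)
  also have "\<dots> \<le> ennreal ((2 * S) powr max 1 p)"
  proof (intro ennreal_leI powr_mono2)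
    have "(\<Sum>n<N. \<Sum>k<(2::nat) ^ n. b n powr min 1 p) = (\<Sum>n<N. 2 ^ n * b n powr min 1 p)"
      by simp
    then show "S + (\<Sum>n<N. \<Sum>k<(2::nat) ^ n. b n powr min 1 p) \<le> 2 * S"
      using S(2)[of N] by linarith
    show "0 \<le> S + (\<Sum>n<N. \<Sum>k<(2::nat) ^ n. b n powr min 1 p)"
      using S(1) by (intro add_nonneg_nonneg sum_nonneg) auto
  qed simp
  finally show ?thesis by (simp add: W_def)
qed

section \<open>Estimates of the remainder\<close>

lemma AE_lborel_translate:
  assumes "AE x in lborel. P (x::real)"
  shows "AE x in lborel. P (x + c)"
proof -
  obtain N where N: "N \<in> null_sets lborel" "{x \<in> space lborel. \<not> P x} \<subseteq> N"
    using assms by (auto simp: eventually_ae_filter)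
  have [measurable]: "N \<in> sets borel" using N(1) by (auto simp: null_sets_def)
  have "AE x in lborel. c + 1 * x \<notin> N"
    by (rule AE_borel_affine) (use N(1) in \<open>auto intro: AE_not_in\<close>)
  then show ?thesis by eventually_elim (use N(2) in \<open>auto simp: add.commute\<close>)
qed

lemma Lp_norm_translate_le:
  assumes p: "0 < p" and f: "f \<in> borel_measurable (restrict_space lborel {0..b::real})"
    and g: "(\<lambda>x. f (x + c)) \<in> borel_measurable (restrict_space lborel {0..a})"
    and c: "0 \<le> c" "a + c \<le> b"
  shows "Lp_norm (restrict_space lborel {0..a}) p (\<lambda>x. f (x + c)) \<le> Lp_norm (restrict_space lborel {0..b}) p f"
  using p
proof (cases rule: ennreal_exponent_cases)
  case infinite
  let ?L = "Lp_norm (restrict_space lborel {0..b}) top f"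
  have [measurable]: "(\<lambda>x. f x * indicator {0..b} x) \<in> borel_measurable borel"
    using borel_measurable_restrict_space_iff_ennreal[of "{0..b}" lborel f] f by simp
  have "AE x in restrict_space lborel {0..b}. f x \<le> ?L"
    by (rule Lp_norm_infinity_imp_AE) simp
  then have "AE x in lborel. f x * indicator {0..b} x \<le> ?L"
    by (subst (asm) AE_restrict_space_iff) (auto elim!: eventually_mono simp: indicator_def)
  then have "AE x in lborel. f (c + 1 * x) * indicator {0..b} (c + 1 * x) \<le> ?L"
    by (intro AE_borel_affine) auto
  then have "AE x in restrict_space lborel {0..a}. f (x + c) \<le> ?L"
    using c by (subst AE_restrict_space_iff) (auto elim!: eventually_mono simp: indicator_def add.commute)
  then show ?thesis using infinite g by (simp add: Lp_norm_infinity_le_iff)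
next
  case (finite r)
  have "(\<integral>\<^sup>+x. ennpowr (f (x + c)) r \<partial>restrict_space lborel {0..a}) \<le> (\<integral>\<^sup>+x. ennpowr (f x) r \<partial>restrict_space lborel {0..b})"
    by (rule nn_integral_translate_le) (use f c in auto)
  then show ?thesis using finite by (simp add: Lp_norm_def ennpowr_mono)
qed

text \<open>The norm of \<open>\<tau> powr \<epsilon>\<close> in \<open>L^q\<close> of
  \<open>d\<tau>/\<tau>\<close> on \<open>(0,1]\<close>; scaling to \<open>(0,T]\<close> gives the
  factor \<open>T powr \<epsilon>\<close>.\<close>

definition power_const :: "real \<Rightarrow> ennreal \<Rightarrow> real" where
  "power_const \<epsilon> q = (if q = top then 1 else (1 / (\<epsilon> * enn2real q)) powr recip q)"

lemma power_const_nonneg [simp]: "0 \<le> power_const \<epsilon> q"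
  by (simp add: power_const_def)

lemma Lp_norm_log_measure_powr_le:
  assumes "0 < q" "0 < \<epsilon>" "0 < T"
  shows "Lp_norm (log_measure T) q (\<lambda>\<tau>. ennreal (\<tau> powr \<epsilon>)) \<le> ennreal (power_const \<epsilon> q * T powr \<epsilon>)"
proof -
  have m: "(\<lambda>\<tau>. ennreal (\<tau> powr a)) \<in> borel_measurable (log_measure T)" for a
    unfolding measurable_cong_sets[OF sets_log_measure refl]
    by (intro measurable_restrict_space1) measurable
  show ?thesis
    using assms(1)
  proof (cases rule: ennreal_exponent_cases)
    case infinite
    have "AE \<tau> in log_measure T. ennreal (\<tau> powr \<epsilon>) \<le> ennreal (T powr \<epsilon>)"
      unfolding AE_log_measure using assms by (auto intro!: AE_I2 powr_mono2)
    then show ?thesis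
      using infinite m by (simp add: Lp_norm_infinity_le_iff power_const_def)
  next
    case (finite r)
    have "(\<integral>\<^sup>+\<tau>. ennpowr (ennreal (\<tau> powr \<epsilon>)) r \<partial>log_measure T) = (\<integral>\<^sup>+\<tau>. ennreal (\<tau> powr (\<epsilon> * r)) \<partial>log_measure T)"
      by (simp add: ennpowr_ennreal powr_powr)
    also have "\<dots> = (\<integral>\<^sup>+\<tau>. ennreal (\<tau> powr (\<epsilon> * r - 1)) * indicator {0<..T} \<tau> \<partial>lborel)"
      by (subst nn_integral_log_measure[OF m])
        (auto intro!: nn_integral_cong simp: indicator_def ennreal_mult[symmetric] powr_diff)
    also have "\<dots> = ennreal (T powr (\<epsilon> * r) / (\<epsilon> * r))"
      using assms finite by (intro nn_integral_powr_from_0) auto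
    also have "\<dots> = ennpowr (ennreal (power_const \<epsilon> q * T powr \<epsilon>)) r"
      using assms finite by (simp add: ennpowr_ennreal powr_mult powr_powr power_const_def)
    finally show ?thesis
      using finite Lp_norm_finite_le_iff[of r "log_measure T" _ "ennreal (power_const \<epsilon> q * T powr \<epsilon>)"] by simp
  qed
qed

text \<open>\<open>K\<close> will be \<open>c * (\<Phi> + M)\<close> with \<open>c \<ge> 1\<close>.
  Then \<open>M \<le> K\<close> allows the bound on \<open>delta A\<close> to be absorbed into
  \<open>K\<close>, while \<open>M\<close> itself is kept for the modulus of continuity.\<close>

locale remainder_setting =
  fixes T p \<gamma> \<kappa> \<theta> M K :: real and m :: nat
    and A :: "real \<Rightarrow> real \<Rightarrow> nat \<Rightarrow> real" and I :: "real \<Rightarrow> nat \<Rightarrow> real"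
  assumes T_pos: "0 < T" and p_pos: "0 < p" and \<gamma>_pos: "0 < \<gamma>" and \<kappa>: "\<kappa> = \<gamma> - 1 / p" and \<kappa>_pos: "0 < \<kappa>"
    and \<theta>: "0 < \<theta>" "\<theta> < 1 / 2" and M: "0 < M" "M \<le> K"
    and A_meas: "map2_measurable T m A" and I_meas: "path_measurable T m I"
    and delta_bd: "delta_bound T m \<theta> \<kappa> M A"
    and int_le: "\<And>h. 0 < h \<Longrightarrow> h \<le> T / 2 \<Longrightarrow>
      (\<integral>\<^sup>+r. ennreal (vnorm m (remainder A I r (r + h)) powr p) \<partial>restrict_space lborel {0..T - h})
        \<le> ennreal ((K * h powr \<gamma>) powr p)"
begin

abbreviation R :: "real \<Rightarrow> real \<Rightarrow> nat \<Rightarrow> real" where "R \<equiv> remainder A I"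

lemma K_pos: "0 < K" using M by simp

text \<open>The first two bounds become small when a single piece is short, which yields continuity;
  the third has the homogeneity \<open>\<kappa>\<close> that chaining requires.\<close>

lemma delta_le:
  assumes "0 \<le> s" "s \<le> u" "u \<le> t" "t \<le> T"
  shows "vnorm m (delta A s u t) \<le> M * (u - s) powr (\<theta> * \<kappa>) * T powr ((1 - \<theta>) * \<kappa>)"
    and "vnorm m (delta A s u t) \<le> M * (t - u) powr (\<theta> * \<kappa>) * T powr ((1 - \<theta>) * \<kappa>)"
    and "vnorm m (delta A s u t) \<le> M * (t - s) powr \<kappa>"
proof -
  have *: "vnorm m (delta A s u t) \<le> M * x powr (\<theta> * \<kappa>) * y powr ((1 - \<theta>) * \<kappa>)"
    if "min (u - s) (t - u) \<le> x" "max (u - s) (t - u) \<le> y" for x y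
  proof -
    have "vnorm m (delta A s u t) \<le> M * min (u - s) (t - u) powr (\<theta> * \<kappa>) * max (u - s) (t - u) powr ((1 - \<theta>) * \<kappa>)"
      using delta_bd assms by (auto simp: delta_bound_def Delta3_def)
    also have "\<dots> \<le> M * x powr (\<theta> * \<kappa>) * y powr ((1 - \<theta>) * \<kappa>)"
      using that assms M \<theta> \<kappa>_pos by (intro mult_mono powr_mono2) auto
    finally show ?thesis .
  qed
  show "vnorm m (delta A s u t) \<le> M * (u - s) powr (\<theta> * \<kappa>) * T powr ((1 - \<theta>) * \<kappa>)"
    "vnorm m (delta A s u t) \<le> M * (t - u) powr (\<theta> * \<kappa>) * T powr ((1 - \<theta>) * \<kappa>)"
    using assms by (auto intro!: *)
  have "\<theta> * \<kappa> + (1 - \<theta>) * \<kappa> = \<kappa>" by (simp add: algebra_simps)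
  then have "(t - s) powr (\<theta> * \<kappa>) * (t - s) powr ((1 - \<theta>) * \<kappa>) = (t - s) powr \<kappa>"
    by (simp flip: powr_add)
  then show "vnorm m (delta A s u t) \<le> M * (t - s) powr \<kappa>"
    using *[of "t - s" "t - s"] assms by (simp add: mult.assoc)
qed

lemma R_meas: "map2_measurable T m R"
  using A_meas I_meas by (rule remainder_measurable)

lemma R_split: "R s t i = R s u i + (R u t i - delta A s u t i)"
  by (simp add: remainder_def path_incr_def delta_def)

lemma vnorm_split_le: "vnorm m (R s t) \<le> vnorm m (R s u) + vnorm m (R u t) + vnorm m (delta A s u t)"
proof -
  have "R s t = (\<lambda>i. R s u i + (R u t i + - delta A s u t i))"
    by (rule ext) (simp add: R_split[of s t _ u])
  then have "vnorm m (R s t) \<le> vnorm m (R s u) + vnorm m (\<lambda>i. R u t i + - delta A s u t i)"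
    using vnorm_add_le[of m "R s u" "\<lambda>i. R u t i + - delta A s u t i"] by simp
  also have "vnorm m (\<lambda>i. R u t i + - delta A s u t i) \<le> vnorm m (R u t) + vnorm m (\<lambda>i. - delta A s u t i)"
    by (rule vnorm_add_le)
  finally show ?thesis by (simp add: vnorm_uminus)
qed

text \<open>At \<open>(s,s,s)\<close> the pointwise bound vanishes while
  \<open>delta A s s s\<close> is \<open>- A s s\<close>, so \<open>A\<close> is zero on the
  diagonal.\<close>

lemma R_diag:
  assumes "0 \<le> s" "s \<le> T" "i < m"
  shows "R s s i = 0"
proof -
  have "vnorm m (delta A s s s) \<le> 0"
    using delta_le(3)[of s s s] assms by simp
  then have "vnorm m (delta A s s s) = 0" using vnorm_nonneg[of m "delta A s s s"] by linarith
  then show ?thesis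
    using assms by (auto simp: vnorm_eq_0_iff delta_def remainder_def path_incr_def)
qed

text \<open>The maximum with 1 lets \<open>C * K\<close> dominate the integral bound with
  \<open>K\<close> too, so interpolation works with a single constant.\<close>

definition C :: real where "C = max 1 (chaining.chain_const p \<kappa>)"

lemma C_ge_1: "1 \<le> C"
  by (simp add: C_def)

lemma good_set:
  "\<exists>G. (AE s in lborel. s \<in> G) \<and>
    (\<forall>s\<in>G. \<forall>t\<in>G. 0 \<le> s \<longrightarrow> s \<le> t \<longrightarrow> t \<le> T \<longrightarrow> vnorm m (R s t) \<le> C * K * (t - s) powr \<kappa>)"
proof -
  define \<rho> where "\<rho> s t = (if (s, t) \<in> Delta2 T then vnorm m (R s t) else 0)" for s t
  have Delta2_closed: "closed (Delta2 T)"
  proof -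
    have "Delta2 T = {x. 0 \<le> fst x} \<inter> {x. fst x \<le> snd x} \<inter> {x. snd x \<le> T}"
      by (auto simp: Delta2_def)
    also have "closed \<dots>"
      by (intro closed_Int closed_Collect_le continuous_intros)
    finally show ?thesis .
  qed
  interpret chaining T p \<gamma> K \<kappa> \<rho>
  proof
    have "(\<lambda>x. vnorm m (R (fst x) (snd x))) \<in> borel_measurable (restrict_space borel (Delta2 T))"
      using R_meas unfolding map2_measurable_def case_prod_beta by (intro vnorm_measurable) auto
    then have "(\<lambda>x. indicator (Delta2 T) x *\<^sub>R vnorm m (R (fst x) (snd x))) \<in> borel_measurable borel"
      using Delta2_closed by (subst (asm) borel_measurable_restrict_space_iff) auto
    also have "(\<lambda>x. indicator (Delta2 T) x *\<^sub>R vnorm m (R (fst x) (snd x))) = case_prod \<rho>"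
      by (auto simp: \<rho>_def indicator_def fun_eq_iff)
    finally show "case_prod \<rho> \<in> borel_measurable (borel \<Otimes>\<^sub>M borel)"
      by (simp add: borel_prod)
    show "(\<integral>\<^sup>+r. ennreal (\<rho> r (r + h) powr p) \<partial>lborel) \<le> ennreal ((K * h powr \<gamma>) powr p)"
      if h: "0 < h" "h \<le> T / 2" for h
    proof -
      have "(\<integral>\<^sup>+r. ennreal (\<rho> r (r + h) powr p) \<partial>lborel)
        = (\<integral>\<^sup>+r. ennreal (vnorm m (R r (r + h)) powr p) * indicator {0..T - h} r \<partial>lborel)"
        using h by (intro nn_integral_cong) (auto simp: \<rho>_def Delta2_def indicator_def)
      also have "\<dots> = (\<integral>\<^sup>+r. ennreal (vnorm m (R r (r + h)) powr p) \<partial>restrict_space lborel {0..T - h})"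
        by (simp add: nn_integral_restrict_space)
      also have "\<dots> \<le> ennreal ((K * h powr \<gamma>) powr p)" by (rule int_le[OF h])
      finally show ?thesis .
    qed
    show "\<rho> s t \<le> \<rho> s u + \<rho> u t + K * (t - s) powr \<kappa>"
      if st: "0 \<le> s" "s \<le> u" "u \<le> t" "t \<le> T" for s u t
    proof -
      have "vnorm m (delta A s u t) \<le> K * (t - s) powr \<kappa>"
        using delta_le(3)[OF st] M by (auto elim!: order_trans intro: mult_right_mono)
      then show ?thesis
        using vnorm_split_le[of s t u] st by (simp add: \<rho>_def Delta2_def)
    qed
  qed (use T_pos p_pos \<gamma>_pos K_pos \<kappa> \<kappa>_pos in \<open>auto simp: \<rho>_def Delta2_def split: if_splits\<close>)
  obtain G where G: "AE s in lborel. s \<in> G"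
    "\<And>s t. s \<in> G \<Longrightarrow> t \<in> G \<Longrightarrow> 0 \<le> s \<and> s < t \<and> t \<le> T \<Longrightarrow> \<rho> s t \<le> chain_const * K * (t - s) powr \<kappa>"
    using AE_le by blast
  have "vnorm m (R s t) \<le> C * K * (t - s) powr \<kappa>"
    if "s \<in> G" "t \<in> G" "0 \<le> s" "s \<le> t" "t \<le> T" for s t
  proof (cases "s = t")
    case True
    then have "vnorm m (R s t) = 0" using R_diag that by (auto simp: vnorm_eq_0_iff)
    then show ?thesis using C_ge_1 K_pos by simp
  next
    case False
    then have "\<rho> s t \<le> chain_const * K * (t - s) powr \<kappa>"
      using G(2) that by auto
    also have "\<dots> \<le> C * K * (t - s) powr \<kappa>"
      using K_pos by (intro mult_right_mono) (auto simp: C_def)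
    finally show ?thesis using that by (simp add: \<rho>_def Delta2_def)
  qed
  then show ?thesis using G(1) by blast
qed

text \<open>The exceptional set of \<open>good_set\<close> concerns single end points, not pairs.
  Hence for every fixed \<open>h\<close> almost every \<open>r\<close> has both \<open>r\<close> and
  \<open>r + h\<close> in \<open>G\<close>, by translation invariance.\<close>

lemma AE_line:
  assumes h: "0 \<le> h"
  shows "AE r in restrict_space lborel {0..T - h}. vnorm m (R r (r + h)) \<le> C * K * h powr \<kappa>"
proof -
  obtain G where G: "AE s in lborel. s \<in> G"
    "\<And>s t. s \<in> G \<Longrightarrow> t \<in> G \<Longrightarrow> 0 \<le> s \<Longrightarrow> s \<le> t \<Longrightarrow> t \<le> T \<Longrightarrow> vnorm m (R s t) \<le> C * K * (t - s) powr \<kappa>"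
    using good_set by metis
  from AE_lborel_translate[OF G(1)] have "AE s in lborel. s + h \<in> G" by simp
  with G(1) have "AE r in lborel. r \<in> {0..T - h} \<longrightarrow> vnorm m (R r (r + h)) \<le> C * K * h powr \<kappa>"
  proof eventually_elim
    case (elim r)
    then show ?case using G(2)[of r "r + h"] h by auto
  qed
  then show ?thesis by (subst AE_restrict_space_iff) auto
qed

end

section \<open>Norm estimates of the remainder and of the integral\<close>

lemma quasi_const_ge_1: "1 \<le> quasi_const p"
proof -
  have "(1::real) \<le> 2 powr recip p" by (rule ge_one_powr_ge_zero) (auto simp: recip_def)
  then show ?thesis by (simp add: quasi_const_def)
qed

lemma recip_nonneg [simp]: "0 \<le> recip q"
  by (simp add: recip_def)

context remainder_setting
begin

lemma line_measurable:
  assumes "map2_measurable T m B" "0 \<le> h"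
  shows "(\<lambda>r. ennreal (vnorm m (B r (r + h)))) \<in> borel_measurable (restrict_space lborel {0..T - h})"
proof -
  have [measurable]: "(\<lambda>r. vnorm m (B r (r + h))) \<in> borel_measurable (restrict_space lborel {0..T - h})"
    using assms by (intro vnorm_curve_measurable[where T=T]) auto
  show ?thesis by measurable
qed

lemma CC_norm_le: "CC_norm T m \<kappa> R \<le> ennreal (C * K)"
proof -
  have CK: "0 \<le> C * K" using C_ge_1 K_pos by simp
  have "Omega T m \<infinity> R \<tau> / ennreal (\<tau> powr \<kappa>) \<le> ennreal (C * K)" if \<tau>: "\<tau> \<in> {0<..T}" for \<tau>
  proof -
    have "Omega T m \<infinity> R \<tau> \<le> ennreal (C * K * \<tau> powr \<kappa>)"
      unfolding Omega_def
    proof (rule SUP_least)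
      fix h assume h: "h \<in> {0..\<tau>}"
      then have "C * K * h powr \<kappa> \<le> C * K * \<tau> powr \<kappa>"
        using CK \<kappa>_pos by (intro mult_left_mono powr_mono2) auto
      then have "AE r in restrict_space lborel {0..T - h}. ennreal (vnorm m (R r (r + h))) \<le> ennreal (C * K * \<tau> powr \<kappa>)"
        using AE_line[of h] h by (auto elim!: eventually_mono intro!: ennreal_leI)
      then show "Lp_norm (restrict_space lborel {0..T - h}) \<infinity> (\<lambda>r. ennreal (vnorm m (R r (r + h))))
          \<le> ennreal (C * K * \<tau> powr \<kappa>)"
        using line_measurable[OF R_meas, of h] h by (simp add: Lp_norm_infinity_le_iff)
    qed
    then have "Omega T m \<infinity> R \<tau> * ennreal (1 / \<tau> powr \<kappa>) \<le> ennreal (C * K * \<tau> powr \<kappa>) * ennreal (1 / \<tau> powr \<kappa>)"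
      by (rule mult_right_mono) simp
    also have "\<dots> = ennreal (C * K)"
      using \<tau> CK by (simp add: ennreal_mult[symmetric])
    finally show ?thesis using \<tau> by (simp add: divide_ennreal_eq_mult)
  qed
  then have "AE \<tau> in log_measure T. Omega T m \<infinity> R \<tau> / ennreal (\<tau> powr \<kappa>) \<le> ennreal (C * K)"
    by (simp add: AE_log_measure)
  then show ?thesis
    unfolding CC_norm_def BB_norm_def
    using mono_on_quotient_measurable[where T=T and \<phi>="Omega T m \<infinity> R" and \<gamma>=\<kappa>, OF Omega_mono]
    by (simp add: Lp_norm_infinity_le_iff)
qed

text \<open>The ratio of the \<open>L^p\<close> bound to the \<open>L^\<infinity>\<close> bound is
  \<open>h powr (1 / p)\<close>; its power \<open>p * recip p1\<close> contributes
  \<open>h powr recip p1\<close>.\<close>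

lemma Lp_norm_R_le:
  assumes p1: "ennreal p < p1" and h: "0 < h" "h \<le> T / 2"
  shows "Lp_norm (restrict_space lborel {0..T - h}) p1 (\<lambda>r. ennreal (vnorm m (R r (r + h))))
    \<le> ennreal (C * K * h powr (\<kappa> + recip p1))"
proof -
  have CK: "0 < C * K" using C_ge_1 K_pos by simp
  have "K * 1 \<le> K * C" using C_ge_1 K_pos by (intro mult_left_mono) auto
  then have KC: "K \<le> C * K" by (simp add: mult.commute)
  have "Lp_norm (restrict_space lborel {0..T - h}) p1 (\<lambda>r. ennreal (vnorm m (R r (r + h))))
    \<le> ennreal (C * K * h powr \<kappa> * (C * K * h powr \<gamma> / (C * K * h powr \<kappa>)) powr (enn2real (ennreal p) * recip p1))"
  proof (rule Lp_norm_le_of_smaller_exponent)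
    show "AE r in restrict_space lborel {0..T - h}. ennreal (vnorm m (R r (r + h))) \<le> ennreal (C * K * h powr \<kappa>)"
      using AE_line[of h] h by (auto elim!: eventually_mono intro!: ennreal_leI)
    have "ennreal ((K * h powr \<gamma>) powr p) \<le> ennreal ((C * K * h powr \<gamma>) powr p)"
      using KC K_pos p_pos by (intro ennreal_leI powr_mono2 mult_right_mono) auto
    with int_le[OF h] show "Lp_norm (restrict_space lborel {0..T - h}) (ennreal p) (\<lambda>r. ennreal (vnorm m (R r (r + h))))
        \<le> ennreal (C * K * h powr \<gamma>)"
      using p_pos CK by (subst Lp_norm_vnorm_le_iff) (auto elim: order_trans)
  qed (use p1 p_pos CK h line_measurable[OF R_meas, of h] in auto)
  also have "C * K * h powr \<kappa> * (C * K * h powr \<gamma> / (C * K * h powr \<kappa>)) powr (enn2real (ennreal p) * recip p1)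
    = C * K * h powr (\<kappa> + recip p1)"
  proof -
    have "C * K * h powr \<gamma> / (C * K * h powr \<kappa>) = h powr (1 / p)"
    proof -
      have "C * K * h powr \<gamma> / (C * K * h powr \<kappa>) = h powr \<gamma> / h powr \<kappa>"
        using CK by (metis mult_divide_mult_cancel_left order_less_irrefl)
      also have "\<dots> = h powr (1 / p)" by (simp add: \<kappa> flip: powr_diff)
      finally show ?thesis .
    qed
    then show ?thesis using p_pos h by (simp add: powr_powr powr_add)
  qed
  finally show ?thesis .
qed

lemma Lp_norm_path_incr_le:
  assumes p1: "ennreal p < p1" and h: "0 \<le> h" "h \<le> T / 2"
  shows "Lp_norm (restrict_space lborel {0..T - h}) p1 (\<lambda>r. ennreal (vnorm m (path_incr I r (r + h))))
    \<le> ennreal (quasi_const p1) * (Omega T m p1 A h + ennreal (C * K * h powr (\<kappa> + recip p1)))"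
    (is "?lhs \<le> _")
proof -
  let ?N = "restrict_space lborel {0..T - h}"
  have p1_pos: "0 < p1" using p1 by (metis not_gr_zero not_less_zero)
  have "?lhs \<le> ennreal (quasi_const p1) * (Lp_norm ?N p1 (\<lambda>r. ennreal (vnorm m (A r (r + h))))
      + Lp_norm ?N p1 (\<lambda>r. ennreal (vnorm m (R r (r + h)))))"
  proof (rule Lp_norm_add_le[OF p1_pos])
    have "vnorm m (path_incr I r (r + h)) \<le> vnorm m (A r (r + h)) + vnorm m (R r (r + h))" for r
      using vnorm_add_le[of m "A r (r + h)" "R r (r + h)"] by (simp add: remainder_def)
    then show "AE r in ?N. ennreal (vnorm m (path_incr I r (r + h)))
        \<le> ennreal (vnorm m (A r (r + h))) + ennreal (vnorm m (R r (r + h)))"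
      by (auto simp flip: ennreal_plus intro!: AE_I2 ennreal_leI)
  qed (use h line_measurable A_meas R_meas path_incr_measurable[OF I_meas] in auto)
  also have "\<dots> \<le> ennreal (quasi_const p1) * (Omega T m p1 A h + ennreal (C * K * h powr (\<kappa> + recip p1)))"
  proof (intro mult_left_mono add_mono)
    show "Lp_norm ?N p1 (\<lambda>r. ennreal (vnorm m (A r (r + h)))) \<le> Omega T m p1 A h"
      using h by (intro Lp_norm_le_Omega) auto
    show "Lp_norm ?N p1 (\<lambda>r. ennreal (vnorm m (R r (r + h)))) \<le> ennreal (C * K * h powr (\<kappa> + recip p1))"
    \<comment> \<open>The supremum in \<open>Omega\<close> includes \<open>h = 0\<close>, which the
      integral bound does not cover; there the remainder vanishes by \<open>R_diag\<close>.\<close>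
    proof (cases "h = 0")
      case False
      then show ?thesis using Lp_norm_R_le[OF p1] h by simp
    next
      case True
      have "Lp_norm ?N p1 (\<lambda>r. ennreal (vnorm m (R r (r + h)))) \<le> Lp_norm ?N p1 (\<lambda>r. 0)"
      proof (rule Lp_norm_mono_AE[OF p1_pos line_measurable[OF R_meas h(1)]])
        have "ennreal (vnorm m (R r (r + h))) \<le> 0" if "r \<in> {0..T}" for r
        proof -
          have "vnorm m (R r r) = 0" using R_diag that by (auto simp: vnorm_eq_0_iff)
          then show ?thesis using True by simp
        qed
        then show "AE r in ?N. ennreal (vnorm m (R r (r + h))) \<le> 0"
          using True by (intro AE_I2) (auto simp: space_restrict_space)
      qed
      also have "Lp_norm ?N p1 (\<lambda>r. 0) \<le> 0"
        using p1_pos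
      proof (cases rule: ennreal_exponent_cases)
        case infinite
        then show ?thesis by (simp only:) (subst Lp_norm_infinity_le_iff, auto)
      next
        case (finite r)
        then show ?thesis unfolding finite(2) by (subst Lp_norm_finite_le_iff) auto
      qed
      finally show ?thesis by simp
    qed
  qed simp
  finally show ?thesis .
qed

text \<open>Neither norm controls lines with \<open>h > T/2\<close>, but an increment of length \<open>h\<close> is the sum of two
  increments of length \<open>h/2\<close>.\<close>

lemma Omega_path_incr_le:
  assumes p1: "ennreal p < p1" and \<tau>: "0 < \<tau>" "\<tau> \<le> T"
  shows "Omega T m p1 (path_incr I) \<tau> \<le> ennreal (2 * (quasi_const p1)\<^sup>2) *
    (Omega T m p1 A (min \<tau> (T / 2)) + ennreal (C * K * \<tau> powr (\<kappa> + recip p1)))"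
  unfolding Omega_def[of T m p1 "path_incr I"]
proof (rule SUP_least)
  fix h assume "h \<in> {0..\<tau>}"
  then have h: "0 \<le> h" "h \<le> \<tau>" by auto
  have p1_pos: "0 < p1" using p1 by (metis not_gr_zero not_less_zero)
  have CK: "0 \<le> C * K" using C_ge_1 K_pos by simp
  let ?c = "quasi_const p1"
  let ?B = "Omega T m p1 A (min \<tau> (T / 2)) + ennreal (C * K * \<tau> powr (\<kappa> + recip p1))"
  let ?L = "\<lambda>h. Lp_norm (restrict_space lborel {0..T - h}) p1 (\<lambda>r. ennreal (vnorm m (path_incr I r (r + h))))"
  have small: "?L x \<le> ennreal ?c * ?B" if x: "0 \<le> x" "x \<le> T / 2" "x \<le> \<tau>" for x
  proof -
    have 1: "Omega T m p1 A x \<le> Omega T m p1 A (min \<tau> (T / 2))"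
      using Omega_mono[of UNIV T m p1 A] x by (auto simp: mono_on_def)
    have 2: "C * K * x powr (\<kappa> + recip p1) \<le> C * K * \<tau> powr (\<kappa> + recip p1)"
      using CK \<kappa>_pos x by (intro mult_left_mono powr_mono2 add_nonneg_nonneg) auto
    have "ennreal ?c * (Omega T m p1 A x + ennreal (C * K * x powr (\<kappa> + recip p1))) \<le> ennreal ?c * ?B"
      by (rule mult_left_mono[OF add_mono[OF 1 ennreal_leI[OF 2]]]) simp
    with Lp_norm_path_incr_le[OF p1 x(1,2)] show ?thesis by (rule order_trans)
  qed
  have c1: "1 \<le> ?c" by (rule quasi_const_ge_1)
  show "?L h \<le> ennreal (2 * ?c\<^sup>2) * ?B"
  proof (cases "h \<le> T / 2")
    case True
    have "?L h \<le> ennreal ?c * ?B" using small h True by simp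
    also have "\<dots> \<le> ennreal (2 * ?c\<^sup>2) * ?B"
    proof (intro mult_right_mono ennreal_leI)
      have "?c * 1 \<le> ?c * (2 * ?c)" using c1 by (intro mult_left_mono) auto
      then show "?c \<le> 2 * ?c\<^sup>2" by (simp add: power2_eq_square algebra_simps)
    qed simp
    finally show ?thesis .
  next
    case False
    let ?N = "restrict_space lborel {0..T - h}"
    let ?f = "\<lambda>r. ennreal (vnorm m (path_incr I r (r + h / 2)))"
    have f: "?f \<in> borel_measurable (restrict_space lborel {0..T - h / 2})"
      using h by (intro line_measurable path_incr_measurable I_meas) auto
    have f0: "?f \<in> borel_measurable ?N"
    proof -
      have [measurable]: "(\<lambda>r. vnorm m (path_incr I r (r + h / 2))) \<in> borel_measurable ?N"
        using h by (intro vnorm_curve_measurable[where T=T] path_incr_measurable[OF I_meas]) auto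
      show ?thesis by measurable
    qed
    have "(\<lambda>r. vnorm m (path_incr I (r + h / 2) (r + h))) \<in> borel_measurable ?N"
      using h by (intro vnorm_curve_measurable[where T=T] path_incr_measurable[OF I_meas]) auto
    then have f1: "(\<lambda>r. ?f (r + h / 2)) \<in> borel_measurable ?N"
      unfolding add.assoc field_sum_of_halves by measurable
    have "?L h \<le> ennreal ?c * (Lp_norm ?N p1 ?f + Lp_norm ?N p1 (\<lambda>r. ?f (r + h / 2)))"
    proof (rule Lp_norm_add_le[OF p1_pos _ f0 f1])
      show "(\<lambda>r. ennreal (vnorm m (path_incr I r (r + h)))) \<in> borel_measurable ?N"
        using h by (intro line_measurable path_incr_measurable I_meas) auto
      have "vnorm m (path_incr I r (r + h)) \<le> vnorm m (path_incr I r (r + h / 2)) + vnorm m (path_incr I (r + h / 2) (r + h / 2 + h / 2))" for r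
        using vnorm_add_le[of m "path_incr I r (r + h / 2)" "path_incr I (r + h / 2) (r + h / 2 + h / 2)"]
        by (simp add: path_incr_def add.assoc)
      then show "AE r in ?N. ennreal (vnorm m (path_incr I r (r + h))) \<le> ?f r + ?f (r + h / 2)"
        by (auto simp flip: ennreal_plus intro!: AE_I2 ennreal_leI)
    qed
    also have "\<dots> \<le> ennreal ?c * (?L (h / 2) + ?L (h / 2))"
    proof (intro mult_left_mono add_mono)
      show "Lp_norm ?N p1 (\<lambda>r. ?f (r + h / 2)) \<le> ?L (h / 2)"
        using h by (intro Lp_norm_translate_le p1_pos f f1) auto
      show "Lp_norm ?N p1 ?f \<le> ?L (h / 2)"
        using h f0 Lp_norm_translate_le[OF p1_pos f, of 0 "T - h"] by simp
    qed simp
    also have "\<dots> \<le> ennreal ?c * (ennreal ?c * ?B + ennreal ?c * ?B)"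
      using h \<tau> by (intro mult_left_mono add_mono small) auto
    also have "\<dots> = ennreal (2 * ?c\<^sup>2) * ?B"
      using c1 by (simp add: power2_eq_square ennreal_mult mult_2[symmetric] ac_simps)
    finally show ?thesis .
  qed
qed

definition besov_const :: "ennreal \<Rightarrow> ennreal \<Rightarrow> ennreal \<Rightarrow> real \<Rightarrow> real \<Rightarrow> real" where
  "besov_const p1 q1 q \<alpha> \<epsilon> =
     quasi_const q * (2 * (quasi_const p1)\<^sup>2) * (2 powr recip q1 * 2 powr \<alpha> + C * (1 + power_const \<epsilon> q))"

text \<open>The increment of \<open>I\<close> splits into \<open>A\<close> and the remainder. The
  part of \<open>A\<close> passes from \<open>q1\<close> to \<open>q\<close> because it is also
  bounded pointwise; the part of the remainder is the power \<open>\<tau> powr \<epsilon>\<close>,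
  integrable for \<open>d\<tau>/\<tau>\<close> at 0 because \<open>\<epsilon> > 0\<close>.\<close>

lemma Besov_seminorm_le:
  assumes p1: "ennreal p < p1" and q: "0 < q1" "q1 \<le> q" and \<alpha>: "0 < \<alpha>"
    and \<epsilon>: "\<epsilon> = \<kappa> + recip p1 - \<alpha>" "0 < \<epsilon>"
    and fin: "BB_norm T m \<alpha> p1 q1 A < \<infinity>"
  shows "Besov_seminorm T m \<alpha> p1 q I
    \<le> ennreal (besov_const p1 q1 q \<alpha> \<epsilon>) * (BB_norm T m \<alpha> p1 q1 A + ennreal (T powr \<epsilon> * K))"
proof -
  have q_pos: "0 < q" using q by auto
  have CK: "0 < C * K" using C_ge_1 K_pos by simp
  define a where "a \<tau> = Omega T m p1 A (min \<tau> (T / 2))" for \<tau>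
  define b0 where "b0 = enn2real (BB_norm T m \<alpha> p1 q1 A)"
  have b0: "BB_norm T m \<alpha> p1 q1 A = ennreal b0" "0 \<le> b0"
    using fin by (auto simp: b0_def less_top)
  define c2 where "c2 = 2 powr recip q1 * 2 powr \<alpha>"
  have c2: "1 \<le> c2"
  proof -
    have "(1::real) \<le> 2 powr recip q1" "(1::real) \<le> 2 powr \<alpha>"
      using \<alpha> by (auto intro!: ge_one_powr_ge_zero)
    then have "1 * 1 \<le> c2" unfolding c2_def by (intro mult_mono) auto
    then show ?thesis by simp
  qed
  \<comment> \<open>A common bound for \<open>qa\<close> pointwise and in norm, so that the
    interpolation factor below is \<open>b / b = 1\<close>. The second summand keeps
    \<open>b\<close> positive when the norm of \<open>A\<close> is 0.\<close>
  define b where "b = c2 * b0 + C * K * T powr \<epsilon>"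
  have b: "0 < b" "b0 \<le> b"
  proof -
    have "0 < C * K * T powr \<epsilon>" using CK T_pos by simp
    moreover have "1 * b0 \<le> c2 * b0" using c2 b0 by (intro mult_right_mono) auto
    ultimately show "0 < b" "b0 \<le> b" using b0(2) by (auto simp: b_def)
  qed
  have a_mono: "mono_on {0<..T} a"
  proof (rule mono_onI)
    fix r s :: real assume "r \<le> s"
    then have "min r (T / 2) \<le> min s (T / 2)" by auto
    then show "a r \<le> a s"
      using Omega_mono[of UNIV T m p1 A] by (simp add: mono_on_def a_def)
  qed
  define qa where "qa \<tau> = a \<tau> / ennreal (\<tau> powr \<alpha>)" for \<tau>
  have [measurable]: "qa \<in> borel_measurable (log_measure T)"
    unfolding qa_def by (rule mono_on_quotient_measurable[OF a_mono])
  have id_meas: "(\<lambda>\<tau>. ennreal (\<tau> powr x)) \<in> borel_measurable (log_measure T)" for x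
    unfolding measurable_cong_sets[OF sets_log_measure refl]
    by (intro measurable_restrict_space1) measurable
  note [measurable] = id_meas
  have qa_le: "qa \<tau> \<le> ennreal b" if \<tau>: "\<tau> \<in> {0<..T}" for \<tau>
  proof -
    have "a \<tau> \<le> ennreal (2 powr recip q1 * (2 * min \<tau> (T / 2)) powr \<alpha>) * ennreal b0"
      unfolding a_def b0(1)[symmetric] using \<tau> q \<alpha> by (intro Omega_le_BB_norm) auto
    also have "\<dots> = ennreal (2 powr recip q1 * (2 * min \<tau> (T / 2)) powr \<alpha> * b0)"
      using b0 by (simp add: ennreal_mult)
    also have "\<dots> \<le> ennreal (c2 * \<tau> powr \<alpha> * b0)"
    proof (intro ennreal_leI mult_right_mono b0)
      have "(2 * min \<tau> (T / 2)) powr \<alpha> \<le> (2 * \<tau>) powr \<alpha>"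
        using \<tau> \<alpha> T_pos by (intro powr_mono2) auto
      then show "2 powr recip q1 * (2 * min \<tau> (T / 2)) powr \<alpha> \<le> c2 * \<tau> powr \<alpha>"
        using \<tau> by (simp add: c2_def powr_mult)
    qed
    finally have "qa \<tau> \<le> ennreal (c2 * \<tau> powr \<alpha> * b0) * ennreal (1 / \<tau> powr \<alpha>)"
      using \<tau> by (auto simp: qa_def divide_ennreal_eq_mult intro!: mult_right_mono)
    also have "\<dots> = ennreal (c2 * b0)"
      using \<tau> b0 c2 by (simp add: ennreal_mult[symmetric])
    also have "\<dots> \<le> ennreal b"
      using CK T_pos by (intro ennreal_leI) (simp add: b_def)
    finally show ?thesis .
  qed
  have "Lp_norm (log_measure T) q1 qa \<le> Lp_norm (log_measure T) q1 (\<lambda>\<tau>. Omega T m p1 A \<tau> / ennreal (\<tau> powr \<alpha>))"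
  proof (rule Lp_norm_mono_AE[OF q(1)])
    have "a \<tau> \<le> Omega T m p1 A \<tau>" for \<tau>
      unfolding a_def using Omega_mono[of UNIV T m p1 A] by (auto simp: mono_on_def)
    then show "AE \<tau> in log_measure T. qa \<tau> \<le> Omega T m p1 A \<tau> / ennreal (\<tau> powr \<alpha>)"
      by (auto simp: qa_def intro!: AE_I2 divide_right_mono_ennreal)
  qed measurable
  also have "\<dots> \<le> ennreal b"
    using b0 b by (auto simp: BB_norm_def[symmetric] intro!: ennreal_leI)
  finally have "Lp_norm (log_measure T) q qa \<le> ennreal (b * (b / b) powr (enn2real q1 * recip q))"
    using q b qa_le
    by (intro Lp_norm_le_of_smaller_exponent) (auto intro!: AE_I2)
  then have A_part: "Lp_norm (log_measure T) q qa \<le> ennreal b" using b by simp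
  have R_part: "Lp_norm (log_measure T) q (\<lambda>\<tau>. ennreal (C * K) * ennreal (\<tau> powr \<epsilon>))
      \<le> ennreal (C * K) * ennreal (power_const \<epsilon> q * T powr \<epsilon>)"
    using Lp_norm_cmult_le[OF q_pos id_meas CK, of \<epsilon>] Lp_norm_log_measure_powr_le[OF q_pos \<epsilon>(2) T_pos]
    by (elim order_trans) (auto intro!: mult_left_mono)
  let ?c = "2 * (quasi_const p1)\<^sup>2"
  have c: "0 < ?c" by (intro mult_pos_pos zero_less_power quasi_const_pos) simp
  have F_le: "Omega T m p1 (path_incr I) \<tau> / ennreal (\<tau> powr \<alpha>) \<le> ennreal ?c * (qa \<tau> + ennreal (C * K) * ennreal (\<tau> powr \<epsilon>))"
    if \<tau>: "\<tau> \<in> {0<..T}" for \<tau>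
  proof -
    have "Omega T m p1 (path_incr I) \<tau> / ennreal (\<tau> powr \<alpha>)
      \<le> ennreal ?c * (a \<tau> + ennreal (C * K * \<tau> powr (\<kappa> + recip p1))) * ennreal (1 / \<tau> powr \<alpha>)"
      using Omega_path_incr_le[OF p1, of \<tau>] \<tau>
      by (auto simp: a_def divide_ennreal_eq_mult intro!: mult_right_mono)
    also have "\<dots> = ennreal ?c * (qa \<tau> + ennreal (C * K) * ennreal (\<tau> powr \<epsilon>))"
    proof -
      have "ennreal (C * K * \<tau> powr (\<kappa> + recip p1)) * ennreal (1 / \<tau> powr \<alpha>) = ennreal (C * K) * ennreal (\<tau> powr \<epsilon>)"
        using CK by (simp add: ennreal_mult[symmetric] \<epsilon>(1) powr_diff)
      moreover have "qa \<tau> = a \<tau> * ennreal (1 / \<tau> powr \<alpha>)"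
        using \<tau> by (simp add: qa_def divide_ennreal_eq_mult)
      ultimately show ?thesis by (simp only: mult.assoc distrib_right)
    qed
    finally show ?thesis .
  qed
  have "Besov_seminorm T m \<alpha> p1 q I \<le> Lp_norm (log_measure T) q (\<lambda>\<tau>. ennreal ?c * (qa \<tau> + ennreal (C * K) * ennreal (\<tau> powr \<epsilon>)))"
    unfolding Besov_seminorm_def BB_norm_def
    using F_le by (intro Lp_norm_mono_AE q_pos mono_on_quotient_measurable Omega_mono) (auto intro!: AE_I2)
  also have "\<dots> \<le> ennreal ?c * Lp_norm (log_measure T) q (\<lambda>\<tau>. qa \<tau> + ennreal (C * K) * ennreal (\<tau> powr \<epsilon>))"
    by (intro Lp_norm_cmult_le q_pos c) measurable
  also have "\<dots> \<le> ennreal ?c * (ennreal (quasi_const q) * (Lp_norm (log_measure T) q qa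
      + Lp_norm (log_measure T) q (\<lambda>\<tau>. ennreal (C * K) * ennreal (\<tau> powr \<epsilon>))))"
    by (intro mult_left_mono Lp_norm_add_le q_pos) (auto intro!: AE_I2)
  also have "\<dots> \<le> ennreal ?c * (ennreal (quasi_const q) * (ennreal b + ennreal (C * K) * ennreal (power_const \<epsilon> q * T powr \<epsilon>)))"
    by (intro mult_left_mono add_mono A_part R_part) auto
  also have "\<dots> = ennreal (quasi_const q * ?c * (b + C * K * (power_const \<epsilon> q * T powr \<epsilon>)))"
  proof -
    let ?y = "power_const \<epsilon> q * T powr \<epsilon>"
    have "0 \<le> C * K * ?y" using mult_nonneg_nonneg[OF less_imp_le[OF CK], of ?y] by simp
    moreover have "ennreal (C * K) * ennreal ?y = ennreal (C * K * ?y)"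
      using CK by (subst ennreal_mult'[of "C * K"]) auto
    ultimately have "ennreal b + ennreal (C * K) * ennreal ?y = ennreal (b + C * K * ?y)"
      using b(1) by (simp only: ennreal_plus less_imp_le)
    moreover have "ennreal (quasi_const q * ?c * (b + C * K * ?y)) = ennreal (quasi_const q) * ennreal ?c * ennreal (b + C * K * ?y)"
      using ennreal_mult'[of "quasi_const q * ?c" "b + C * K * ?y"] ennreal_mult'[of "quasi_const q" ?c]
        mult_pos_pos[OF quasi_const_pos[of q] c] quasi_const_pos[of q]
      by (simp only: less_imp_le)
    ultimately show ?thesis by (simp only: mult.left_commute mult.assoc)
  qed
  also have "\<dots> \<le> ennreal (besov_const p1 q1 q \<alpha> \<epsilon> * (b0 + T powr \<epsilon> * K))"
  proof -
    let ?w = "1 + power_const \<epsilon> q"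
    have "b + C * K * (power_const \<epsilon> q * T powr \<epsilon>) = c2 * b0 + C * ?w * (T powr \<epsilon> * K)"
      by (simp add: b_def algebra_simps)
    also have "\<dots> \<le> (c2 + C * ?w) * b0 + (c2 + C * ?w) * (T powr \<epsilon> * K)"
      using b0 c2 C_ge_1 K_pos by (intro add_mono mult_right_mono) auto
    also have "\<dots> = (c2 + C * ?w) * (b0 + T powr \<epsilon> * K)" by (simp add: algebra_simps)
    finally have "quasi_const q * ?c * (b + C * K * (power_const \<epsilon> q * T powr \<epsilon>))
       \<le> quasi_const q * ?c * ((c2 + C * ?w) * (b0 + T powr \<epsilon> * K))"
      by (rule mult_left_mono) (rule less_imp_le[OF mult_pos_pos[OF quasi_const_pos c]])
    then show ?thesis
      by (intro ennreal_leI) (simp add: besov_const_def c2_def mult.assoc)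
  qed
  also have "\<dots> = ennreal (besov_const p1 q1 q \<alpha> \<epsilon>) * (BB_norm T m \<alpha> p1 q1 A + ennreal (T powr \<epsilon> * K))"
  proof -
    have "0 \<le> besov_const p1 q1 q \<alpha> \<epsilon>"
      unfolding besov_const_def using less_imp_le[OF quasi_const_pos] C_ge_1 by (auto intro!: mult_nonneg_nonneg add_nonneg_nonneg)
    then show ?thesis
      using b0 K_pos by (simp add: ennreal_mult)
  qed
  finally show ?thesis .
qed

end

section \<open>Continuous version of the remainder\<close>

lemma continuous_on_vnorm:
  assumes "\<And>i. i < m \<Longrightarrow> continuous_on S (\<lambda>x. f x i)"
  shows "continuous_on S (\<lambda>x. vnorm m (f x))"
  unfolding vnorm_def L2_set_def using assms by (intro continuous_intros) auto

context remainder_setting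
begin

text \<open>The cost of attaching a piece of length \<open>x\<close> to an interval: the remainder
  over the piece itself, plus the value of \<open>delta A\<close> at the junction.\<close>

definition modulus :: "real \<Rightarrow> real" where
  "modulus x = C * K * x powr \<kappa> + M * x powr (\<theta> * \<kappa>) * T powr ((1 - \<theta>) * \<kappa>)"

lemma modulus_mono: "0 \<le> x \<Longrightarrow> x \<le> y \<Longrightarrow> modulus x \<le> modulus y"
  unfolding modulus_def using C_ge_1 K_pos M \<theta> \<kappa>_pos
  by (intro add_mono mult_left_mono mult_right_mono powr_mono2) auto

lemma modulus_tendsto: "(modulus \<longlongrightarrow> 0) (at_right 0)"
proof -
  have *: "((\<lambda>x. x powr a) \<longlongrightarrow> 0) (at_right (0::real))" if "0 < a" for a :: real
  proof -
    have "((\<lambda>x. x powr a) \<longlongrightarrow> 0 powr a) (at_right (0::real))"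
      using that by (intro tendsto_powr' tendsto_ident_at tendsto_const)
        (auto simp: eventually_at_right_less eventually_at_filter)
    then show ?thesis by simp
  qed
  have "(modulus \<longlongrightarrow> C * K * 0 + M * 0 * T powr ((1 - \<theta>) * \<kappa>)) (at_right 0)"
    unfolding modulus_def[abs_def] using \<kappa>_pos \<theta> by (intro tendsto_intros *) auto
  then show ?thesis by simp
qed

text \<open>Enlarging the interval \<open>[s,t]\<close> to \<open>[a,b]\<close> changes the remainder by the modulus only; here
  the two different exponents of the pointwise bound on \<open>\<delta>A\<close> matter.\<close>

lemma R_enlarge_le:
  assumes G: "\<And>s t. s \<in> G \<Longrightarrow> t \<in> G \<Longrightarrow> 0 \<le> s \<Longrightarrow> s \<le> t \<Longrightarrow> t \<le> T \<Longrightarrow> vnorm m (R s t) \<le> C * K * (t - s) powr \<kappa>"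
    and mem: "a \<in> G" "s \<in> G" "t \<in> G" "b \<in> G" and ord: "0 \<le> a" "a \<le> s" "s \<le> t" "t \<le> b" "b \<le> T"
    and i: "i < m"
  shows "\<bar>R a b i - R s t i\<bar> \<le> modulus (s - a) + modulus (b - t)"
proof -
  have "R a b i - R s t i = R a s i - delta A a s b i + (R t b i - delta A s t b i)"
    using R_split[of a b i s] R_split[of s b i t] by simp
  then have "\<bar>R a b i - R s t i\<bar> \<le> \<bar>R a s i\<bar> + \<bar>delta A a s b i\<bar> + \<bar>R t b i\<bar> + \<bar>delta A s t b i\<bar>"
    by linarith
  also have "\<dots> \<le> vnorm m (R a s) + vnorm m (delta A a s b) + vnorm m (R t b) + vnorm m (delta A s t b)"
    using i by (intro add_mono abs_le_vnorm)
  also have "\<dots> \<le> modulus (s - a) + modulus (b - t)"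
  proof -
    have "vnorm m (R a s) \<le> C * K * (s - a) powr \<kappa>" "vnorm m (R t b) \<le> C * K * (b - t) powr \<kappa>"
      using mem ord by (auto intro!: G)
    moreover have "vnorm m (delta A a s b) \<le> M * (s - a) powr (\<theta> * \<kappa>) * T powr ((1 - \<theta>) * \<kappa>)"
      "vnorm m (delta A s t b) \<le> M * (b - t) powr (\<theta> * \<kappa>) * T powr ((1 - \<theta>) * \<kappa>)"
      using ord by (auto intro!: delta_le)
    ultimately show ?thesis unfolding modulus_def by linarith
  qed
  finally show ?thesis .
qed

text \<open>The remainder is uniformly continuous on pairs of good points, which are dense in the
  simplex, so it extends continuously to the closure. On every line almost every pair is good, which
  gives the identification with the original; the bound passes to the closure.\<close>

lemma continuous_version_exists:
  "\<exists>R'. continuous_version T m R R' \<and>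
    (\<forall>s t. 0 \<le> s \<and> s < t \<and> t \<le> T \<longrightarrow> vnorm m (R' s t) \<le> C * K * (t - s) powr \<kappa>)"
proof -
  obtain G where ae: "AE s in lborel. s \<in> G" and G: "\<And>s t. s \<in> G \<Longrightarrow> t \<in> G \<Longrightarrow> 0 \<le> s \<Longrightarrow> s \<le> t \<Longrightarrow> t \<le> T \<Longrightarrow>
      vnorm m (R s t) \<le> C * K * (t - s) powr \<kappa>"
    using good_set by metis
  define X where "X = {x \<in> Delta2 T. fst x \<in> G \<and> snd x \<in> G}"
  have dist_le: "\<bar>fst x - fst y\<bar> \<le> dist x y" "\<bar>snd x - snd y\<bar> \<le> dist x y" for x y :: "real \<times> real"
    using dist_fst_le[of x y] dist_snd_le[of x y] by (auto simp: dist_real_def)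
  have uc: "uniformly_continuous_on X (\<lambda>x. R (fst x) (snd x) i)" if i: "i < m" for i
    unfolding uniformly_continuous_on_def
  proof (intro allI impI)
    fix e :: real assume e: "0 < e"
    have "eventually (\<lambda>x. modulus x < e / 4) (at_right 0)"
      using order_tendstoD(2)[OF modulus_tendsto, of "e / 4"] e by simp
    then obtain b where b: "0 < b" "\<And>x. 0 < x \<Longrightarrow> x < b \<Longrightarrow> modulus x < e / 4"
      unfolding eventually_at_right_field by auto
    define d where "d = b / 2"
    have d: "0 < d" "modulus d < e / 4" using b by (auto simp: d_def)
    have "\<bar>R (fst x) (snd x) i - R (fst y) (snd y) i\<bar> < e"
      if xy: "x \<in> X" "y \<in> X" "dist y x < d" for x y
    proof -
      \<comment> \<open>The two intervals need not be nested, so both are compared with their common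
        hull. Its end points are among theirs and therefore lie in \<open>G\<close>.\<close>
      let ?a = "min (fst x) (fst y)" and ?b = "max (snd x) (snd y)"
      have close: "\<bar>fst y - fst x\<bar> \<le> d" "\<bar>snd y - snd x\<bar> \<le> d"
        using dist_le[of y x] xy(3) by auto
      have mem: "?a \<in> G" "?b \<in> G" using xy by (auto simp: X_def min_def max_def)
      have *: "\<bar>R ?a ?b i - R (fst z) (snd z) i\<bar> < e / 2" if z: "z = x \<or> z = y" for z
      proof -
        have zX: "z \<in> X" using z xy by auto
        have "\<bar>R ?a ?b i - R (fst z) (snd z) i\<bar> \<le> modulus (fst z - ?a) + modulus (?b - snd z)"
          by (rule R_enlarge_le[where G=G]) (use G mem zX xy z i in \<open>auto simp: X_def Delta2_def\<close>)
        also have "\<dots> \<le> modulus d + modulus d"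
          using z close by (intro add_mono modulus_mono) auto
        finally show ?thesis using d by linarith
      qed
      have tri: "\<bar>u - v\<bar> < e" if "\<bar>w - u\<bar> < e / 2" "\<bar>w - v\<bar> < e / 2" for u v w :: real
        using that by linarith
      show ?thesis by (rule tri[OF *[of x] *[of y]]) simp_all
    qed
    then show "\<exists>d>0. \<forall>x\<in>X. \<forall>x'\<in>X. dist x' x < d \<longrightarrow>
        dist (R (fst x') (snd x') i) (R (fst x) (snd x) i) < e"
      using d(1) by (intro exI[of _ d]) (auto simp: dist_real_def abs_minus_commute)
  qed
  have dense: "Delta2 T \<subseteq> closure X"
  proof
    fix x assume "x \<in> Delta2 T"
    then obtain s t where x: "x = (s, t)" and st: "0 \<le> s" "s \<le> t" "t \<le> T"
      by (auto simp: Delta2_def)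
    show "x \<in> closure X"
      unfolding closure_approachable
    proof (intro allI impI)
      fix e :: real assume e: "0 < e"
      have near: "\<exists>y\<in>X. dist y x < e"
        if "s' \<in> G" "t' \<in> G" "0 \<le> s'" "s' \<le> t'" "t' \<le> T" "\<bar>s' - s\<bar> < e / 2" "\<bar>t' - t\<bar> < e / 2" for s' t'
      proof (rule bexI[of _ "(s', t')"])
        have "dist (s', t') (s, t) \<le> \<bar>s' - s\<bar> + \<bar>t' - t\<bar>"
          unfolding dist_Pair_Pair dist_real_def
          using sqrt_sum_squares_le_sum_abs[of "s' - s" "t' - t"] by simp
        then show "dist (s', t') x < e" using that x by simp
        show "(s', t') \<in> X" using that by (auto simp: X_def Delta2_def)
      qed
      show "\<exists>y\<in>X. dist y x < e"
      proof (cases "s < t")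
        case True
        \<comment> \<open>Both points are approximated from inside the interval, on either side of
          the midpoint, so that the order \<open>s' \<le> t'\<close> and membership in
          \<open>[0,T]\<close> persist.\<close>
        obtain s' where s': "s < s'" "s' < min (s + e / 2) ((s + t) / 2)" "s' \<in> G"
          by (rule AE_lborel_obtain[OF ae, of s "min (s + e / 2) ((s + t) / 2)"]) (use True e in auto)
        obtain t' where t': "max (t - e / 2) ((s + t) / 2) < t'" "t' < t" "t' \<in> G"
          by (rule AE_lborel_obtain[OF ae, of "max (t - e / 2) ((s + t) / 2)" t]) (use True e in auto)
        show ?thesis using s' t' st by (intro near[of s' t']) auto
      next
        case False
        then have eq: "t = s" using st by simp
        \<comment> \<open>A diagonal point is approximated by diagonal points, from the right unless
          \<open>s = T\<close>.\<close>
        show ?thesis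
        proof (cases "s < T")
          case True
          obtain s' where s': "s < s'" "s' < min (s + e / 2) T" "s' \<in> G"
            by (rule AE_lborel_obtain[OF ae, of s "min (s + e / 2) T"]) (use True e in auto)
          then show ?thesis using st eq by (intro near[of s' s']) auto
        next
          case False
          then have "s = T" using st by simp
          obtain s' where s': "max 0 (T - e / 2) < s'" "s' < T" "s' \<in> G"
            by (rule AE_lborel_obtain[OF ae, of "max 0 (T - e / 2)" T]) (use T_pos e in auto)
          then show ?thesis using st eq \<open>s = T\<close> by (intro near[of s' s']) auto
        qed
      qed
    qed
  qed
  have "\<exists>g. continuous_on (closure X) g \<and> (\<forall>x\<in>X. R (fst x) (snd x) i = g x)" if "i < m" for i
    using uniformly_continuous_on_extension_on_closure[OF uc[OF that]] uniformly_continuous_imp_continuous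
    by metis
  then obtain g where g: "\<And>i. i < m \<Longrightarrow> continuous_on (closure X) (g i)"
    "\<And>i x. i < m \<Longrightarrow> x \<in> X \<Longrightarrow> g i x = R (fst x) (snd x) i"
    by metis
  define R' where "R' s t i = g i (s, t)" for s t i
  have "continuous_version T m R R'"
    unfolding continuous_version_def
  proof (intro conjI allI impI ballI)
    fix i assume "i < m"
    then show "continuous_on (Delta2 T) (\<lambda>(s, t). R' s t i)"
      using continuous_on_subset[OF g(1) dense] by (simp add: R'_def)
  next
    fix h assume h: "h \<in> {0..T}"
    have "AE r in lborel. r + h \<in> G" by (rule AE_lborel_translate[OF ae])
    with ae have "AE r in lborel. r \<in> {0..T - h} \<longrightarrow> (\<forall>i<m. R' r (r + h) i = R r (r + h) i)"
    proof eventually_elim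
      case (elim r)
      then show ?case using g(2)[of _ "(r, r + h)"] h by (auto simp: R'_def X_def Delta2_def)
    qed
    then show "AE r in restrict_space lborel {0..T - h}. \<forall>i<m. R' r (r + h) i = R r (r + h) i"
      by (subst AE_restrict_space_iff) auto
  qed
  moreover have "vnorm m (R' s t) \<le> C * K * (t - s) powr \<kappa>" if st: "0 \<le> s" "s < t" "t \<le> T" for s t
  proof -
    let ?F = "\<lambda>x. vnorm m (R' (fst x) (snd x)) - C * K * \<bar>snd x - fst x\<bar> powr \<kappa>"
    have cont: "continuous_on (closure X) ?F"
      using g(1) \<kappa>_pos
      by (intro continuous_on_diff continuous_on_vnorm continuous_on_mult continuous_on_const
          continuous_on_powr' continuous_on_rabs continuous_on_fst continuous_on_snd continuous_on_id)
        (auto simp: R'_def)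
    have "?F (s, t) \<le> 0"
    proof (rule continuous_le_on_closure[OF cont])
      show "(s, t) \<in> closure X" using dense st by (auto simp: Delta2_def)
      fix x assume x: "x \<in> X"
      have "vnorm m (R' (fst x) (snd x)) = vnorm m (R (fst x) (snd x))"
        using g(2) x by (intro vnorm_cong) (simp add: R'_def)
      then show "?F x \<le> 0" using G[of "fst x" "snd x"] x by (auto simp: X_def Delta2_def)
    qed
    then show ?thesis using st by simp
  qed
  ultimately show ?thesis by blast
qed

end

section \<open>Supercritical and critical sewing constants\<close>

lemma delta_midpoint_integral_le:
  assumes p: "0 < p" and h: "0 \<le> h" and b: "0 \<le> b" and le: "Omega3 T m (ennreal p) (delta A) h \<le> ennreal b"
  shows "(\<integral>\<^sup>+r. ennreal (vnorm m (delta A r (r + h / 2) (r + h)) powr p) \<partial>restrict_space lborel {0..T - h})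
    \<le> ennreal (b powr p)"
proof -
  have "Lp_norm (restrict_space lborel {0..T - h}) (ennreal p) (\<lambda>r. ennreal (vnorm m (delta A r (r + 1/2 * h) (r + h))))
      \<le> Omega3 T m (ennreal p) (delta A) h"
    using h by (intro Lp_norm_le_Omega3) auto
  also note le
  finally show ?thesis using p b by (simp add: Lp_norm_vnorm_le_iff)
qed

text \<open>The geometric series for the powers \<open>min 1 p\<close>, with the doubling loss of
  \<open>Omega3_le_BB3_norm\<close>, brought back to the first power. The maximum with 1 secures
  \<open>M \<le> K\<close> later.\<close>

definition sewing_const :: "real \<Rightarrow> ennreal \<Rightarrow> real \<Rightarrow> real" where
  "sewing_const p q \<gamma> =
     max 1 ((2 * (2 powr recip q * 2 powr \<gamma>) powr min 1 p / (1 - 2 powr (1 - \<gamma> * min 1 p))) powr (1 / min 1 p))"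

text \<open>Level \<open>n\<close> is bounded by a multiple of
  \<open>2 ^ n * (h / 2 ^ n) powr (\<gamma> * min 1 p)\<close>. The ratio
  \<open>2 powr (1 - \<gamma> * min 1 p)\<close> is below 1 exactly because \<open>\<gamma>\<close>
  exceeds both 1 and \<open>1 / p\<close>.\<close>

lemma remainder_integral_le_BB3_norm:
  assumes T: "0 < T" and p: "0 < p" and q: "0 < q" and \<gamma>: "1 < \<gamma>" "1 / p < \<gamma>" and h: "0 < h" "h \<le> T / 2"
    and A: "map2_measurable T m A"
    and gi: "generalized_integral T m p1 (ennreal p) q1 q2 \<alpha> \<gamma> A I"
    and \<Phi>: "BB3_norm T m \<gamma> (ennreal p) q (delta A) = ennreal \<Phi>" "0 \<le> \<Phi>" and M: "0 < M"
  shows "(\<integral>\<^sup>+r. ennreal (vnorm m (remainder A I r (r + h)) powr p) \<partial>restrict_space lborel {0..T - h})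
     \<le> ennreal ((sewing_const p q \<gamma> * (\<Phi> + M) * h powr \<gamma>) powr p)"
proof -
  define e where "e = min 1 p"
  have e: "0 < e" "max 1 p = 1 / e * p" using p by (auto simp: e_def min_def max_def)
  define x where "x = 2 powr (1 - \<gamma> * e)"
  have "1 < \<gamma> * e" using \<gamma> p by (auto simp: e_def min_def field_simps)
  then have x: "0 < x" "x < 1" using powr_less_mono[of "1 - \<gamma> * e" 0 2] by (auto simp: x_def)
  define c where "c = 2 powr recip q * 2 powr \<gamma>"
  have c: "0 < c" by (simp add: c_def)
  define b where "b n = c * \<Phi> * (h / 2 ^ n) powr \<gamma>" for n :: nat
  have b: "0 \<le> b n" for n using c \<Phi> by (simp add: b_def)
  \<comment> \<open>\<open>M\<close> enters although the sum involves only \<open>\<Phi>\<close>: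
    \<open>remainder_integral_le\<close> asks for a positive \<open>S\<close>, and
    \<open>\<Phi>\<close> may be 0.\<close>
  define S where "S = (c * (\<Phi> + M) * h powr \<gamma>) powr e / (1 - x)"
  have S: "0 < S" using c \<Phi> M h x by (simp add: S_def)
  have "(\<integral>\<^sup>+r. ennreal (vnorm m (remainder A I r (r + h)) powr p) \<partial>restrict_space lborel {0..T - h})
     \<le> ennreal ((2 * S) powr max 1 p)"
  proof (rule remainder_integral_le[OF T p _ h A gi b _ S])
    show "0 < \<gamma>" using \<gamma> by simp
    fix n :: nat
    have hn: "0 < h / 2 ^ n" "h / 2 ^ n \<le> T / 2"
      using h halved_le[OF h(1), of n] by (simp, linarith)
    have "Omega3 T m (ennreal p) (delta A) (h / 2 ^ n) \<le> ennreal (2 powr recip q * (2 * (h / 2 ^ n)) powr \<gamma>) * ennreal \<Phi>"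
      unfolding \<Phi>(1)[symmetric] using q \<gamma> hn by (intro Omega3_le_BB3_norm) auto
    also have "\<dots> = ennreal (2 powr recip q * (2 * (h / 2 ^ n)) powr \<gamma> * \<Phi>)"
      by (simp add: ennreal_mult' \<Phi>(2))
    also have "2 powr recip q * (2 * (h / 2 ^ n)) powr \<gamma> * \<Phi> = b n"
      unfolding b_def c_def powr_mult[of 2 "h / 2 ^ n"] by (simp only: mult.assoc mult.left_commute mult.commute[of \<Phi>])
    finally have "Omega3 T m (ennreal p) (delta A) (h / 2 ^ n) \<le> ennreal (b n)" .
    then show "(\<integral>\<^sup>+r. ennreal (vnorm m (delta A r (r + h / 2 ^ n / 2) (r + h / 2 ^ n)) powr p)
       \<partial>restrict_space lborel {0..T - h / 2 ^ n}) \<le> ennreal (b n powr p)"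
      using hn by (intro delta_midpoint_integral_le p b) auto
  next
    fix N :: nat
    have summand: "2 ^ n * b n powr e = (c * \<Phi> * h powr \<gamma>) powr e * x ^ n" for n
    proof -
      have "b n = c * \<Phi> * h powr \<gamma> / (2 ^ n) powr \<gamma>"
        using h by (simp add: b_def powr_divide)
      then have "b n powr e = (c * \<Phi> * h powr \<gamma>) powr e / (2 ^ n) powr (\<gamma> * e)"
        by (simp only: powr_divide powr_powr)
      moreover have "(2::real) ^ n / (2 ^ n) powr (\<gamma> * e) = x ^ n"
      proof -
        have "(2::real) ^ n / (2 ^ n) powr (\<gamma> * e) = (2 ^ n) powr (1 - \<gamma> * e)"
          by (simp add: powr_diff)
        also have "\<dots> = x ^ n"
          by (simp add: x_def powr_realpow[symmetric] powr_powr mult.commute)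
        finally show ?thesis .
      qed
      ultimately show ?thesis by (metis times_divide_eq_left times_divide_eq_right mult.commute)
    qed
    have "(\<Sum>n<N. 2 ^ n * b n powr min 1 p) = (c * \<Phi> * h powr \<gamma>) powr e * (\<Sum>n<N. x ^ n)"
      unfolding e_def[symmetric] summand by (simp add: sum_distrib_left)
    also have "\<dots> \<le> (c * (\<Phi> + M) * h powr \<gamma>) powr e * (1 / (1 - x))"
    proof (intro mult_mono powr_mono2)
      show "(\<Sum>n<N. x ^ n) \<le> 1 / (1 - x)"
        using x by (simp add: sum_gp_strict divide_right_mono)
    qed (use e c \<Phi> M x \<gamma> h in \<open>auto intro!: sum_nonneg\<close>)
    finally show "(\<Sum>n<N. 2 ^ n * b n powr min 1 p) \<le> S" by (simp add: S_def)
  qed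
  also have "(2 * S) powr max 1 p = ((2 * S) powr (1 / e)) powr p"
    by (simp add: powr_powr e(2))
  also have "(2 * S) powr (1 / e) = (2 * c powr e / (1 - x)) powr (1 / e) * ((\<Phi> + M) * h powr \<gamma>)"
  proof -
    have "2 * S = 2 * c powr e / (1 - x) * ((\<Phi> + M) * h powr \<gamma>) powr e"
      by (simp add: S_def powr_mult mult.assoc)
    then have "(2 * S) powr (1 / e) = (2 * c powr e / (1 - x)) powr (1 / e) * (((\<Phi> + M) * h powr \<gamma>) powr e) powr (1 / e)"
      by (simp only: powr_mult)
    then show ?thesis using e(1) \<Phi> M by (simp add: powr_powr)
  qed
  also have "ennreal (((2 * c powr e / (1 - x)) powr (1 / e) * ((\<Phi> + M) * h powr \<gamma>)) powr p)
    \<le> ennreal ((sewing_const p q \<gamma> * ((\<Phi> + M) * h powr \<gamma>)) powr p)"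
    using \<Phi> M p by (intro ennreal_leI powr_mono2 mult_right_mono)
      (auto simp: sewing_const_def c_def x_def e_def)
  finally show ?thesis by (simp add: mult.assoc)
qed

text \<open>In the critical case the geometric series of the sewing argument is replaced by the
  embedding of \<open>\<ell>\<^sup>q\<close> into \<open>\<ell>\<^sup>1\<close>, whence the condition \<open>q \<le> 1\<close>.\<close>

lemma sum_powr_subadditive:
  assumes "0 < r" "r \<le> (1::real)" "\<And>n. n \<in> N \<Longrightarrow> 0 \<le> f n"
  shows "(\<Sum>n\<in>N. f n) powr r \<le> (\<Sum>n\<in>N. f n powr r)"
  using assms(3)
proof (induction N rule: infinite_finite_induct)
  case (insert n N)
  have "(f n + (\<Sum>n\<in>N. f n)) powr r \<le> f n powr r + (\<Sum>n\<in>N. f n) powr r"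
    using insert assms by (intro powr_add_le_of_le_1 sum_nonneg) auto
  then show ?case using insert by simp
qed (use assms in auto)

text \<open>One factor 2 is the allowance for the finest partition sum, another is the
  \<open>2 * h\<close> by which the dyadic terms are normalized; \<open>2 powr recip q\<close> stems
  from \<open>log_measure_dyadic_sum_le\<close>.\<close>

definition critical_sewing_const :: "ennreal \<Rightarrow> real" where
  "critical_sewing_const q = 4 * 2 powr recip q"

lemma critical_sewing_const_ge_1: "1 \<le> critical_sewing_const q"
proof -
  have "(1::real) \<le> 2 powr recip q" by (rule ge_one_powr_ge_zero) auto
  then show ?thesis by (simp add: critical_sewing_const_def)
qed

text \<open>For \<open>\<gamma> = 1\<close> the terms \<open>2 ^ n * b n / (2 * h)\<close> are the
  normalized values of \<open>Omega3\<close> at \<open>h / 2 ^ n\<close>. There is no geometric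
  decay, but \<open>log_measure_dyadic_sum_le\<close> sums their \<open>r\<close>-th powers, and
  \<open>r \<le> 1\<close> then bounds their plain sum.\<close>

lemma remainder_integral_le_BB3_norm_critical:
  assumes T: "0 < T" and p: "1 \<le> p" and q: "0 < q" "q \<le> 1" and h: "0 < h" "h \<le> T / 2"
    and A: "map2_measurable T m A"
    and gi: "generalized_integral T m p1 (ennreal p) q1 q2 \<alpha> 1 A I"
    and \<Phi>: "BB3_norm T m 1 (ennreal p) q (delta A) = ennreal \<Phi>" "0 \<le> \<Phi>" and M: "0 < M"
  shows "(\<integral>\<^sup>+r. ennreal (vnorm m (remainder A I r (r + h)) powr p) \<partial>restrict_space lborel {0..T - h})
     \<le> ennreal ((critical_sewing_const q * (\<Phi> + M) * h powr 1) powr p)"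
proof -
  obtain r where r: "0 < r" "r \<le> 1" "q = ennreal r" "recip q = 1 / r"
    using q(1)
  proof (cases rule: ennreal_exponent_cases)
    case (finite r)
    then show ?thesis using q(2) that by (simp add: ennreal_le_1)
  qed (use q in \<open>simp add: top_unique\<close>)
  define \<Omega> where "\<Omega> = Omega3 T m (ennreal p) (delta A)"
  define b where "b n = enn2real (\<Omega> (h / 2 ^ n))" for n :: nat
  have b: "0 \<le> b n" for n by (simp add: b_def)
  define S where "S = 2 powr (1 / r) * (2 * h) * (\<Phi> + M)"
  have S: "0 < S" using h M \<Phi> by (simp add: S_def)
  have hn: "0 < h / 2 ^ n" "h / 2 ^ n \<le> T / 2" for n :: nat
    using h halved_le[OF h(1), of n] by (simp, linarith)
  have \<Omega>_eq: "\<Omega> (h / 2 ^ n) = ennreal (b n)" for n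
  proof -
    have "\<Omega> (h / 2 ^ n) \<le> ennreal (2 powr recip q * (2 * (h / 2 ^ n)) powr 1) * ennreal \<Phi>"
      unfolding \<Phi>(1)[symmetric] \<Omega>_def using q hn by (intro Omega3_le_BB3_norm) auto
    also have "\<dots> < top" by (simp add: ennreal_mult_less_top)
    finally show ?thesis by (simp add: b_def)
  qed
  have "(\<integral>\<^sup>+r. ennreal (vnorm m (remainder A I r (r + h)) powr p) \<partial>restrict_space lborel {0..T - h})
     \<le> ennreal ((2 * S) powr max 1 p)"
  proof (rule remainder_integral_le[OF T _ _ h A gi b _ S])
    show "(\<integral>\<^sup>+r. ennreal (vnorm m (delta A r (r + h / 2 ^ n / 2) (r + h / 2 ^ n)) powr p)
       \<partial>restrict_space lborel {0..T - h / 2 ^ n}) \<le> ennreal (b n powr p)" for n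
      using p b \<Omega>_eq[of n] less_imp_le[OF hn(1)] by (intro delta_midpoint_integral_le) (auto simp: \<Omega>_def)
    fix N :: nat
    have "(\<Sum>n<N. ennpowr (\<Omega> (h / 2 ^ n) / ennreal ((2 * (h / 2 ^ n)) powr 1)) r)
      \<le> 2 * (\<integral>\<^sup>+\<tau>. ennpowr (\<Omega> \<tau> / ennreal (\<tau> powr 1)) r \<partial>log_measure T)"
      by (rule log_measure_dyadic_sum_le[OF _ r(1) _ h]) (simp_all add: \<Omega>_def Omega3_mono)
    also have "\<dots> \<le> 2 * ennpowr (ennreal \<Phi>) r"
    proof (rule mult_left_mono)
      have "Lp_norm (log_measure T) (ennreal r) (\<lambda>\<tau>. \<Omega> \<tau> / ennreal (\<tau> powr 1)) \<le> ennreal \<Phi>"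
        using \<Phi>(1) unfolding BB3_norm_def r(3) \<Omega>_def by simp
      then show "(\<integral>\<^sup>+\<tau>. ennpowr (\<Omega> \<tau> / ennreal (\<tau> powr 1)) r \<partial>log_measure T) \<le> ennpowr (ennreal \<Phi>) r"
        using r(1) by (simp add: Lp_norm_finite_le_iff)
    qed simp
    also have "\<dots> = ennreal (2 * \<Phi> powr r)"
      using \<Phi> by (simp add: ennpowr_ennreal ennreal_mult)
    also have "(\<Sum>n<N. ennpowr (\<Omega> (h / 2 ^ n) / ennreal ((2 * (h / 2 ^ n)) powr 1)) r)
        = (\<Sum>n<N. ennreal ((b n / (2 * (h / 2 ^ n))) powr r))"
    proof (intro sum.cong refl)
      fix n
      have "ennreal (b n) / ennreal ((2 * (h / 2 ^ n)) powr 1) = ennreal (b n / (2 * (h / 2 ^ n)))"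
      proof -
        have "ennreal u / ennreal ((2 * y) powr 1) = ennreal (u / (2 * y))" if "0 \<le> u" "0 < y" for u y :: real
          using that by (simp add: divide_ennreal)
        from this[OF b hn(1)] show ?thesis .
      qed
      then show "ennpowr (\<Omega> (h / 2 ^ n) / ennreal ((2 * (h / 2 ^ n)) powr 1)) r = ennreal ((b n / (2 * (h / 2 ^ n))) powr r)"
        unfolding \<Omega>_eq using b[of n] less_imp_le[OF hn(1)] by (simp add: ennpowr_ennreal del: times_divide_eq_right)
    qed
    finally have *: "(\<Sum>n<N. (b n / (2 * (h / 2 ^ n))) powr r) \<le> 2 * \<Phi> powr r"
      by (simp add: sum_ennreal)
    have "((\<Sum>n<N. 2 ^ n * b n) / (2 * h)) powr r = (\<Sum>n<N. b n / (2 * (h / 2 ^ n))) powr r"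
      by (simp add: sum_divide_distrib mult.commute)
    also have "\<dots> \<le> (\<Sum>n<N. (b n / (2 * (h / 2 ^ n))) powr r)"
      using r b h by (intro sum_powr_subadditive) auto
    also note *
    finally have "(((\<Sum>n<N. 2 ^ n * b n) / (2 * h)) powr r) powr (1 / r) \<le> (2 * \<Phi> powr r) powr (1 / r)"
      using r by (intro powr_mono2) auto
    moreover have "0 \<le> (\<Sum>n<N. 2 ^ n * b n) / (2 * h)"
      using b h by (intro divide_nonneg_nonneg sum_nonneg) auto
    moreover have "x \<le> 2 powr (1 / r) * \<Phi>"
      if "(x powr r) powr (1 / r) \<le> (2 * \<Phi> powr r) powr (1 / r)" "0 \<le> x" for x
      using that r \<Phi> by (simp add: powr_powr powr_mult)
    ultimately have "(\<Sum>n<N. 2 ^ n * b n) / (2 * h) \<le> 2 powr (1 / r) * \<Phi>"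
      by blast
    then have "(\<Sum>n<N. 2 ^ n * b n) \<le> 2 powr (1 / r) * \<Phi> * (2 * h)"
      using h by (simp add: pos_divide_le_eq)
    also have "\<dots> \<le> S" using h M by (simp add: S_def algebra_simps)
    finally show "(\<Sum>n<N. 2 ^ n * b n powr min 1 p) \<le> S"
      using p b by simp
  qed (use p in auto)
  also have "(2 * S) powr max 1 p = (critical_sewing_const q * (\<Phi> + M) * h powr 1) powr p"
    using p h r by (simp add: S_def critical_sewing_const_def mult_ac)
  finally show ?thesis .
qed

section \<open>Assembly of the two cases\<close>

definition holder_const :: "ennreal \<Rightarrow> real \<Rightarrow> real" where
  "holder_const p \<gamma> = remainder_setting.C (enn2real p) (\<gamma> - recip p)"

text \<open>Outside its locale, a constant takes as arguments just the locale parameters that it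
  mentions. For this one and \<open>holder_const\<close> these are \<open>p\<close> and
  \<open>\<kappa>\<close>, so independence of \<open>T\<close>, \<open>m\<close>, \<open>A\<close>
  and \<open>M\<close> is visible from the type.\<close>

definition interpolation_const :: "ennreal \<Rightarrow> ennreal \<Rightarrow> ennreal \<Rightarrow> ennreal \<Rightarrow> real \<Rightarrow> real \<Rightarrow> real" where
  "interpolation_const p1 p2 q1 q2 \<alpha> \<gamma> = remainder_setting.besov_const (enn2real p2) (\<gamma> - recip p2)
     p1 q1 (max q1 q2) \<alpha> (\<gamma> - recip p2 - \<alpha> + recip p1)"

text \<open>Shared by both cases, which differ only in \<open>c\<close> and in the proof of
  \<open>int_le\<close>. That hypothesis speaks of real representatives of \<open>p2\<close> and of
  the norm of \<open>delta A\<close>; they exist since \<open>p2 < p1\<close> and the norm is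
  finite.\<close>

lemma generalized_integral_bounds:
  fixes T :: real
  assumes T: "0 < T" and p: "0 < p2" "p2 < p1" and q1: "0 < q1" and \<alpha>: "0 < \<alpha>" and \<gamma>: "0 < \<gamma>" "recip p2 < \<gamma>"
    and \<epsilon>: "\<gamma> - recip p2 > \<alpha> - recip p1" and \<theta>: "0 < \<theta>" "\<theta> < 1 / 2" and M: "0 < M"
    and A: "map2_measurable T m A"
    and A_fin: "BB_norm T m \<alpha> p1 q1 A < \<infinity>" and dA_fin: "BB3_norm T m \<gamma> p2 q2 (delta A) < \<infinity>"
    and bd: "delta_bound T m \<theta> (\<gamma> - recip p2) M A"
    and gi: "generalized_integral T m p1 p2 q1 q2 \<alpha> \<gamma> A I"
    and c: "1 \<le> c"
    and int_le: "\<And>p \<Phi> h. 0 < p \<Longrightarrow> p2 = ennreal p \<Longrightarrow> BB3_norm T m \<gamma> p2 q2 (delta A) = ennreal \<Phi> \<Longrightarrow> 0 \<le> \<Phi> \<Longrightarrow>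
      0 < h \<Longrightarrow> h \<le> T / 2 \<Longrightarrow>
      (\<integral>\<^sup>+r. ennreal (vnorm m (remainder A I r (r + h)) powr p) \<partial>restrict_space lborel {0..T - h})
     \<le> ennreal ((c * (\<Phi> + M) * h powr \<gamma>) powr p)"
  obtains K where "0 \<le> K" "ennreal K = ennreal c * (BB3_norm T m \<gamma> p2 q2 (delta A) + ennreal M)"
    "1 \<le> holder_const p2 \<gamma>"
    "CC_norm T m (\<gamma> - recip p2) (remainder A I) \<le> ennreal (holder_const p2 \<gamma> * K)"
    "\<exists>R. continuous_version T m (remainder A I) R \<and>
      (\<forall>s t. 0 \<le> s \<and> s < t \<and> t \<le> T \<longrightarrow> vnorm m (R s t) \<le> holder_const p2 \<gamma> * K * (t - s) powr (\<gamma> - recip p2))"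
    "Besov_seminorm T m \<alpha> p1 (max q1 q2) I \<le> ennreal (interpolation_const p1 p2 q1 q2 \<alpha> \<gamma>) *
      (BB_norm T m \<alpha> p1 q1 A + ennreal (T powr (\<gamma> - recip p2 - \<alpha> + recip p1) * K))"
proof -
  obtain p where pr: "0 < p" "p2 = ennreal p" "enn2real p2 = p" "recip p2 = 1 / p"
    using p(1)
  proof (cases rule: ennreal_exponent_cases)
    case infinite
    then show ?thesis using p(2) by simp
  qed (use that in auto)
  define \<Phi> where "\<Phi> = enn2real (BB3_norm T m \<gamma> p2 q2 (delta A))"
  have \<Phi>: "BB3_norm T m \<gamma> p2 q2 (delta A) = ennreal \<Phi>" "0 \<le> \<Phi>"
    using dA_fin by (auto simp: \<Phi>_def less_top)
  define K where "K = c * (\<Phi> + M)"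
  have MK: "M \<le> K"
  proof -
    have "1 * M \<le> c * (\<Phi> + M)" using c M \<Phi> by (intro mult_mono) auto
    then show ?thesis by (simp add: K_def)
  qed
  interpret remainder_setting T p \<gamma> "\<gamma> - recip p2" \<theta> M K m A I
  proof
    show "(\<integral>\<^sup>+r. ennreal (vnorm m (remainder A I r (r + h)) powr p) \<partial>restrict_space lborel {0..T - h})
        \<le> ennreal ((K * h powr \<gamma>) powr p)" if "0 < h" "h \<le> T / 2" for h
      unfolding K_def by (rule int_le[OF pr(1,2) \<Phi> that])
    show "path_measurable T m I"
      using gi by (simp add: generalized_integral_def Besov_space_def)
  qed (use T pr \<gamma> \<theta> M MK A bd in auto)
  show thesis
  proof (rule that[of K])
    show "0 \<le> K" using K_pos by simp
    show "ennreal K = ennreal c * (BB3_norm T m \<gamma> p2 q2 (delta A) + ennreal M)"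
      using c M \<Phi> by (simp add: K_def ennreal_mult')
    show "1 \<le> holder_const p2 \<gamma>"
      unfolding holder_const_def pr(3) by (rule C_ge_1)
    show "CC_norm T m (\<gamma> - recip p2) (remainder A I) \<le> ennreal (holder_const p2 \<gamma> * K)"
      unfolding holder_const_def pr(3) by (rule CC_norm_le)
    show "\<exists>R. continuous_version T m (remainder A I) R \<and>
      (\<forall>s t. 0 \<le> s \<and> s < t \<and> t \<le> T \<longrightarrow> vnorm m (R s t) \<le> holder_const p2 \<gamma> * K * (t - s) powr (\<gamma> - recip p2))"
      unfolding holder_const_def pr(3) by (rule continuous_version_exists)
    show "Besov_seminorm T m \<alpha> p1 (max q1 q2) I \<le> ennreal (interpolation_const p1 p2 q1 q2 \<alpha> \<gamma>) *
      (BB_norm T m \<alpha> p1 q1 A + ennreal (T powr (\<gamma> - recip p2 - \<alpha> + recip p1) * K))"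
      unfolding interpolation_const_def pr(3)
      using p q1 \<alpha> \<epsilon> A_fin pr by (intro Besov_seminorm_le) auto
  qed
qed

text \<open>As \<open>c \<ge> 1\<close>, the constant inside one summand may be moved in front of
  the whole sum.\<close>

lemma ennreal_mult_add_le:
  assumes "1 \<le> c" "0 \<le> d"
  shows "ennreal d * (x + ennreal y * (ennreal c * z)) \<le> ennreal (d * c) * (x + ennreal y * z)"
proof -
  have "x + ennreal y * (ennreal c * z) \<le> ennreal c * x + ennreal c * (ennreal y * z)"
  proof (intro add_mono)
    have "1 * x \<le> ennreal c * x" using assms by (intro mult_right_mono) auto
    then show "x \<le> ennreal c * x" by simp
  qed (simp add: mult.left_commute)
  from mult_left_mono[OF this, of "ennreal d"] show ?thesis
    using assms by (simp add: ennreal_mult distrib_left mult.assoc)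
qed

lemma supercritical_bounds:
  fixes T :: real
  assumes "0 < p2" "0 < q1" "0 < q2" "0 < \<alpha>" "max 1 (recip p2) < \<gamma>" "p2 < p1"
    "\<gamma> - recip p2 > \<alpha> - recip p1" "0 < \<theta>" "\<theta> < 1/2" "0 < M" "0 < T" "map2_measurable T m A"
    and fin: "BB_norm T m \<alpha> p1 q1 A + BB3_norm T m \<gamma> p2 q2 (delta A) < \<infinity>"
    and "delta_bound T m \<theta> (\<gamma> - recip p2) M A" "generalized_integral T m p1 p2 q1 q2 \<alpha> \<gamma> A I"
  shows "CC_norm T m (\<gamma> - recip p2) (remainder A I)
      \<le> ennreal (holder_const p2 \<gamma> * sewing_const (enn2real p2) q2 \<gamma>) * (BB3_norm T m \<gamma> p2 q2 (delta A) + ennreal M)"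
    and "Besov_seminorm T m \<alpha> p1 (max q1 q2) I
      \<le> ennreal (max 0 (interpolation_const p1 p2 q1 q2 \<alpha> \<gamma>) * sewing_const (enn2real p2) q2 \<gamma>) *
         (BB_norm T m \<alpha> p1 q1 A + ennreal (T powr (\<gamma> - recip p2 - \<alpha> + recip p1)) *
            (BB3_norm T m \<gamma> p2 q2 (delta A) + ennreal M))"
proof -
  let ?c = "sewing_const (enn2real p2) q2 \<gamma>"
  have c: "1 \<le> ?c" by (simp add: sewing_const_def)
  obtain K where K: "0 \<le> K" "ennreal K = ennreal ?c * (BB3_norm T m \<gamma> p2 q2 (delta A) + ennreal M)"
    "1 \<le> holder_const p2 \<gamma>"
    "CC_norm T m (\<gamma> - recip p2) (remainder A I) \<le> ennreal (holder_const p2 \<gamma> * K)"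
    "Besov_seminorm T m \<alpha> p1 (max q1 q2) I \<le> ennreal (interpolation_const p1 p2 q1 q2 \<alpha> \<gamma>) *
      (BB_norm T m \<alpha> p1 q1 A + ennreal (T powr (\<gamma> - recip p2 - \<alpha> + recip p1) * K))"
  proof (rule generalized_integral_bounds[where c = ?c])
    show "(\<integral>\<^sup>+r. ennreal (vnorm m (remainder A I r (r + h)) powr p) \<partial>restrict_space lborel {0..T - h})
       \<le> ennreal ((?c * (\<Phi> + M) * h powr \<gamma>) powr p)"
      if "0 < p" "p2 = ennreal p" "BB3_norm T m \<gamma> p2 q2 (delta A) = ennreal \<Phi>" "0 \<le> \<Phi>" "0 < h" "h \<le> T / 2" for p \<Phi> h
    proof -
      have "recip p2 = 1 / p" using that assms(1) by (cases rule: ennreal_exponent_cases[OF assms(1)]) auto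
      then show ?thesis
        using that assms remainder_integral_le_BB3_norm[of T p q2 \<gamma> h m A p1 q1 q2 \<alpha> I \<Phi> M] by simp
    qed
  qed (use assms c in auto)
  show "CC_norm T m (\<gamma> - recip p2) (remainder A I)
      \<le> ennreal (holder_const p2 \<gamma> * ?c) * (BB3_norm T m \<gamma> p2 q2 (delta A) + ennreal M)"
    using K c by (simp add: ennreal_mult mult.assoc)
  \<comment> \<open>Taking \<open>max 0\<close> leaves the value under \<open>ennreal\<close>
    unchanged and supplies the nonnegativity that \<open>ennreal_mult_add_le\<close> asks
    for.\<close>
  have "Besov_seminorm T m \<alpha> p1 (max q1 q2) I \<le> ennreal (max 0 (interpolation_const p1 p2 q1 q2 \<alpha> \<gamma>)) *
      (BB_norm T m \<alpha> p1 q1 A + ennreal (T powr (\<gamma> - recip p2 - \<alpha> + recip p1)) * (ennreal ?c * (BB3_norm T m \<gamma> p2 q2 (delta A) + ennreal M)))"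
    using K(5) unfolding K(2)[symmetric] by (elim order_trans) (auto intro!: mult_right_mono ennreal_leI simp: ennreal_mult K(1))
  also have "\<dots> \<le> ennreal (max 0 (interpolation_const p1 p2 q1 q2 \<alpha> \<gamma>) * ?c) *
         (BB_norm T m \<alpha> p1 q1 A + ennreal (T powr (\<gamma> - recip p2 - \<alpha> + recip p1)) *
            (BB3_norm T m \<gamma> p2 q2 (delta A) + ennreal M))"
    by (rule ennreal_mult_add_le[OF c]) simp
  finally show "Besov_seminorm T m \<alpha> p1 (max q1 q2) I \<le> \<dots>" .
qed

text \<open>Since \<open>l q2\<close> is non-increasing, its value at \<open>t - s\<close> is at
  least its value at \<open>T\<close>, so division by the logarithmic factor costs at most
  \<open>1 / l q2 T\<close>. This may enter the constants because \<open>T\<close> and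
  \<open>l\<close> are fixed before them.\<close>

lemma critical_bounds:
  fixes T :: real
  assumes T: "0 < T" and l: "log_like T l"
    and q2: "0 < q2" "q2 \<le> 1" and p2: "1 < p2" "p2 < p1" and asm: "0 < q1" "0 < \<alpha>"
    "1 - recip p2 > \<alpha> - recip p1" "0 < \<theta>" "\<theta> < 1/2" "0 < M" "map2_measurable T m A"
    and fin: "BB_norm T m \<alpha> p1 q1 A + BB3_norm T m 1 p2 q2 (delta A) < \<infinity>"
    and bd: "delta_bound T m \<theta> (1 - recip p2) M A" "generalized_integral T m p1 p2 q1 q2 \<alpha> 1 A I"
  shows "\<exists>R. continuous_version T m (remainder A I) R \<and>
      (SUP (s, t)\<in>{(s, t). 0 \<le> s \<and> s < t \<and> t \<le> T}.
         ennreal (vnorm m (R s t) / (((t - s) * l q2 (t - s)) * (t - s) powr (- recip p2))))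
      \<le> ennreal (holder_const p2 1 * critical_sewing_const q2 / l q2 T) * (BB3_norm T m 1 p2 q2 (delta A) + ennreal M)"
    and "Besov_seminorm T m \<alpha> p1 (max q1 q2) I
      \<le> ennreal (max 0 (interpolation_const p1 p2 q1 q2 \<alpha> 1) * (critical_sewing_const q2 * max 1 (1 / l q2 T))) *
         (BB_norm T m \<alpha> p1 q1 A + ennreal (T powr (1 - recip p2 - \<alpha> + recip p1) * l q2 T) *
            (BB3_norm T m 1 p2 q2 (delta A) + ennreal M))"
proof -
  let ?c = "critical_sewing_const q2"
  have c: "1 \<le> ?c" by (rule critical_sewing_const_ge_1)
  have p2_pos: "0 < p2" using p2(1) by (metis less_trans zero_less_one)
  obtain p where p: "1 < p" "p2 = ennreal p" "recip p2 = 1 / p"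
    using p2_pos
  proof (cases rule: ennreal_exponent_cases)
    case infinite
    then show ?thesis using p2(2) by simp
  next
    case (finite r)
    then show ?thesis using p2(1) that by (simp add: ennreal_less_iff flip: ennreal_1)
  qed
  have l_pos: "0 < l q2 h" if "0 < h" "h \<le> T" for h
    using l q2(1) that by (auto simp: log_like_def)
  have l_ge: "l q2 T \<le> l q2 h" if "0 < h" "h \<le> T" for h
    using l q2(1) that by (auto simp: log_like_def monotone_on_def)
  have lT: "0 < l q2 T" using l_pos T by simp
  obtain K where K: "0 \<le> K" "ennreal K = ennreal ?c * (BB3_norm T m 1 p2 q2 (delta A) + ennreal M)"
    "1 \<le> holder_const p2 1"
    "\<exists>R. continuous_version T m (remainder A I) R \<and>
      (\<forall>s t. 0 \<le> s \<and> s < t \<and> t \<le> T \<longrightarrow> vnorm m (R s t) \<le> holder_const p2 1 * K * (t - s) powr (1 - recip p2))"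
    "Besov_seminorm T m \<alpha> p1 (max q1 q2) I \<le> ennreal (interpolation_const p1 p2 q1 q2 \<alpha> 1) *
      (BB_norm T m \<alpha> p1 q1 A + ennreal (T powr (1 - recip p2 - \<alpha> + recip p1) * K))"
  proof (rule generalized_integral_bounds[where c = ?c])
    show "(\<integral>\<^sup>+r. ennreal (vnorm m (remainder A I r (r + h)) powr p) \<partial>restrict_space lborel {0..T - h})
       \<le> ennreal ((?c * (\<Phi> + M) * h powr 1) powr p)"
      if that': "0 < p" "p2 = ennreal p" "BB3_norm T m 1 p2 q2 (delta A) = ennreal \<Phi>" "0 \<le> \<Phi>" "0 < h" "h \<le> T / 2" for p \<Phi> h
    proof -
      have "1 < p" using p2(1) that'(1,2) by (simp add: ennreal_less_iff flip: ennreal_1)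
      then show ?thesis
        using that' T q2 asm bd
        by (intro remainder_integral_le_BB3_norm_critical) auto
    qed
    show "recip p2 < 1" using p by simp
  qed (use T p2_pos p2 q2 asm bd fin c in auto)
  obtain R where R: "continuous_version T m (remainder A I) R"
    "\<And>s t. 0 \<le> s \<Longrightarrow> s < t \<Longrightarrow> t \<le> T \<Longrightarrow> vnorm m (R s t) \<le> holder_const p2 1 * K * (t - s) powr (1 - recip p2)"
    using K(4) by blast
  have "(SUP (s, t)\<in>{(s, t). 0 \<le> s \<and> s < t \<and> t \<le> T}.
         ennreal (vnorm m (R s t) / (((t - s) * l q2 (t - s)) * (t - s) powr (- recip p2))))
      \<le> ennreal (holder_const p2 1 * K / l q2 T)"
  proof (rule SUP_least, clarify)
    fix s t assume st: "0 \<le> s" "s < t" "t \<le> T"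
    define h where "h = t - s"
    have h: "0 < h" "h \<le> T" using st by (auto simp: h_def)
    have eq: "h * l q2 h * h powr (- recip p2) = l q2 h * h powr (1 - recip p2)"
      using h by (simp add: powr_diff powr_minus field_simps)
    have "vnorm m (R s t) / (l q2 h * h powr (1 - recip p2))
      \<le> holder_const p2 1 * K * h powr (1 - recip p2) / (l q2 h * h powr (1 - recip p2))"
      using R(2)[OF st] l_pos[OF h] by (intro divide_right_mono) (auto simp: h_def)
    also have "\<dots> = holder_const p2 1 * K / l q2 h" using h by simp
    also have "\<dots> \<le> holder_const p2 1 * K / l q2 T"
      using K(1,3) l_ge[OF h] lT by (intro divide_left_mono) (auto intro!: mult_pos_pos)
    finally show "ennreal (vnorm m (R s t) / (((t - s) * l q2 (t - s)) * (t - s) powr (- recip p2)))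
        \<le> ennreal (holder_const p2 1 * K / l q2 T)"
      unfolding h_def[symmetric] eq by (rule ennreal_leI)
  qed
  also have "\<dots> = ennreal (holder_const p2 1 / l q2 T) * ennreal K"
    using K(1,3) lT by (simp add: ennreal_mult[symmetric])
  also have "\<dots> = ennreal (holder_const p2 1 * ?c / l q2 T) * (BB3_norm T m 1 p2 q2 (delta A) + ennreal M)"
  proof -
    have "ennreal (holder_const p2 1 * ?c / l q2 T) = ennreal (holder_const p2 1 / l q2 T) * ennreal ?c"
      using K(3) c lT by (simp add: ennreal_mult[symmetric])
    then show ?thesis unfolding K(2) by (simp only: mult.assoc)
  qed
  finally show "\<exists>R. continuous_version T m (remainder A I) R \<and>
      (SUP (s, t)\<in>{(s, t). 0 \<le> s \<and> s < t \<and> t \<le> T}.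
         ennreal (vnorm m (R s t) / (((t - s) * l q2 (t - s)) * (t - s) powr (- recip p2))))
      \<le> ennreal (holder_const p2 1 * ?c / l q2 T) * (BB3_norm T m 1 p2 q2 (delta A) + ennreal M)"
    using R(1) by blast
  let ?T = "T powr (1 - recip p2 - \<alpha> + recip p1)" and ?B = "BB3_norm T m 1 p2 q2 (delta A) + ennreal M"
  let ?D = "max 0 (interpolation_const p1 p2 q1 q2 \<alpha> 1)" and ?w = "?c * max 1 (1 / l q2 T)"
  have w: "1 \<le> ?w" using mult_mono[OF c, of 1 "max 1 (1 / l q2 T)"] c by simp
  \<comment> \<open>The factor \<open>l q2 T * max 1 (1 / l q2 T)\<close>, which is at least 1, is
    inserted so that \<open>l q2 T\<close> appears explicitly; its companion goes into the constant
    \<open>?w\<close>, which stays at least 1.\<close>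
  have TK: "ennreal (?T * K) \<le> ennreal (?T * l q2 T) * (ennreal ?w * ?B)"
  proof -
    have "1 \<le> l q2 T * max 1 (1 / l q2 T)"
      using mult_left_mono[of "1 / l q2 T" "max 1 (1 / l q2 T)" "l q2 T"] lT by simp
    then have "?T * K * 1 \<le> ?T * K * (l q2 T * max 1 (1 / l q2 T))"
      using K(1) by (intro mult_left_mono) auto
    then have "ennreal (?T * K) \<le> ennreal (?T * K * (l q2 T * max 1 (1 / l q2 T)))"
      by (intro ennreal_leI) simp
    also have "\<dots> = ennreal (?T * l q2 T) * (ennreal (max 1 (1 / l q2 T)) * ennreal K)"
      using K(1) lT by (simp add: ennreal_mult[symmetric] mult_ac)
    also have "\<dots> = ennreal (?T * l q2 T) * (ennreal ?w * ?B)"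
      using c unfolding K(2) by (subst ennreal_mult'[of ?c]) (auto simp: mult_ac)
    finally show ?thesis .
  qed
  have "Besov_seminorm T m \<alpha> p1 (max q1 q2) I \<le> ennreal (interpolation_const p1 p2 q1 q2 \<alpha> 1) *
      (BB_norm T m \<alpha> p1 q1 A + ennreal (?T * K))"
    by (rule K(5))
  also have "\<dots> \<le> ennreal ?D * (BB_norm T m \<alpha> p1 q1 A + ennreal (?T * l q2 T) * (ennreal ?w * ?B))"
    by (rule mult_mono[OF ennreal_leI add_left_mono[OF TK]]) auto
  also have "\<dots> \<le> ennreal (?D * ?w) * (BB_norm T m \<alpha> p1 q1 A + ennreal (?T * l q2 T) * ?B)"
    by (rule ennreal_mult_add_le[OF w]) simp
  finally show "Besov_seminorm T m \<alpha> p1 (max q1 q2) I \<le> \<dots>" .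
qed

theorem theorem3p3:
  shows
    "(\<exists>(C1 :: ennreal \<Rightarrow> ennreal \<Rightarrow> real \<Rightarrow> real \<Rightarrow> real)
       (C2 :: ennreal \<Rightarrow> ennreal \<Rightarrow> ennreal \<Rightarrow> ennreal \<Rightarrow> real \<Rightarrow> real \<Rightarrow> real \<Rightarrow> real).
        \<forall>p1 p2 q1 q2 \<alpha> \<gamma> \<theta> (T :: real) (m :: nat) (A :: real \<Rightarrow> real \<Rightarrow> nat \<Rightarrow> real) (M :: real) I.
          0 < p1 \<and> 0 < p2 \<and> 0 < q1 \<and> 0 < q2 \<and> 0 < \<alpha> \<and> \<alpha> < 1 \<and>
          max 1 (recip p2) < \<gamma> \<and> p2 < p1 \<and> \<gamma> - recip p2 > \<alpha> - recip p1 \<and>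
          0 < \<theta> \<and> \<theta> < 1/2 \<and> 0 < M \<and> 0 < T \<and>
          map2_measurable T m A \<and>
          BB_norm T m \<alpha> p1 q1 A + BB3_norm T m \<gamma> p2 q2 (delta A) < \<infinity> \<and>
          delta_bound T m \<theta> (\<gamma> - recip p2) M A \<and>
          generalized_integral T m p1 p2 q1 q2 \<alpha> \<gamma> A I
          \<longrightarrow>
          CC_norm T m (\<gamma> - recip p2) (remainder A I)
            \<le> ennreal (C1 p2 q2 \<gamma> \<theta>) * (BB3_norm T m \<gamma> p2 q2 (delta A) + ennreal M) \<and>
          Besov_seminorm T m \<alpha> p1 (max q1 q2) I
            \<le> ennreal (C2 p1 p2 q1 q2 \<alpha> \<gamma> \<theta>) *
               (BB_norm T m \<alpha> p1 q1 A +
                ennreal (T powr (\<gamma> - recip p2 - \<alpha> + recip p1)) *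
                  (BB3_norm T m \<gamma> p2 q2 (delta A) + ennreal M)))
     \<and>
     (\<forall>(T :: real) l. 0 < T \<and> log_like T l \<longrightarrow>
       (\<exists>(C1 :: ennreal \<Rightarrow> ennreal \<Rightarrow> real \<Rightarrow> real)
          (C2 :: ennreal \<Rightarrow> ennreal \<Rightarrow> ennreal \<Rightarrow> ennreal \<Rightarrow> real \<Rightarrow> real \<Rightarrow> real).
        \<forall>p1 p2 q1 q2 \<alpha> \<theta> (m :: nat) (A :: real \<Rightarrow> real \<Rightarrow> nat \<Rightarrow> real) (M :: real) I.
          0 < q2 \<and> q2 \<le> 1 \<and> 1 < p2 \<and> p2 < p1 \<and> 0 < q1 \<and> 0 < \<alpha> \<and> \<alpha> < 1 \<and>
          1 - recip p2 > \<alpha> - recip p1 \<and>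
          0 < \<theta> \<and> \<theta> < 1/2 \<and> 0 < M \<and>
          map2_measurable T m A \<and>
          BB_norm T m \<alpha> p1 q1 A + BB3_norm T m 1 p2 q2 (delta A) < \<infinity> \<and>
          delta_bound T m \<theta> (1 - recip p2) M A \<and>
          generalized_integral T m p1 p2 q1 q2 \<alpha> 1 A I
          \<longrightarrow>
          (\<exists>R. continuous_version T m (remainder A I) R \<and>
            (SUP (s, t)\<in>{(s, t). 0 \<le> s \<and> s < t \<and> t \<le> T}.
               ennreal (vnorm m (R s t) /
                 (((t - s) * l q2 (t - s)) * (t - s) powr (- recip p2))))
            \<le> ennreal (C1 p2 q2 \<theta>) * (BB3_norm T m 1 p2 q2 (delta A) + ennreal M)) \<and>
          Besov_seminorm T m \<alpha> p1 (max q1 q2) I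
            \<le> ennreal (C2 p1 p2 q1 q2 \<alpha> \<theta>) *
               (BB_norm T m \<alpha> p1 q1 A +
                ennreal (T powr (1 - recip p2 - \<alpha> + recip p1) * l q2 T) *
                  (BB3_norm T m 1 p2 q2 (delta A) + ennreal M))))"
proof (rule conjI, goal_cases)
  case 1
  show ?case
    by (rule exI[of _ "\<lambda>p2 q2 \<gamma> \<theta>. holder_const p2 \<gamma> * sewing_const (enn2real p2) q2 \<gamma>"],
        rule exI[of _ "\<lambda>p1 p2 q1 q2 \<alpha> \<gamma> \<theta>.
          max 0 (interpolation_const p1 p2 q1 q2 \<alpha> \<gamma>) * sewing_const (enn2real p2) q2 \<gamma>"],
        intro allI impI conjI; elim conjE; rule supercritical_bounds; assumption)
next
  case 2
  show ?case
  proof (intro allI impI, elim conjE, goal_cases)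
    case (1 T l)
    show ?case
      by (rule exI[of _ "\<lambda>p2 q2 \<theta>. holder_const p2 1 * critical_sewing_const q2 / l q2 T"],
          rule exI[of _ "\<lambda>p1 p2 q1 q2 \<alpha> \<theta>. max 0 (interpolation_const p1 p2 q1 q2 \<alpha> 1)
            * (critical_sewing_const q2 * max 1 (1 / l q2 T))"],
          intro allI impI conjI; elim conjE; rule critical_bounds[OF 1]; assumption)
  qed
qed

end
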